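(* Suppose that $1<p\le2$ and $0<s<1$, let $\frac1p+\frac1{p'}=1$, and let $g$ be an analytic function in $\mathbb{D}$. The following statements hold. (i) If $T_g$ maps $B^p$ into $Q_s$, then $g\in Q_{s,\log,1/p'}$. (ii) If $\alpha>1/2$ and $g\in Q_{s,\log,\alpha}$, then $T_g$ maps $B^p$ into $Q_s$.
   Context: $\mathbb{D}$ is the open unit disc in $\mathbb{C}$ and $dA$ is the normalized Lebesgue area measure on $\mathbb{D}$. For $a\in\mathbb{D}$, $\varphi_a(z)=\frac{a-z}{1-\overline{a}z}$. For $1<p<\infty$, the Besov space $B^p$ is the space of all analytic $f$ in $\mathbb{D}$ with $\int_{\mathbb{D}}(1-|z|)^{p-2}|f'(z)|^p\,dA(z)<\infty$. For $0<s<\infty$, $Q_s$ is the space of all analytic $f$ in $\mathbb{D}$ with $\sup_{a\in\mathbb{D}}\int_{\mathbb{D}}|f'(z)|^2 g(z,a)^s\,dA(z)<\infty$, where $g(z,a)=\log\frac{|1-\overline{a}z|}{|a-z|}$ is the Green function; equivalently (a known fact), $\sup_{a\in\mathbb{D}}\int_{\mathbb{D}}|f'(z)|^2(1-|\varphi_a(z)|^2)^s\,dA(z)<\infty$. For $0<s<\infty$ and $\alpha>0$, $Q_{s,\log,\alpha}$ is the space of all analytic $f$ in $\mathbb{D}$ with $\sup_{a\in\mathbb{D}}\left(\log\frac{2}{1-|a|}\right)^{2\alpha}\int_{\mathbb{D}}|f'(z)|^2(1-|\varphi_a(z)|^2)^s\,dA(z)<\infty$. For $g$ and $f$ analytic in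 $\mathbb{D}$ and $z\in\mathbb{D}$: $T_g(f)(z)=\int_0^z g'(\xi)f(\xi)\,d\xi$. $T_g$ maps $X$ into $Y$ if $T_g(X)\subset Y$. *)

theory Defs
  imports "HOL-Analysis.Analysis" "HOL-Complex_Analysis.Complex_Analysis"
begin

abbreviation unit_disc :: "complex set" where
  "unit_disc \<equiv> ball 0 1"

definition disc_area :: "complex measure" where
  "disc_area = uniform_measure lborel unit_disc"

definition phi :: "complex \<Rightarrow> complex \<Rightarrow> complex" where
  "phi a z = (a - z) / (1 - cnj a * z)"

text \<open>The Green function of the disc has a logarithmic pole at \<open>z = a\<close>; there the HOL
  conventions \<open>x / 0 = 0\<close> and \<open>ln 0 = 0\<close> give the value \<open>0\<close>. As a function of \<open>z\<close> it is
  only ever integrated against \<open>disc_area\<close>, for which \<open>{a}\<close> is a null set.\<close>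

definition green :: "complex \<Rightarrow> complex \<Rightarrow> real" where
  "green z a = ln (cmod (1 - cnj a * z) / cmod (a - z))"

text \<open>The spaces below are sets of total functions on \<open>complex\<close>, but membership only depends
  on the values on the (open) unit disc. All integrals and suprema are taken in \<open>ennreal\<close>, so
  that \<open>< \<infinity>\<close> is genuine finiteness.\<close>

definition besov :: "real \<Rightarrow> (complex \<Rightarrow> complex) set" where
  "besov p = {f. f holomorphic_on unit_disc \<and>
     (\<integral>\<^sup>+z. ennreal ((1 - cmod z) powr (p - 2) * cmod (deriv f z) powr p) \<partial>disc_area) < \<infinity>}"

definition Q_space :: "real \<Rightarrow> (complex \<Rightarrow> complex) set" where
  "Q_space s = {f. f holomorphic_on unit_disc \<and>
     (SUP a\<in>unit_disc.
        \<integral>\<^sup>+z. ennreal ((cmod (deriv f z))\<^sup>2 * green z a powr s) \<partial>disc_area) < \<infinity>}"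

definition Q_log_space :: "real \<Rightarrow> real \<Rightarrow> (complex \<Rightarrow> complex) set" where
  "Q_log_space s \<alpha> = {f. f holomorphic_on unit_disc \<and>
     (SUP a\<in>unit_disc.
        ennreal (ln (2 / (1 - cmod a)) powr (2 * \<alpha>)) *
        (\<integral>\<^sup>+z. ennreal ((cmod (deriv f z))\<^sup>2 * (1 - (cmod (phi a z))\<^sup>2) powr s) \<partial>disc_area)) < \<infinity>}"

text \<open>For \<open>z\<close> in the disc and \<open>f\<close>, \<open>g\<close> holomorphic there, the integral does not depend on the
  path from \<open>0\<close> to \<open>z\<close>; we integrate along the line segment.\<close>

definition T_op :: "(complex \<Rightarrow> complex) \<Rightarrow> (complex \<Rightarrow> complex) \<Rightarrow> complex \<Rightarrow> complex" where
  "T_op g f z = contour_integral (linepath 0 z) (\<lambda>\<xi>. deriv g \<xi> * f \<xi>)"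

end

theory Submission
  imports Defs "HOL-Probability.Probability_Measure"
begin

text \<open>
  Write \<open>w_a(z) = (1 - |phi a z|\<^sup>2)\<^sup>s\<close> and \<open>L_a = ln (2 / (1 - |a|))\<close>. By the mean value property near
  the pole, the Green function may be replaced by \<open>w_a\<close>, and \<open>(T_g f)' = g' f\<close>.

  Sufficiency: as \<open>p \<le> 2\<close>, \<open>f\<close> lies in the Dirichlet space, where
  \<open>f(z) - f(a) = \<integral> f'(u) (z - a) / ((1 - cnj u * z) (1 - cnj u * a)) dA(u)\<close>. Cauchy--Schwarz gives
  \<open>|f(a)|\<^sup>2 \<le> C L_a\<close> and \<open>|f(z) - f(a)|\<^sup>2 w_a(z) \<le> C \<integral> |f'(u)|\<^sup>2 w_u(z) dA(u)\<close>. Integrating against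
  \<open>|g'|\<^sup>2\<close>, the constant part \<open>f(a)\<close> is paid for by the logarithm in the hypothesis on \<open>g\<close>, and
  the oscillation only needs \<open>sup_u \<integral> |g'|\<^sup>2 w_u < \<infinity>\<close>.

  Necessity: the functions \<open>f_a(z) = L_a powr (-1/p) Log (2 / (1 - cnj a * z))\<close> are bounded in the
  Besov space and have nonnegative real part. If \<open>\<integral> |g'|\<^sup>2 (Re f_a)\<^sup>2 w_a\<close> were unbounded along
  a rapid sequence \<open>a_n\<close>, then \<open>f = \<Sum> 2\<^sup>-\<^sup>n f_(a_n)\<close> would violate the hypothesis because
  \<open>|f| \<ge> 2\<^sup>-\<^sup>n Re f_(a_n)\<close>; no closed graph theorem is needed. Finally
  \<open>L_a = ln (2 / |1 - cnj a * z|) + ln t\<close> with \<open>t = |1 - cnj a * z| / (1 - |a|)\<close>, and \<open>ln\<^sup>2 t\<close> is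
  absorbed by the decay of \<open>w_a\<close> away from \<open>a\<close>.
\<close>

text \<open>For sufficiency the obstacle is that \<open>f\<close> runs through a whole space while
  \<open>g\<close> is tested only against the weights \<open>w_u\<close>. Cauchy--Schwarz is
  therefore applied with \<open>w_u(z)\<close> itself as weight in the integration variable
  \<open>u\<close>: after Fubini the \<open>z\<close>-integral is again a tested mass, and the
  reciprocal weight enters a two-point kernel integral that is estimated on dyadic shells.

  For necessity the exponent comes from normalising the test functions: the Besov integral of the
  unnormalised logarithm is at most a multiple of \<open>L_a\<close>, and
  \<open>L_a\<^sup>2 * L_a powr (- 2 / p) = L_a powr (2 / p')\<close>. The logarithm is close to
  \<open>L_a\<close> only near \<open>a\<close>, whereas the integrals extend over the whole disc.
  The defect \<open>ln t\<close> is handled by moving \<open>a\<close> along its radius towards the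
  origin, where the mass of \<open>deriv g\<close> is bounded as well; this last bound comes from
  the constant function \<open>1\<close>.

  Polar coordinates are replaced by two facts: area is invariant under rotations, and the square of
  the modulus is uniformly distributed on the unit interval.\<close>

abbreviation kernel_norm :: "complex \<Rightarrow> complex \<Rightarrow> real" where
  "kernel_norm a z \<equiv> cmod (1 - cnj a * z)"

abbreviation dirichlet_energy :: "(complex \<Rightarrow> complex) \<Rightarrow> ennreal" where
  "dirichlet_energy f \<equiv> (\<integral>\<^sup>+z. ennreal ((cmod (deriv f z))\<^sup>2) \<partial>disc_area)"

section \<open>Area measure on the disc\<close>

text \<open>The Euclidean measure on \<open>complex\<close> is characterised by its values on boxes,
  so it is enough to compare side lengths. This opens iterated integration over real and imaginary
  parts.\<close>

lemma lborel_complex_eq_distr: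
  "(lborel :: complex measure) = distr (lborel \<Otimes>\<^sub>M lborel) borel (\<lambda>(x, y). Complex x y)"
proof (rule lborel_eqI)
  have m[measurable]: "(\<lambda>(x, y). Complex x y) \<in> borel_measurable (lborel \<Otimes>\<^sub>M lborel)"
    unfolding Complex_eq case_prod_unfold by measurable
  fix l u :: complex
  assume le: "\<And>b. b \<in> Basis \<Longrightarrow> l \<bullet> b \<le> u \<bullet> b"
  then have "Re l \<le> Re u" "Im l \<le> Im u"
    using le[of 1] le[of \<i>] by (auto simp: Basis_complex_def)
  moreover have "(\<lambda>(x, y). Complex x y) -` box l u \<inter> space (lborel \<Otimes>\<^sub>M lborel)
      = box (Re l) (Re u) \<times> box (Im l) (Im u)"
    by (auto simp: box_def Basis_complex_def space_pair_measure)
  ultimately show "emeasure (distr (lborel \<Otimes>\<^sub>M lborel) borel (\<lambda>(x, y). Complex x y)) (box l u)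
      = (\<Prod>b\<in>Basis. (u - l) \<bullet> b)"
    by (simp add: emeasure_distr lborel.emeasure_pair_measure_Times Basis_complex_def
        ennreal_mult' emeasure_lborel_box_eq del: box_real)
qed simp

lemma nn_integral_lborel_complex:
  assumes [measurable]: "f \<in> borel_measurable borel"
  shows "(\<integral>\<^sup>+z. f z \<partial>lborel) = (\<integral>\<^sup>+y. \<integral>\<^sup>+x. f (Complex x y) \<partial>lborel \<partial>lborel)"
    and "(\<integral>\<^sup>+z. f z \<partial>lborel) = (\<integral>\<^sup>+x. \<integral>\<^sup>+y. f (Complex x y) \<partial>lborel \<partial>lborel)"
proof -
  have [measurable]: "(\<lambda>(x, y). Complex x y) \<in> borel_measurable (lborel \<Otimes>\<^sub>M lborel)"
    unfolding Complex_eq case_prod_unfold by measurable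
  have "(\<integral>\<^sup>+z. f z \<partial>lborel) = (\<integral>\<^sup>+q. f (case q of (x, y) \<Rightarrow> Complex x y) \<partial>(lborel \<Otimes>\<^sub>M lborel))"
    by (subst lborel_complex_eq_distr, subst nn_integral_distr) auto
  moreover have "(\<integral>\<^sup>+q. f (case q of (x, y) \<Rightarrow> Complex x y) \<partial>(lborel \<Otimes>\<^sub>M lborel))
      = (\<integral>\<^sup>+x. \<integral>\<^sup>+y. f (Complex x y) \<partial>lborel \<partial>lborel)"
    by (subst lborel.nn_integral_fst[symmetric]) auto
  moreover have "(\<integral>\<^sup>+q. f (case q of (x, y) \<Rightarrow> Complex x y) \<partial>(lborel \<Otimes>\<^sub>M lborel))
      = (\<integral>\<^sup>+y. \<integral>\<^sup>+x. f (Complex x y) \<partial>lborel \<partial>lborel)"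
    by (subst lborel_pair.nn_integral_snd[symmetric]) auto
  ultimately show "(\<integral>\<^sup>+z. f z \<partial>lborel) = (\<integral>\<^sup>+y. \<integral>\<^sup>+x. f (Complex x y) \<partial>lborel \<partial>lborel)"
    and "(\<integral>\<^sup>+z. f z \<partial>lborel) = (\<integral>\<^sup>+x. \<integral>\<^sup>+y. f (Complex x y) \<partial>lborel \<partial>lborel)"
    by simp_all
qed

lemma measurable_Complex[measurable (raw)]:
  assumes [measurable]: "f \<in> borel_measurable M" "g \<in> borel_measurable M"
  shows "(\<lambda>x. Complex (f x) (g x)) \<in> borel_measurable M"
  unfolding Complex_eq by measurable

text \<open>A rotation with nonzero cosine factors into two affine changes of one real coordinate each.\<close>

lemma nn_integral_lborel_rotate_aux:
  assumes [measurable]: "f \<in> borel_measurable borel" and "cmod u = 1" "Re u \<noteq> 0"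
  shows "(\<integral>\<^sup>+z. f (u * z) \<partial>lborel) = (\<integral>\<^sup>+z. f z \<partial>lborel)"
proof -
  define c s where "c = Re u" and "s = Im u"
  have c: "c \<noteq> 0" and cs: "c * c + s * s = 1"
    using assms(2,3) by (simp_all add: c_def s_def cmod_def power2_eq_square)
  have s2: "c * (c * y) + s * (s * y) = y" for y
    using cs by (metis distrib_right mult.assoc mult_1)
  have u: "u = Complex c s" by (simp add: c_def s_def)
  have *: "ennreal \<bar>c\<bar> * (ennreal \<bar>1 / c\<bar> * A) = A" for A
    using c by (simp add: mult.assoc[symmetric] ennreal_mult'[symmetric])
  have "(\<integral>\<^sup>+z. f (u * z) \<partial>lborel)
      = (\<integral>\<^sup>+y. \<integral>\<^sup>+x. f (u * Complex x y) \<partial>lborel \<partial>lborel)"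
    by (rule nn_integral_lborel_complex) simp
  \<comment> \<open>With \<open>x' = c * x - s * y\<close> the imaginary part
    \<open>s * x + c * y\<close> equals \<open>s / c * x' + y / c\<close>, because
    \<open>c * c + s * s = 1\<close>. Thus \<open>x\<close> can be substituted for fixed
    \<open>y\<close>, and afterwards \<open>y\<close> for fixed \<open>x'\<close>; the two Jacobians
    \<open>1 / c\<close> and \<open>c\<close> cancel.\<close>
  also have "\<dots> = (\<integral>\<^sup>+y. \<integral>\<^sup>+x. f (Complex (- s * y + c * x) (s / c * (- s * y + c * x) + y / c)) \<partial>lborel \<partial>lborel)"
  proof -
    have "u * Complex x y = Complex (- s * y + c * x) (s / c * (- s * y + c * x) + y / c)" for x y
      using c by (simp add: u complex_eq_iff field_simps s2)
    then show ?thesis by simp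
  qed
  also have "\<dots> = (\<integral>\<^sup>+y. ennreal \<bar>1 / c\<bar> * (\<integral>\<^sup>+x. f (Complex x (s / c * x + y / c)) \<partial>lborel) \<partial>lborel)"
  proof (intro nn_integral_cong)
    fix y
    have "(\<integral>\<^sup>+x. f (Complex x (s / c * x + y / c)) \<partial>lborel)
        = ennreal \<bar>c\<bar> * (\<integral>\<^sup>+x. f (Complex (- s * y + c * x) (s / c * (- s * y + c * x) + y / c)) \<partial>lborel)"
      by (rule nn_integral_real_affine[OF _ c]) simp
    then show "(\<integral>\<^sup>+x. f (Complex (- s * y + c * x) (s / c * (- s * y + c * x) + y / c)) \<partial>lborel)
        = ennreal \<bar>1 / c\<bar> * (\<integral>\<^sup>+x. f (Complex x (s / c * x + y / c)) \<partial>lborel)"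
      using *[symmetric] by (simp add: mult.left_commute)
  qed
  also have "\<dots> = ennreal \<bar>1 / c\<bar> * (\<integral>\<^sup>+y. \<integral>\<^sup>+x. f (Complex x (s / c * x + y / c)) \<partial>lborel \<partial>lborel)"
    by (rule nn_integral_cmult) measurable
  also have "(\<integral>\<^sup>+y. \<integral>\<^sup>+x. f (Complex x (s / c * x + y / c)) \<partial>lborel \<partial>lborel)
      = (\<integral>\<^sup>+x. \<integral>\<^sup>+y. f (Complex x (s / c * x + y / c)) \<partial>lborel \<partial>lborel)"
    by (rule lborel_pair.Fubini') measurable
  also have "\<dots> = (\<integral>\<^sup>+x. ennreal \<bar>c\<bar> * (\<integral>\<^sup>+y. f (Complex x y) \<partial>lborel) \<partial>lborel)"
  proof (intro nn_integral_cong)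
    fix x
    have "(\<integral>\<^sup>+y. f (Complex x y) \<partial>lborel)
        = ennreal \<bar>1 / c\<bar> * (\<integral>\<^sup>+y. f (Complex x (s / c * x + (1 / c) * y)) \<partial>lborel)"
      by (rule nn_integral_real_affine) (use c in auto)
    then show "(\<integral>\<^sup>+y. f (Complex x (s / c * x + y / c)) \<partial>lborel)
        = ennreal \<bar>c\<bar> * (\<integral>\<^sup>+y. f (Complex x y) \<partial>lborel)"
      using * by simp
  qed
  also have "\<dots> = ennreal \<bar>c\<bar> * (\<integral>\<^sup>+x. \<integral>\<^sup>+y. f (Complex x y) \<partial>lborel \<partial>lborel)"
    by (rule nn_integral_cmult) measurable
  also have "(\<integral>\<^sup>+x. \<integral>\<^sup>+y. f (Complex x y) \<partial>lborel \<partial>lborel) = (\<integral>\<^sup>+z. f z \<partial>lborel)"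
    by (rule nn_integral_lborel_complex(2)[symmetric]) simp
  finally show ?thesis using * by (simp add: mult.left_commute)
qed

lemma nn_integral_lborel_rotate:
  assumes [measurable]: "f \<in> borel_measurable borel" and u: "cmod u = 1"
  shows "(\<integral>\<^sup>+z. f (u * z) \<partial>lborel) = (\<integral>\<^sup>+z. f z \<partial>lborel)"
proof (cases "Re u = 0")
  case True
  \<comment> \<open>A purely imaginary \<open>u\<close> is split into an eighth of a turn and the
    remaining rotation; both have nonzero real part.\<close>
  define v where "v = cis (pi / 4)"
  have v: "cmod v = 1" "Re v \<noteq> 0" by (auto simp: v_def cos_45)
  have "Re (u * inverse v) \<noteq> 0"
  proof -
    have "Im u \<noteq> 0" using True u by (auto simp: cmod_def)
    then show ?thesis using True by (simp add: v_def cis_inverse sin_45)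
  qed
  moreover have "cmod (u * inverse v) = 1" using u v by (simp add: norm_mult norm_inverse)
  ultimately have "(\<integral>\<^sup>+z. f (u * inverse v * (v * z)) \<partial>lborel) = (\<integral>\<^sup>+z. f z \<partial>lborel)"
    using nn_integral_lborel_rotate_aux[of "\<lambda>z. f (u * inverse v * z)" v]
      nn_integral_lborel_rotate_aux[of f "u * inverse v"] v by simp
  moreover have "u * inverse v * (v * z) = u * z" for z
  proof -
    have "v \<noteq> 0" using v(1) by auto
    then show ?thesis by simp
  qed
  ultimately show ?thesis by simp
qed (use assms nn_integral_lborel_rotate_aux in auto)

section \<open>Normalised area: rotation invariance and the radial distribution\<close>

lemma emeasure_lborel_unit_disc: "emeasure lborel unit_disc = ennreal pi"
  by (simp add: emeasure_ball unit_ball_vol_2)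

lemma sets_disc_area[measurable_cong, simp]: "sets disc_area = sets borel"
  and space_disc_area[simp]: "space disc_area = UNIV"
  by (simp_all add: disc_area_def)

lemma AE_disc_area: "AE z in disc_area. z \<in> unit_disc"
  unfolding disc_area_def by (rule AE_uniform_measureI) auto

lemma prob_space_disc_area: "prob_space disc_area"
  unfolding disc_area_def
  by (rule prob_space_uniform_measure) (simp_all add: emeasure_lborel_unit_disc)

interpretation disc_area: prob_space disc_area
  by (rule prob_space_disc_area)

lemma nn_integral_disc_area:
  assumes [measurable]: "f \<in> borel_measurable borel"
  shows "(\<integral>\<^sup>+z. f z \<partial>disc_area) = (\<integral>\<^sup>+z. f z * indicator unit_disc z \<partial>lborel) / ennreal pi"
  unfolding disc_area_def
  by (subst nn_integral_uniform_measure) (simp_all add: emeasure_lborel_unit_disc)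

lemma nn_integral_disc_area_rotate:
  assumes [measurable]: "f \<in> borel_measurable borel" and u: "cmod u = 1"
  shows "(\<integral>\<^sup>+z. f (u * z) \<partial>disc_area) = (\<integral>\<^sup>+z. f z \<partial>disc_area)"
proof -
  have "indicator unit_disc (u * z) = (indicator unit_disc z :: ennreal)" for z
    using u by (simp add: indicator_def norm_mult)
  moreover have "(\<lambda>z. f z * indicator unit_disc z) \<in> borel_measurable borel"
    by (intro borel_measurable_times_ennreal borel_measurable_indicator) auto
  ultimately show ?thesis
    using nn_integral_lborel_rotate[of "\<lambda>z. f z * indicator unit_disc z" u] u
    by (simp add: nn_integral_disc_area)
qed

lemma distr_disc_area_rotate:
  assumes u: "cmod u = 1"
  shows "distr disc_area borel ((*) u) = disc_area"
proof (rule measure_eqI)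
  fix A assume "A \<in> sets (distr disc_area borel ((*) u))"
  then have [measurable]: "A \<in> sets borel" by simp
  show "emeasure (distr disc_area borel ((*) u)) A = emeasure disc_area A"
    using nn_integral_disc_area_rotate[of "indicator A" u] u
    by (simp add: nn_integral_distr flip: nn_integral_indicator)
qed simp

text \<open>The disc of radius \<open>sqrt a\<close> has normalised area \<open>a\<close>, so both
  measures agree on the half-lines \<open>{..a}\<close>, which form a generating family closed under
  intersection.\<close>

lemma disc_area_radial:
  "distr disc_area borel (\<lambda>z. (cmod z)\<^sup>2) = uniform_measure lborel {0..1}"
proof (rule measure_eqI_generator_eq[where E = "range (\<lambda>a::real. {..a})" and \<Omega> = UNIV
      and A = "\<lambda>n. {..real n}"])
  show "Int_stable (range (\<lambda>a::real. {..a}))"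
    by (auto simp: Int_stable_def)
  show "sets (distr disc_area borel (\<lambda>z. (cmod z)\<^sup>2)) = sigma_sets UNIV (range (\<lambda>a::real. {..a}))"
    "sets (uniform_measure lborel {0..1::real}) = sigma_sets UNIV (range (\<lambda>a::real. {..a}))"
    by (simp_all add: borel_eq_atMost)
  fix X assume "X \<in> range (\<lambda>a::real. {..a})"
  then obtain a where X: "X = {..a}" by auto
  have "emeasure (distr disc_area borel (\<lambda>z. (cmod z)\<^sup>2)) {..a} = emeasure disc_area {z. (cmod z)\<^sup>2 \<le> a}"
    by (subst emeasure_distr) (auto simp: vimage_def)
  also have "\<dots> = ennreal (min 1 (max 0 a))"
  proof -
    have "emeasure disc_area {z. (cmod z)\<^sup>2 \<le> a} = emeasure lborel (unit_disc \<inter> {z. (cmod z)\<^sup>2 \<le> a}) / ennreal pi"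
      unfolding disc_area_def by (subst emeasure_uniform_measure) (simp_all add: emeasure_lborel_unit_disc)
    also have "emeasure lborel (unit_disc \<inter> {z. (cmod z)\<^sup>2 \<le> a}) = ennreal (pi * min 1 (max 0 a))"
    proof -
      consider "a < 0" | "a \<ge> 1" | "0 \<le> a" "a < 1" by linarith
      then show ?thesis
      proof cases
        case 1
        then have "{z. (cmod z)\<^sup>2 \<le> a} = {}"
          using zero_le_power2 by (auto simp: not_le intro: less_le_trans)
        then show ?thesis using 1 by simp
      next
        case 2
        have "(cmod z)\<^sup>2 \<le> a" if "z \<in> unit_disc" for z
          using that 2 power_le_one[of "cmod z" 2] by auto
        then have "unit_disc \<inter> {z. (cmod z)\<^sup>2 \<le> a} = unit_disc" by blast
        then show ?thesis using 2 by (simp add: emeasure_lborel_unit_disc)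
      next
        case 3
        have "unit_disc \<inter> {z. (cmod z)\<^sup>2 \<le> a} = cball 0 (sqrt a)"
        proof -
          have *: "(cmod z)\<^sup>2 \<le> a \<longleftrightarrow> cmod z \<le> sqrt a" for z
            using real_sqrt_le_iff[of "(cmod z)\<^sup>2" a] by simp
          have a1: "sqrt a < 1" using 3 by simp
          then have "z \<in> unit_disc" if "cmod z \<le> sqrt a" for z
            using le_less_trans[OF that a1] by simp
          then show ?thesis unfolding * by (auto simp del: real_sqrt_lt_1_iff)
        qed
        then show ?thesis using 3 by (simp add: emeasure_cball unit_ball_vol_2)
      qed
    qed
    finally show ?thesis by (simp add: divide_ennreal)
  qed
  also have "\<dots> = emeasure (uniform_measure lborel {0..1}) {..a}"
  proof -
    have "{0..1} \<inter> {..a} = {0..min 1 a}" by auto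
    then have "emeasure (uniform_measure lborel {0..1}) {..a} = emeasure lborel {0..min 1 a}"
      by (subst emeasure_uniform_measure) (simp_all add: divide_ennreal_def)
    also have "\<dots> = ennreal (min 1 (max 0 a))"
      by (cases "a < 0") auto
    finally show ?thesis ..
  qed
  finally show "emeasure (distr disc_area borel (\<lambda>z. (cmod z)\<^sup>2)) X = emeasure (uniform_measure lborel {0..1}) X"
    by (simp add: X)
next
  show "(\<Union>n. {..real n}) = UNIV"
    using real_arch_simple by auto
  interpret D: prob_space "distr disc_area borel (\<lambda>z. (cmod z)\<^sup>2)"
    by (rule disc_area.prob_space_distr) simp
  show "emeasure (distr disc_area borel (\<lambda>z. (cmod z)\<^sup>2)) {..real n} \<noteq> \<infinity>" for n
    by (metis D.emeasure_finite infinity_ennreal_def)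
qed auto

section \<open>Integrals of powers of the kernel\<close>

lemma nn_integral_powr_from_0:
  assumes "\<sigma> < 1" "0 \<le> c"
  shows "(\<integral>\<^sup>+x. indicator {0..c} x * ennreal (x powr - \<sigma>) \<partial>lborel) = ennreal (c powr (1 - \<sigma>) / (1 - \<sigma>))"
proof -
  have "((\<lambda>x. x powr - \<sigma>) has_integral (c powr (1 - \<sigma>) / (1 - \<sigma>))) {0..c}"
    using has_integral_powr_from_0[of "- \<sigma>" c] assms by (simp add: algebra_simps)
  from nn_integral_has_integral_lebesgue[OF _ this] show ?thesis
    by (simp add: ennreal_mult ennreal_indicator)
qed

lemma nn_integral_powr_below:
  assumes "\<sigma> < 1" "0 \<le> c"
  shows "(\<integral>\<^sup>+x. indicator {X - c..X} x * ennreal ((X - x) powr - \<sigma>) \<partial>lborel) = ennreal (c powr (1 - \<sigma>) / (1 - \<sigma>))"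
proof -
  have "indicator {X - c..X} (X - x) = (indicator {0..c} x :: ennreal)" for x
    by (auto simp: indicator_def)
  then show ?thesis
    using nn_integral_real_affine[of "\<lambda>x. indicator {X - c..X} x * ennreal ((X - x) powr - \<sigma>)" "-1" X]
      nn_integral_powr_from_0[OF assms]
    by simp
qed

lemma nn_integral_disc_area_radial:
  assumes [measurable]: "k \<in> borel_measurable borel"
  shows "(\<integral>\<^sup>+u. k ((cmod u)\<^sup>2) \<partial>disc_area) = (\<integral>\<^sup>+r. k r * indicator {0..1} r \<partial>lborel)"
proof -
  have "(\<integral>\<^sup>+u. k ((cmod u)\<^sup>2) \<partial>disc_area) = (\<integral>\<^sup>+r. k r \<partial>distr disc_area borel (\<lambda>z. (cmod z)\<^sup>2))"
    by (subst nn_integral_distr) auto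
  also have "\<dots> = (\<integral>\<^sup>+r. k r * indicator {0..1} r \<partial>lborel)"
    unfolding disc_area_radial by (subst nn_integral_uniform_measure) (auto simp: divide_ennreal_def)
  finally show ?thesis .
qed

text \<open>Since \<open>1 - cmod u\<close> is at least half of \<open>1 - (cmod u)\<^sup>2\<close>,
  the integral reduces to a one-dimensional one in the uniformly distributed variable
  \<open>(cmod u)\<^sup>2\<close>. The numerator \<open>2\<close> bounds
  \<open>2 powr \<sigma>\<close>.\<close>

lemma disc_area_powr_total:
  assumes "0 \<le> \<sigma>" "\<sigma> < 1"
  shows "(\<integral>\<^sup>+u. ennreal ((1 - cmod u) powr - \<sigma>) \<partial>disc_area) \<le> ennreal (2 / (1 - \<sigma>))"
proof -
  have "(\<integral>\<^sup>+u. ennreal ((1 - cmod u) powr - \<sigma>) \<partial>disc_area)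
      \<le> (\<integral>\<^sup>+u. ennreal (2 * (1 - (cmod u)\<^sup>2) powr - \<sigma>) \<partial>disc_area)"
  proof (rule nn_integral_mono_AE, use AE_disc_area in eventually_elim)
    fix u assume "u \<in> unit_disc"
    then have u: "cmod u < 1" by simp
    have "(1 - cmod u) powr - \<sigma> \<le> ((1 - (cmod u)\<^sup>2) / 2) powr - \<sigma>"
    proof (rule powr_mono2')
      show "0 < (1 - (cmod u)\<^sup>2) / 2" using u by (simp add: power_less_one_iff)
      have "0 \<le> (1 - cmod u) * (1 - cmod u)" by simp
      then show "(1 - (cmod u)\<^sup>2) / 2 \<le> 1 - cmod u" by (simp add: field_simps power2_eq_square)
    qed (use assms in simp)
    also have "\<dots> = 2 powr \<sigma> * (1 - (cmod u)\<^sup>2) powr - \<sigma>"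
      using u by (simp add: powr_divide powr_minus field_simps power_le_one_iff)
    also have "\<dots> \<le> 2 powr 1 * (1 - (cmod u)\<^sup>2) powr - \<sigma>"
      using assms by (intro mult_right_mono powr_mono) auto
    finally show "ennreal ((1 - cmod u) powr - \<sigma>) \<le> ennreal (2 * (1 - (cmod u)\<^sup>2) powr - \<sigma>)"
      by (intro ennreal_leI) simp
  qed
  also have "\<dots> = (\<integral>\<^sup>+r. ennreal (2 * (1 - r) powr - \<sigma>) * indicator {0..1} r \<partial>lborel)"
    by (rule nn_integral_disc_area_radial) simp
  also have "\<dots> = (\<integral>\<^sup>+r. ennreal 2 * (indicator {1 - 1..1} r * ennreal ((1 - r) powr - \<sigma>)) \<partial>lborel)"
    by (intro nn_integral_cong) (simp add: ennreal_mult mult_ac)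
  also have "\<dots> = ennreal 2 * ennreal (1 powr (1 - \<sigma>) / (1 - \<sigma>))"
    by (subst nn_integral_cmult) (simp, subst nn_integral_powr_below, use assms in auto)
  also have "\<dots> = ennreal (2 / (1 - \<sigma>))"
    using assms ennreal_mult'[of 2 "1 / (1 - \<sigma>)"] by simp
  finally show ?thesis .
qed

text \<open>Compares the radial with the horizontal distance to the circle. With
  \<open>X = sqrt (1 - y\<^sup>2)\<close> and \<open>N\<close> the modulus,
  \<open>X\<^sup>2 - x\<^sup>2\<close> and \<open>1 - N\<^sup>2\<close> are the same number; factor
  both sides.\<close>

lemma one_minus_norm_ge:
  assumes "x\<^sup>2 + y\<^sup>2 < 1" "0 \<le> x"
  shows "sqrt (1 - y\<^sup>2) * (sqrt (1 - y\<^sup>2) - x) / 2 \<le> 1 - cmod (Complex x y)" "x < sqrt (1 - y\<^sup>2)"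
proof -
  define X N where "X = sqrt (1 - y\<^sup>2)" and "N = cmod (Complex x y)"
  show *: "x < sqrt (1 - y\<^sup>2)"
    using assms by (intro real_less_rsqrt) auto
  have y: "y\<^sup>2 \<le> 1" using assms(1) zero_le_power2[of x] by linarith
  have X2: "X * X = 1 - y\<^sup>2" using y by (simp add: X_def)
  have N2: "N * N = x * x + y\<^sup>2" by (simp add: N_def cmod_def power2_eq_square)
  have "N * N < 1 * 1" using assms N2 by (simp add: power2_eq_square)
  then have N1: "N < 1" "0 \<le> N" by (auto simp: N_def mult_less_cancel2 intro: power_less_imp_less_base simp flip: power2_eq_square)
  have "X * (X - x) \<le> (X + x) * (X - x)" using * assms(2) by (intro mult_right_mono) (auto simp: X_def)
  also have "\<dots> = (1 + N) * (1 - N)" using X2 N2 by (simp add: algebra_simps)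
  also have "\<dots> \<le> 2 * (1 - N)" using N1 by (intro mult_right_mono) auto
  finally show "sqrt (1 - y\<^sup>2) * (sqrt (1 - y\<^sup>2) - x) / 2 \<le> 1 - cmod (Complex x y)"
    by (simp add: X_def N_def)
qed

text \<open>For \<open>h < 1 / 4\<close> the set lies in a curved strip along the circle near
  \<open>1\<close>, of horizontal width \<open>h\<close> and height \<open>4 * h\<close>.
  Integrating the boundary singularity horizontally gives
  \<open>h powr (1 - \<sigma>) / (1 - \<sigma>)\<close>, and the height supplies the remaining power
  of \<open>h\<close>.\<close>

lemma disc_area_powr_local:
  assumes \<sigma>: "0 \<le> \<sigma>" "\<sigma> < 1" and h: "0 < h" "h < 1 / 4" and r: "0 \<le> r" "r < 1"
  shows "(\<integral>\<^sup>+u. ennreal ((1 - cmod u) powr - \<sigma>) * indicator {u. cmod (1 - of_real r * u) \<le> h} u \<partial>disc_area)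
    \<le> ennreal (16 / (1 - \<sigma>) * h powr (2 - \<sigma>))"
proof -
  have [measurable]: "{u. cmod (1 - of_real r * u) \<le> h} \<in> sets borel" "unit_disc \<in> sets borel" by measurable
  let ?F = "\<lambda>u. ennreal ((1 - cmod u) powr - \<sigma>) * indicator {u. cmod (1 - of_real r * u) \<le> h} u * indicator unit_disc u"
  \<comment> \<open>The factor \<open>4\<close> bounds \<open>4 powr \<sigma>\<close>, coming from
    \<open>(X - x) / 4 \<le> 1 - cmod u\<close> with
    \<open>X = sqrt (1 - y\<^sup>2) \<ge> 1 / 2\<close>. The range of \<open>y\<close> comes from
    \<open>r * \<bar>y\<bar> \<le> h\<close> and \<open>r \<ge> 1 / 2\<close>.\<close>
  let ?G = "\<lambda>x y. 4 * (indicator {sqrt (1 - y\<^sup>2) - h..sqrt (1 - y\<^sup>2)} x * ennreal ((sqrt (1 - y\<^sup>2) - x) powr - \<sigma>)) * indicator {-2 * h..2 * h} y :: ennreal"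
  have le: "?F (Complex x y) \<le> ?G x y" for x y
  proof (cases "cmod (1 - of_real r * Complex x y) \<le> h \<and> cmod (Complex x y) < 1")
    case True
    define X where "X = sqrt (1 - y\<^sup>2)"
    have xy: "x\<^sup>2 + y\<^sup>2 < 1" using True by (simp add: cmod_def)
    have "1 - r * x \<le> h"
      using order_trans[OF abs_Re_le_cmod conjunct1[OF True]] by simp
    moreover have "\<bar>r * y\<bar> \<le> h"
      using order_trans[OF abs_Im_le_cmod conjunct1[OF True]] by simp
    ultimately have rx: "r * x \<ge> 1 - h" and ry: "r * \<bar>y\<bar> \<le> h" using r by (auto simp: abs_mult)
    have "r * x > 0" using rx h by linarith
    then have x0: "x > 0" using r by (simp add: zero_less_mult_iff)
    then have x1: "x \<ge> 1 - h" using rx r mult_right_mono[of r 1 x] by linarith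
    have "x\<^sup>2 < 1" using xy zero_le_power2[of y] by linarith
    then have "x < 1" using x0 by (simp add: power_less_one_iff abs_square_less_1)
    then have r34: "r \<ge> 1 / 2" using rx r h mult_left_mono[of x 1 r] by linarith
    then have y2: "\<bar>y\<bar> \<le> 2 * h" using ry mult_right_mono[OF r34, of "\<bar>y\<bar>"] by simp
    have xX: "x < X" and ge: "X * (X - x) / 2 \<le> 1 - cmod (Complex x y)"
      using one_minus_norm_ge[OF xy] x0 by (auto simp: X_def)
    have X1: "X \<le> 1" by (simp add: X_def)
    have "X \<ge> 1 / 2" using xX x1 h by simp
    then have "1 / 2 * (X - x) \<le> X * (X - x)" using xX by (intro mult_right_mono) auto
    then have ge': "(X - x) / 4 \<le> 1 - cmod (Complex x y)" using ge by simp
    have "(1 - cmod (Complex x y)) powr - \<sigma> \<le> ((X - x) / 4) powr - \<sigma>"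
      using ge' xX \<sigma> by (intro powr_mono2') auto
    also have "\<dots> = 4 powr \<sigma> * (X - x) powr - \<sigma>"
      using xX by (simp add: powr_divide powr_minus field_simps)
    also have "\<dots> \<le> 4 powr 1 * (X - x) powr - \<sigma>"
      using \<sigma> by (intro mult_right_mono powr_mono) auto
    finally have "ennreal ((1 - cmod (Complex x y)) powr - \<sigma>) \<le> ennreal (4 * (X - x) powr - \<sigma>)"
      by (intro ennreal_leI) simp
    moreover have "y \<in> {-2 * h..2 * h}" "x \<in> {X - h..X}" using y2 xX x1 X1 by auto
    ultimately show ?thesis using True
      by (simp add: X_def[symmetric] ennreal_mult)
  qed auto
  have inner: "(\<integral>\<^sup>+x. ?G x y \<partial>lborel) = ennreal (4 * h powr (1 - \<sigma>) / (1 - \<sigma>)) * indicator {-2 * h..2 * h} y" for y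
  proof -
    have "(\<integral>\<^sup>+x. ?G x y \<partial>lborel) = 4 * ennreal (h powr (1 - \<sigma>) / (1 - \<sigma>)) * indicator {-2 * h..2 * h} y"
      by (subst nn_integral_multc, simp, subst nn_integral_cmult, simp,
          subst nn_integral_powr_below) (use \<sigma> h in auto)
    also have "4 * ennreal (h powr (1 - \<sigma>) / (1 - \<sigma>)) = ennreal (4 * h powr (1 - \<sigma>) / (1 - \<sigma>))"
      using ennreal_mult'[of 4 "h powr (1 - \<sigma>) / (1 - \<sigma>)"] by simp
    finally show ?thesis .
  qed
  have "(\<integral>\<^sup>+u. ?F u \<partial>lborel) = (\<integral>\<^sup>+y. \<integral>\<^sup>+x. ?F (Complex x y) \<partial>lborel \<partial>lborel)"
    by (rule nn_integral_lborel_complex) measurable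
  also have "\<dots> \<le> (\<integral>\<^sup>+y. \<integral>\<^sup>+x. ?G x y \<partial>lborel \<partial>lborel)"
    by (intro nn_integral_mono le)
  also have "\<dots> = (\<integral>\<^sup>+y. ennreal (4 * h powr (1 - \<sigma>) / (1 - \<sigma>)) * indicator {-2 * h..2 * h} y \<partial>lborel)"
    unfolding inner ..
  also have "\<dots> = ennreal (4 * h powr (1 - \<sigma>) / (1 - \<sigma>)) * ennreal (4 * h)"
    using h by (subst nn_integral_cmult_indicator) auto
  also have "\<dots> = ennreal (16 / (1 - \<sigma>) * h powr (2 - \<sigma>))"
  proof -
    have "h powr (2 - \<sigma>) = h powr (1 - \<sigma>) * h"
      using powr_add[of h "1 - \<sigma>" 1] h by simp
    then show ?thesis using h \<sigma> by (simp flip: ennreal_mult')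
  qed
  finally have "(\<integral>\<^sup>+u. ?F u \<partial>lborel) \<le> ennreal (16 / (1 - \<sigma>) * h powr (2 - \<sigma>))" .
  then have "(\<integral>\<^sup>+u. ?F u \<partial>lborel) / ennreal pi \<le> ennreal (16 / (1 - \<sigma>) * h powr (2 - \<sigma>)) / ennreal pi"
    by (rule divide_right_mono_ennreal)
  also have "\<dots> = ennreal (16 / (1 - \<sigma>) * h powr (2 - \<sigma>) / pi)"
    using \<sigma> by (intro divide_ennreal) auto
  also have "\<dots> \<le> ennreal (16 / (1 - \<sigma>) * h powr (2 - \<sigma>))"
  proof (rule ennreal_leI)
    have *: "A / pi \<le> A" if "A \<ge> 0" for A
      using that pi_ge_two mult_left_mono[of 1 pi A] by (simp add: field_simps)
    show "16 / (1 - \<sigma>) * h powr (2 - \<sigma>) / pi \<le> 16 / (1 - \<sigma>) * h powr (2 - \<sigma>)"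
      by (rule *) (use \<sigma> in auto)
  qed
  finally show ?thesis
    by (subst nn_integral_disc_area) auto
qed

text \<open>A rotation makes \<open>z\<close> real and nonnegative. If \<open>h\<close> is not small
  the total integral \<open>2 / (1 - \<sigma>)\<close> suffices: there
  \<open>h powr (2 - \<sigma>) \<ge> 1 / 16\<close>, which explains
  \<open>32 = 2 * 16\<close>.\<close>

lemma disc_area_powr_near:
  assumes \<sigma>: "0 \<le> \<sigma>" "\<sigma> < 1" and h: "0 < h" and z: "z \<in> unit_disc"
  shows "(\<integral>\<^sup>+u. ennreal ((1 - cmod u) powr - \<sigma>) * indicator {u. kernel_norm z u \<le> h} u \<partial>disc_area)
    \<le> ennreal (32 / (1 - \<sigma>) * h powr (2 - \<sigma>))"
proof (cases "h < 1 / 4")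
  case True
  have [measurable]: "{u. kernel_norm z u \<le> h} \<in> sets borel" by measurable
  obtain v where v: "cmod v = 1" "z = of_real (cmod z) * v"
  proof (cases "z = 0")
    case False
    then show ?thesis using that[of "z / of_real (cmod z)"] by (simp add: norm_divide)
  qed (use that[of 1] in simp)
  have *: "cnj z * (v * u) = of_real (cmod z) * u" for u
  proof -
    have "cnj v * v = 1" using v(1) by (metis complex_norm_square mult.commute of_real_1 power_one)
    moreover have "cnj z = of_real (cmod z) * cnj v"
      by (subst v(2)) (simp only: complex_cnj_mult complex_cnj_complex_of_real)
    ultimately show ?thesis by (metis mult.assoc mult_1)
  qed
  have "(\<integral>\<^sup>+u. ennreal ((1 - cmod u) powr - \<sigma>) * indicator {u. kernel_norm z u \<le> h} u \<partial>disc_area)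
    = (\<integral>\<^sup>+u. ennreal ((1 - cmod u) powr - \<sigma>) * indicator {u. cmod (1 - of_real (cmod z) * u) \<le> h} u \<partial>disc_area)"
    by (subst nn_integral_disc_area_rotate[OF _ v(1), symmetric], measurable)
      (simp add: norm_mult v(1) indicator_def *)
  also have "\<dots> \<le> ennreal (16 / (1 - \<sigma>) * h powr (2 - \<sigma>))"
    by (rule disc_area_powr_local) (use \<sigma> h True z in auto)
  also have "\<dots> \<le> ennreal (32 / (1 - \<sigma>) * h powr (2 - \<sigma>))"
    using \<sigma> by (intro ennreal_leI mult_right_mono divide_right_mono) auto
  finally show ?thesis .
next
  case False
  have "(\<integral>\<^sup>+u. ennreal ((1 - cmod u) powr - \<sigma>) * indicator {u. kernel_norm z u \<le> h} u \<partial>disc_area)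
      \<le> (\<integral>\<^sup>+u. ennreal ((1 - cmod u) powr - \<sigma>) \<partial>disc_area)"
    by (intro nn_integral_mono) (auto simp: indicator_def)
  also have "\<dots> \<le> ennreal (2 / (1 - \<sigma>))" by (rule disc_area_powr_total[OF \<sigma>])
  also have "\<dots> \<le> ennreal (32 / (1 - \<sigma>) * h powr (2 - \<sigma>))"
  proof (rule ennreal_leI)
    have "1 / 16 = (1 / 4 :: real) powr 2" by (simp add: power2_eq_square)
    also have "\<dots> \<le> (1 / 4 :: real) powr (2 - \<sigma>)" using \<sigma> by (intro powr_mono') auto
    also have "\<dots> \<le> h powr (2 - \<sigma>)" using \<sigma> False by (intro powr_mono2) auto
    finally have "32 / (1 - \<sigma>) * (1 / 16) \<le> 32 / (1 - \<sigma>) * h powr (2 - \<sigma>)"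
      using \<sigma> by (intro mult_left_mono) auto
    moreover have "2 / (1 - \<sigma>) = 32 / (1 - \<sigma>) * (1 / 16)"
      unfolding times_divide_eq_left by simp
    ultimately show "2 / (1 - \<sigma>) \<le> 32 / (1 - \<sigma>) * h powr (2 - \<sigma>)" by (simp only:)
  qed
  finally show ?thesis .
qed

section \<open>Size of the kernel and decomposition into dyadic shells\<close>

lemma unit_disc_kernel:
  assumes "a \<in> unit_disc" "z \<in> unit_disc"
  shows "1 - cmod a \<le> kernel_norm a z" "1 - cmod z \<le> kernel_norm a z"
    "kernel_norm a z \<le> 2" "0 < kernel_norm a z" "1 - cnj a * z \<noteq> 0"
proof -
  have az: "cmod a < 1" "cmod z < 1" using assms by auto
  have *: "cmod (cnj a * z) \<le> cmod a" "cmod (cnj a * z) \<le> cmod z"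
    using az mult_left_le[of "cmod z" "cmod a"] mult_left_le_one_le[of "cmod z" "cmod a"]
    by (auto simp: norm_mult)
  have "1 - cmod (cnj a * z) \<le> kernel_norm a z"
    using norm_triangle_ineq2[of 1 "cnj a * z"] by simp
  then show 1: "1 - cmod a \<le> kernel_norm a z" and "1 - cmod z \<le> kernel_norm a z"
    using * by linarith+
  show "kernel_norm a z \<le> 2"
    using norm_triangle_ineq4[of 1 "cnj a * z"] * az by simp
  show "0 < kernel_norm a z" using 1 az by linarith
  then show "1 - cnj a * z \<noteq> 0" by auto
qed

lemma kernel_swap: "kernel_norm a z = kernel_norm z a"
  by (metis complex_cnj_cnj complex_cnj_diff complex_cnj_mult complex_cnj_one complex_mod_cnj mult.commute)

lemma power2_powr: "((2::real) ^ j) powr a = (2 powr a) ^ j"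
  by (induction j) (simp_all add: powr_mult)

lemma ex_dyadic:
  fixes \<delta> t :: real
  assumes "0 < \<delta>" "\<delta> \<le> t"
  obtains j where "2 ^ j * \<delta> \<le> t" "t < 2 ^ Suc j * \<delta>"
proof -
  obtain n where "t / \<delta> < 2 ^ n" using real_arch_pow[of 2] by auto
  then have ex: "t < 2 ^ n * \<delta>" using assms by (simp add: field_simps)
  define m where "m = (LEAST n. t < 2 ^ n * \<delta>)"
  have m: "t < 2 ^ m * \<delta>" unfolding m_def using ex by (rule LeastI)
  have "m \<noteq> 0" using m assms by (cases "m = 0") auto
  then obtain j where j: "m = Suc j" by (cases m) auto
  have "\<not> t < 2 ^ j * \<delta>" using not_less_Least[of j "\<lambda>n. t < 2 ^ n * \<delta>"] j m_def by auto
  then show ?thesis using that[of j] m j by simp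
qed

text \<open>Each point where \<open>k\<close> is positive is charged to one level \<open>j\<close>,
  so \<open>k\<close> is dominated by the sum of \<open>c j\<close> over the sets where the kernel
  is at most \<open>h j\<close>. The sets may overlap, and points where \<open>k\<close> vanishes,
  as under a truncation, need no level.\<close>

lemma disc_area_dyadic:
  fixes k :: "complex \<Rightarrow> real"
  assumes \<sigma>: "0 \<le> \<sigma>" "\<sigma> < 1" and z: "z \<in> unit_disc"
    and h: "\<And>j. 0 < h j" and c: "\<And>j. 0 \<le> c j"
    and k: "\<And>u. u \<in> unit_disc \<Longrightarrow> 0 < k u \<Longrightarrow> \<exists>j. kernel_norm z u \<le> h j \<and> k u \<le> c j"
  shows "(\<integral>\<^sup>+u. ennreal ((1 - cmod u) powr - \<sigma> * k u) \<partial>disc_area)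
    \<le> (\<Sum>j. ennreal (32 / (1 - \<sigma>) * (c j * h j powr (2 - \<sigma>))))"
proof -
  define f where "f j u = ennreal (c j) * (ennreal ((1 - cmod u) powr - \<sigma>) * indicator {u. kernel_norm z u \<le> h j} u)" for j u
  have [measurable]: "{u. kernel_norm z u \<le> h j} \<in> sets borel" for j by measurable
  have [measurable]: "f j \<in> borel_measurable borel" for j
    unfolding f_def by measurable
  have "(\<integral>\<^sup>+u. ennreal ((1 - cmod u) powr - \<sigma> * k u) \<partial>disc_area) \<le> (\<integral>\<^sup>+u. (\<Sum>j. f j u) \<partial>disc_area)"
  proof (rule nn_integral_mono_AE, use AE_disc_area in eventually_elim)
    fix u assume u: "u \<in> unit_disc"
    show "ennreal ((1 - cmod u) powr - \<sigma> * k u) \<le> (\<Sum>j. f j u)"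
    proof (cases "0 < k u")
      case True
      then obtain j where j: "kernel_norm z u \<le> h j" "k u \<le> c j" using k u by blast
      then have "ennreal ((1 - cmod u) powr - \<sigma> * k u) \<le> ennreal ((1 - cmod u) powr - \<sigma> * c j)"
        by (intro ennreal_leI mult_left_mono) auto
      also have "\<dots> = f j u" using j c by (simp add: f_def ennreal_mult mult.commute)
      also have "\<dots> = sum (\<lambda>i. f i u) {j}" by simp
      also have "\<dots> \<le> (\<Sum>j. f j u)" by (rule sum_le_suminf) auto
      finally show ?thesis .
    next
      case False
      then have "(1 - cmod u) powr - \<sigma> * k u \<le> 0" by (intro mult_nonneg_nonpos) auto
      then show ?thesis by (simp add: ennreal_neg)
    qed
  qed
  also have "\<dots> = (\<Sum>j. \<integral>\<^sup>+u. f j u \<partial>disc_area)"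
    by (rule nn_integral_suminf) measurable
  also have "\<dots> \<le> (\<Sum>j. ennreal (32 / (1 - \<sigma>) * (c j * h j powr (2 - \<sigma>))))"
  proof (intro suminf_le allI)
    fix j
    have "(\<integral>\<^sup>+u. f j u \<partial>disc_area) = ennreal (c j) * (\<integral>\<^sup>+u. ennreal ((1 - cmod u) powr - \<sigma>) * indicator {u. kernel_norm z u \<le> h j} u \<partial>disc_area)"
      unfolding f_def by (rule nn_integral_cmult) measurable
    also have "\<dots> \<le> ennreal (c j) * ennreal (32 / (1 - \<sigma>) * h j powr (2 - \<sigma>))"
      by (intro mult_left_mono disc_area_powr_near \<sigma> h z) auto
    also have "\<dots> = ennreal (32 / (1 - \<sigma>) * (c j * h j powr (2 - \<sigma>)))"
      using c \<sigma> by (subst ennreal_mult[symmetric]) (auto simp: mult_ac)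
    finally show "(\<integral>\<^sup>+u. f j u \<partial>disc_area) \<le> ennreal (32 / (1 - \<sigma>) * (c j * h j powr (2 - \<sigma>)))" .
  qed auto
  finally show ?thesis .
qed

lemma suminf_ennreal_geometric:
  assumes "0 \<le> A" "0 \<le> r" "r < 1"
  shows "(\<Sum>j. ennreal (A * r ^ j)) = ennreal (A / (1 - r))"
proof (rule suminf_ennreal_eq)
  show "(\<lambda>j. A * r ^ j) sums (A / (1 - r))"
    using sums_mult[OF geometric_sums[of r], of A] assms by simp
qed (use assms in auto)

section \<open>The logarithmic weight and integrals of kernel powers\<close>

definition log_weight :: "complex \<Rightarrow> real" where
  "log_weight a = ln (2 / (1 - cmod a))"

lemma log_weight_ge: "a \<in> unit_disc \<Longrightarrow> ln 2 \<le> log_weight a"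
  unfolding log_weight_def by (intro ln_mono) (auto simp: field_simps)

lemma log_weight_pos: "a \<in> unit_disc \<Longrightarrow> 0 < log_weight a"
  by (rule less_le_trans[OF _ log_weight_ge]) simp_all

text \<open>This is the critical exponent: the power \<open>p\<close> gained from the area of a
  shell cancels the power \<open>- p\<close> of the kernel, so all shells contribute equally. The
  bound counts the shells between the scales \<open>1 - cmod a\<close> and \<open>2\<close>, which
  gives the logarithm.\<close>

lemma kernel_integral_log:
  assumes p: "1 < p" "p \<le> 2"
  obtains C where "0 < C" "\<And>a. a \<in> unit_disc \<Longrightarrow>
    (\<integral>\<^sup>+u. ennreal ((1 - cmod u) powr (p - 2) * kernel_norm a u powr - p) \<partial>disc_area) \<le> ennreal (C * log_weight a)"
proof
  let ?C = "32 / (p - 1) * 2 powr p * (2 / ln 2)"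
  show "0 < ?C" using p by simp
  fix a assume a: "a \<in> unit_disc"
  define \<delta> where "\<delta> = 1 - cmod a"
  have \<delta>: "0 < \<delta>" "\<delta> \<le> 1" using a by (auto simp: \<delta>_def)
  define J where "J = nat \<lfloor>log 2 (2 / \<delta>)\<rfloor>"
  \<comment> \<open>The kernel never exceeds \<open>2\<close>, so shells beyond \<open>J\<close> are
    empty; setting \<open>c\<close> to zero there makes the series a finite sum.\<close>
  define c where "c j = (if j \<le> J then (2 ^ j * \<delta>) powr - p else 0)" for j :: nat
  have "(\<integral>\<^sup>+u. ennreal ((1 - cmod u) powr - (2 - p) * kernel_norm a u powr - p) \<partial>disc_area)
    \<le> (\<Sum>j. ennreal (32 / (1 - (2 - p)) * (c j * (2 ^ Suc j * \<delta>) powr (2 - (2 - p)))))"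
  proof (rule disc_area_dyadic)
    fix u assume u: "u \<in> unit_disc"
    have "\<delta> \<le> kernel_norm a u" using unit_disc_kernel(1)[OF a u] by (simp add: \<delta>_def)
    then obtain j where j: "2 ^ j * \<delta> \<le> kernel_norm a u" "kernel_norm a u < 2 ^ Suc j * \<delta>"
      using ex_dyadic \<delta> by metis
    have "2 ^ j * \<delta> \<le> 2" using j unit_disc_kernel(3)[OF a u] by linarith
    then have "2 ^ j \<le> 2 / \<delta>" using \<delta> by (simp add: field_simps)
    then have "real j \<le> log 2 (2 / \<delta>)" using \<delta> by (simp add: le_log_iff powr_realpow)
    then have "j \<le> J" unfolding J_def by (simp add: le_nat_floor)
    moreover have "kernel_norm a u powr - p \<le> (2 ^ j * \<delta>) powr - p"
      using j \<delta> p by (intro powr_mono2') auto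
    ultimately show "\<exists>j. kernel_norm a u \<le> 2 ^ Suc j * \<delta> \<and> kernel_norm a u powr - p \<le> c j"
      using j by (intro exI[of _ j]) (auto simp: c_def)
  qed (use p \<delta> a in \<open>auto simp: c_def\<close>)
  also have "\<dots> = (\<Sum>j\<le>J. ennreal (32 / (1 - (2 - p)) * (c j * (2 ^ Suc j * \<delta>) powr (2 - (2 - p)))))"
    by (intro suminf_finite) (auto simp: c_def)
  also have "\<dots> = (\<Sum>j\<le>J. ennreal (32 / (p - 1) * 2 powr p))"
  proof (intro sum.cong refl)
    fix j assume "j \<in> {..J}"
    have "(2 ^ j * \<delta>) powr - p * (2 ^ Suc j * \<delta>) powr p = ((2 ^ j * \<delta>) powr - p * (2 ^ j * \<delta>) powr p) * 2 powr p"
      using \<delta> by (simp add: powr_mult)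
    also have "(2 ^ j * \<delta>) powr - p * (2 ^ j * \<delta>) powr p = 1"
      using \<delta> by (simp add: powr_minus)
    finally show "ennreal (32 / (1 - (2 - p)) * (c j * (2 ^ Suc j * \<delta>) powr (2 - (2 - p)))) = ennreal (32 / (p - 1) * 2 powr p)"
      using \<open>j \<in> {..J}\<close> by (simp add: c_def)
  qed
  also have "\<dots> = ennreal (real (Suc J) * (32 / (p - 1) * 2 powr p))"
    using p by (simp only: sum_constant card_atMost ennreal_of_nat_eq_real_of_nat)
      (rule ennreal_mult[symmetric], auto)
  also have "\<dots> \<le> ennreal (?C * log_weight a)"
  proof (rule ennreal_leI)
    have "1 \<le> 2 / \<delta>" using \<delta> by (simp add: field_simps)
    then have "0 \<le> log 2 (2 / \<delta>)" using \<delta> by (subst zero_le_log_cancel_iff) auto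
    then have "real J \<le> log 2 (2 / \<delta>)" unfolding J_def by linarith
    also have "\<dots> = log_weight a / ln 2" by (simp add: log_def log_weight_def \<delta>_def)
    \<comment> \<open>There are \<open>J + 1\<close> shells; the extra one is absorbed by
      \<open>log_weight a \<ge> ln 2\<close>, whence the factor \<open>2\<close>.\<close>
    finally have "real (Suc J) \<le> 2 / ln 2 * log_weight a"
      using log_weight_ge[OF a] by (simp add: field_simps)
    then have "real (Suc J) * (32 / (p - 1) * 2 powr p) \<le> (2 / ln 2 * log_weight a) * (32 / (p - 1) * 2 powr p)"
      using p by (intro mult_right_mono) auto
    then show "real (Suc J) * (32 / (p - 1) * 2 powr p) \<le> ?C * log_weight a"
      by (simp only: mult_ac)
  qed
  finally show "(\<integral>\<^sup>+u. ennreal ((1 - cmod u) powr (p - 2) * kernel_norm a u powr - p) \<partial>disc_area) \<le> ennreal (?C * log_weight a)"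
    by simp
qed

text \<open>Shell \<open>j\<close> contributes a multiple of
  \<open>(2 ^ j * \<delta>) powr - s\<close> with \<open>\<delta> = 1 - cmod a\<close>: a decreasing
  geometric series, dominated by the smallest scale.\<close>

lemma kernel_integral_powr:
  assumes s: "0 < s" "s < 1"
  obtains C where "0 < C" "\<And>a. a \<in> unit_disc \<Longrightarrow>
    (\<integral>\<^sup>+u. ennreal ((1 - cmod u) powr - s * kernel_norm a u powr - 2) \<partial>disc_area)
      \<le> ennreal (C * (1 - cmod a) powr - s)"
proof
  define r where "r = 2 powr - s"
  have r: "0 \<le> r" "r < 1" using s by (auto simp: r_def powr_less_one)
  let ?C = "32 / (1 - s) * 2 powr (2 - s) / (1 - r)"
  show "0 < ?C" using s r by simp
  fix a assume a: "a \<in> unit_disc"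
  define \<delta> where "\<delta> = 1 - cmod a"
  have \<delta>: "0 < \<delta>" using a by (auto simp: \<delta>_def)
  have "(\<integral>\<^sup>+u. ennreal ((1 - cmod u) powr - s * kernel_norm a u powr - 2) \<partial>disc_area)
    \<le> (\<Sum>j. ennreal (32 / (1 - s) * ((2 ^ j * \<delta>) powr - 2 * (2 ^ Suc j * \<delta>) powr (2 - s))))"
  proof (rule disc_area_dyadic)
    fix u assume u: "u \<in> unit_disc"
    have "\<delta> \<le> kernel_norm a u" using unit_disc_kernel(1)[OF a u] by (simp add: \<delta>_def)
    then obtain j where j: "2 ^ j * \<delta> \<le> kernel_norm a u" "kernel_norm a u < 2 ^ Suc j * \<delta>"
      using ex_dyadic \<delta> by metis
    moreover have "kernel_norm a u powr - 2 \<le> (2 ^ j * \<delta>) powr - 2"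
      using j \<delta> by (intro powr_mono2') auto
    ultimately show "\<exists>j. kernel_norm a u \<le> 2 ^ Suc j * \<delta> \<and> kernel_norm a u powr - 2 \<le> (2 ^ j * \<delta>) powr - 2"
      by (intro exI[of _ j]) auto
  qed (use s \<delta> a in auto)
  also have "\<dots> = (\<Sum>j. ennreal ((32 / (1 - s) * 2 powr (2 - s) * \<delta> powr - s) * r ^ j))"
  proof -
    have "(2 ^ j * \<delta>) powr - 2 * (2 ^ Suc j * \<delta>) powr (2 - s) = 2 powr (2 - s) * \<delta> powr - s * r ^ j" for j
    proof -
      have "(2 ^ j * \<delta>) powr - 2 * (2 ^ Suc j * \<delta>) powr (2 - s)
          = 2 powr (2 - s) * ((2 ^ j * \<delta>) powr - 2 * (2 ^ j * \<delta>) powr (2 - s))"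
        using \<delta> powr_mult[of 2 "2 ^ j * \<delta>" "2 - s"] by (simp add: mult_ac)
      also have "(2 ^ j * \<delta>) powr - 2 * (2 ^ j * \<delta>) powr (2 - s) = (2 ^ j * \<delta>) powr - s"
        by (simp flip: powr_add)
      also have "\<dots> = \<delta> powr - s * r ^ j"
        using \<delta> by (simp add: powr_mult power2_powr r_def)
      finally show ?thesis by simp
    qed
    then show ?thesis by (simp add: mult.assoc)
  qed
  also have "\<dots> = ennreal (?C * \<delta> powr - s)"
    using s r by (subst suminf_ennreal_geometric) (auto simp: mult_ac)
  finally show "(\<integral>\<^sup>+u. ennreal ((1 - cmod u) powr - s * kernel_norm a u powr - 2) \<partial>disc_area)
      \<le> ennreal (?C * (1 - cmod a) powr - s)" by (simp add: \<delta>_def)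
qed

text \<open>Here the shells descend from \<open>h\<close>. The one at scale \<open>h / 2 ^ j\<close>
  contributes a multiple of \<open>(h / 2 ^ j) powr s\<close>, so the largest scale dominates. As
  \<open>2 * s - 2\<close> is negative, the kernel power is bounded by its value at the inner radius
  \<open>h / 2 ^ Suc j\<close>.\<close>

lemma kernel_integral_truncated:
  assumes s: "0 < s" "s < 1"
  obtains C where "0 < C" "\<And>z h. z \<in> unit_disc \<Longrightarrow> 0 < h \<Longrightarrow>
    (\<integral>\<^sup>+u. ennreal ((1 - cmod u) powr - s * (kernel_norm z u powr (2 * s - 2)
        * indicator {u. kernel_norm z u \<le> h} u)) \<partial>disc_area)
      \<le> ennreal (C * h powr s)"
proof
  define r where "r = 2 powr - s"
  have r: "0 \<le> r" "r < 1" using s by (auto simp: r_def powr_less_one)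
  let ?C = "32 / (1 - s) * 2 powr (2 - 2 * s) / (1 - r)"
  show "0 < ?C" using s r by simp
  fix z h assume z: "z \<in> unit_disc" and h: "0 < (h::real)"
  let ?k = "\<lambda>u. kernel_norm z u powr (2 * s - 2) * indicator {u. kernel_norm z u \<le> h} u"
  have "(\<integral>\<^sup>+u. ennreal ((1 - cmod u) powr - s * ?k u) \<partial>disc_area)
    \<le> (\<Sum>j. ennreal (32 / (1 - s) * ((h / 2 ^ Suc j) powr (2 * s - 2) * (h / 2 ^ j) powr (2 - s))))"
  proof (rule disc_area_dyadic)
    fix u assume u: "u \<in> unit_disc" and k: "0 < ?k u"
    have "kernel_norm z u \<le> h"
      by (rule ccontr) (use k in simp)
    then obtain j where j: "2 ^ j * kernel_norm z u \<le> h" "h < 2 ^ Suc j * kernel_norm z u"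
      using ex_dyadic unit_disc_kernel(4)[OF z u] by metis
    have "kernel_norm z u powr (2 * s - 2) \<le> (h / 2 ^ Suc j) powr (2 * s - 2)"
      using j h s by (intro powr_mono2') (auto simp: field_simps)
    then have "?k u \<le> (h / 2 ^ Suc j) powr (2 * s - 2)"
      by (auto simp: indicator_def)
    moreover have "kernel_norm z u \<le> h / 2 ^ j" using j by (simp add: field_simps)
    ultimately show "\<exists>j. kernel_norm z u \<le> h / 2 ^ j \<and> ?k u \<le> (h / 2 ^ Suc j) powr (2 * s - 2)"
      by blast
  qed (use s h z in auto)
  also have "\<dots> = (\<Sum>j. ennreal ((32 / (1 - s) * 2 powr (2 - 2 * s) * h powr s) * r ^ j))"
  proof -
    have "(h / 2 ^ Suc j) powr (2 * s - 2) * (h / 2 ^ j) powr (2 - s) = 2 powr (2 - 2 * s) * h powr s * r ^ j" for j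
    proof -
      have "(h / 2 ^ Suc j) powr (2 * s - 2) = (h / 2 ^ j) powr (2 * s - 2) * 2 powr (2 - 2 * s)"
        using h powr_divide[of "h / 2 ^ j" 2 "2 * s - 2"] powr_minus_divide[of 2 "2 * s - 2"]
        by (simp add: mult.commute)
      moreover have "(h / 2 ^ j) powr (2 * s - 2) * (h / 2 ^ j) powr (2 - s) = (h / 2 ^ j) powr s"
        by (simp flip: powr_add)
      moreover have "(h / 2 ^ j) powr s = h powr s * r ^ j"
        using h by (simp add: powr_divide power2_powr r_def powr_minus_divide power_one_over)
      ultimately show ?thesis by (simp add: mult_ac)
    qed
    then show ?thesis by (simp add: mult.assoc)
  qed
  also have "\<dots> = ennreal (?C * h powr s)"
    using s r by (subst suminf_ennreal_geometric) (auto simp: mult_ac)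
  finally show "(\<integral>\<^sup>+u. ennreal ((1 - cmod u) powr - s * ?k u) \<partial>disc_area) \<le> ennreal (?C * h powr s)" .
qed

section \<open>Mean values\<close>

text \<open>One turn takes unit time, so mean values over the circle are integrals over
  \<open>{0..1}\<close> without a normalising factor.\<close>

definition unit_circle :: "real \<Rightarrow> complex" where
  "unit_circle t = exp (2 * of_real pi * \<i> * of_real t)"

lemma norm_unit_circle[simp]: "cmod (unit_circle t) = 1"
  by (simp add: unit_circle_def norm_exp_eq_Re)

lemma unit_circle_nonzero[simp]: "unit_circle t \<noteq> 0"
  by (simp add: unit_circle_def)

lemma continuous_on_unit_circle[continuous_intros]: "continuous_on A unit_circle"
  unfolding unit_circle_def by (intro continuous_intros)

lemma measurable_unit_circle[measurable]: "unit_circle \<in> borel_measurable borel"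
  by (intro borel_measurable_continuous_onI continuous_intros)

text \<open>Cauchy's integral formula with the parametrisation inserted. The point
  \<open>w = 0\<close> gives the mean value property; a general \<open>w\<close> yields the kernel
  of the reproducing formula.\<close>

lemma circle_mean:
  assumes "F holomorphic_on cball 0 1" "cmod w < 1"
  shows "((\<lambda>t. F (unit_circle t) * unit_circle t / (unit_circle t - w)) has_integral F w) {0..1}"
proof -
  have "((\<lambda>u. F u / (u - w)) has_contour_integral (2 * of_real pi * \<i> * F w)) (circlepath 0 1)"
    using Cauchy_integral_circlepath_simple[OF assms(1)] assms(2) by simp
  then have "((\<lambda>t. F (unit_circle t) / (unit_circle t - w) * (2 * of_real pi * \<i> * unit_circle t)) has_integral
      2 * of_real pi * \<i> * F w) {0..1}"
    unfolding has_contour_integral_def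
  proof (rule has_integral_eq[rotated])
    fix t :: real assume t: "t \<in> {0..1}"
    have "circlepath 0 1 t = unit_circle t" by (simp add: circlepath unit_circle_def)
    moreover have "vector_derivative (circlepath 0 1) (at t within {0..1}) = 2 * of_real pi * \<i> * unit_circle t"
      using t vector_derivative_circlepath01[of t 0 1] by (simp add: unit_circle_def)
    ultimately show "F (circlepath 0 1 t) / (circlepath 0 1 t - w) * vector_derivative (circlepath 0 1) (at t within {0..1})
        = F (unit_circle t) / (unit_circle t - w) * (2 * of_real pi * \<i> * unit_circle t)"
      by simp
  qed
  then have "((\<lambda>t. 1 / (2 * of_real pi * \<i>) * (F (unit_circle t) / (unit_circle t - w) * (2 * of_real pi * \<i> * unit_circle t))) has_integral
      1 / (2 * of_real pi * \<i>) * (2 * of_real pi * \<i> * F w)) {0..1}"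
    by (rule has_integral_mult_right)
  then show ?thesis by (simp add: field_simps)
qed

text \<open>Convexity of \<open>x powr q\<close>: the tangent at \<open>c\<close> lies below the graph.\<close>

lemma powr_tangent_le:
  fixes q c y :: real
  assumes "1 \<le> q" "0 \<le> y" "0 \<le> c"
  shows "q * c powr (q - 1) * y \<le> y powr q + (q - 1) * c powr q"
proof (cases "q = 1")
  case True
  then show ?thesis using assms by (cases "c = 0") auto
next
  case False
  then have q: "1 < q" using assms by simp
  have "y * c powr (q - 1) \<le> y powr q / q + (c powr (q - 1)) powr (q / (q - 1)) / (q / (q - 1))"
    using q assms by (intro Youngs_inequality) (auto simp: field_simps)
  also have "(c powr (q - 1)) powr (q / (q - 1)) = c powr q"
    using q by (simp add: powr_powr)
  finally have "q * (y * c powr (q - 1)) \<le> q * (y powr q / q + c powr q / (q / (q - 1)))"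
    using q by (intro mult_left_mono) auto
  also have "\<dots> = y powr q + (q - 1) * c powr q" using q by (simp add: field_simps)
  finally show ?thesis by (simp add: mult_ac)
qed

text \<open>Jensen's inequality by tangents: average the tangent inequality at
  \<open>c = cmod (h 0)\<close> over the circle and use that \<open>c\<close> is at most the mean of
  \<open>cmod h\<close>.\<close>

lemma submean_circle:
  assumes h: "h holomorphic_on ball 0 R" and z: "cmod z < R" and q: "1 \<le> q"
  shows "ennreal (cmod (h 0) powr q) \<le> (\<integral>\<^sup>+t. indicator {0..1} t * ennreal (cmod (h (unit_circle t * z)) powr q) \<partial>lborel)"
proof -
  define c where "c = cmod (h 0)"
  let ?g = "\<lambda>t. h (unit_circle t * z)"
  have "(\<lambda>x. h (x * z)) holomorphic_on cball 0 1"
  proof (rule holomorphic_on_compose[of "\<lambda>x. x * z" _ h, unfolded o_def])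
    show "h holomorphic_on (\<lambda>x. x * z) ` cball 0 1"
    proof (rule holomorphic_on_subset[OF h], clarsimp simp: norm_mult)
      fix x :: complex assume "cmod x \<le> 1"
      then show "cmod x * cmod z < R"
        using z mult_right_mono[of "cmod x" 1 "cmod z"] by simp
    qed
  qed (intro holomorphic_intros)
  from circle_mean[OF this, of 0] have mean: "(?g has_integral h 0) {0..1}" by simp
  have cont: "continuous_on {0..1} ?g"
    by (rule continuous_on_compose2[OF holomorphic_on_imp_continuous_on[OF h]])
      (use z in \<open>auto intro!: continuous_intros simp: norm_mult\<close>)
  have int1: "(\<lambda>t. cmod (?g t)) integrable_on {0..1}"
    and intq: "(\<lambda>t. cmod (?g t) powr q) integrable_on {0..1}"
    using q by (auto intro!: integrable_continuous_real continuous_intros continuous_on_powr' cont)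
  have "c \<le> integral {0..1} (\<lambda>t. cmod (?g t))"
    using integral_norm_bound_integral[OF has_integral_integrable[OF mean] int1] mean
    by (simp add: c_def integral_unique)
  then have "q * c powr (q - 1) * c \<le> q * c powr (q - 1) * integral {0..1} (\<lambda>t. cmod (?g t))"
    using q by (intro mult_left_mono) auto
  also have "\<dots> = integral {0..1} (\<lambda>t. q * c powr (q - 1) * cmod (?g t))"
    by simp
  also have "\<dots> \<le> integral {0..1} (\<lambda>t. cmod (?g t) powr q + (q - 1) * c powr q)"
    using int1 intq powr_tangent_le[OF q]
    by (intro integral_le integrable_add integrable_on_mult_right integrable_const_ivl) (auto simp: c_def)
  also have "\<dots> = integral {0..1} (\<lambda>t. cmod (?g t) powr q) + (q - 1) * c powr q"
    using intq by (subst integral_add) (auto intro: integrable_const_ivl)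
  also have "q * c powr (q - 1) * c = q * c powr q"
    using powr_mult_base[of c "q - 1"] by (simp add: c_def mult_ac)
  finally have le: "c powr q \<le> integral {0..1} (\<lambda>t. cmod (?g t) powr q)"
    by (simp add: algebra_simps)
  have "(\<integral>\<^sup>+t. indicator {0..1} t * cmod (?g t) powr q \<partial>lborel) = ennreal (integral {0..1} (\<lambda>t. cmod (?g t) powr q))"
    by (rule nn_integral_has_integral_lebesgue) (use intq in \<open>auto simp: integrable_integral\<close>)
  then show ?thesis using le
    by (simp add: ennreal_mult ennreal_indicator c_def ennreal_leI)
qed

text \<open>For every \<open>z\<close> in the ball the value at \<open>0\<close> is bounded by the
  mean over the circle through \<open>z\<close>. Integrating over \<open>z\<close> and exchanging
  the integrals leaves rotated copies of one area integral, all equal.\<close>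

lemma submean_0:
  assumes h: "h holomorphic_on ball 0 R" and R: "0 < R" and q: "1 \<le> q"
  shows "ennreal (cmod (h 0) powr q * (pi * R\<^sup>2)) \<le> (\<integral>\<^sup>+z. ennreal (cmod (h z) powr q) * indicator (ball 0 R) z \<partial>lborel)"
proof -
  \<comment> \<open>Nothing is known about \<open>h\<close> outside the ball; the inner indicator
    makes the integrand Borel on the whole plane.\<close>
  define H where "H z = ennreal (cmod (indicator (ball 0 R) z *\<^sub>R h z) powr q) * indicator (ball 0 R) z" for z
  have H: "H z = ennreal (cmod (h z) powr q) * indicator (ball 0 R) z" for z
    by (auto simp: H_def indicator_def)
  have [measurable]: "(\<lambda>z. indicator (ball 0 R) z *\<^sub>R h z) \<in> borel_measurable borel"
    by (rule borel_measurable_continuous_on_indicator)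
      (auto intro: holomorphic_on_imp_continuous_on h)
  have [measurable]: "ball 0 R \<in> sets (borel :: complex measure)" by simp
  have Hm[measurable]: "H \<in> borel_measurable borel"
    unfolding H_def by measurable
  have "ennreal (cmod (h 0) powr q * (pi * R\<^sup>2)) = ennreal (cmod (h 0) powr q) * emeasure lborel (ball (0::complex) R)"
    using R by (simp add: emeasure_ball unit_ball_vol_2 ennreal_mult)
  also have "\<dots> = (\<integral>\<^sup>+z. ennreal (cmod (h 0) powr q) * indicator (ball (0 :: complex) R) z \<partial>lborel)"
    by (subst nn_integral_cmult_indicator) auto
  also have "\<dots> \<le> (\<integral>\<^sup>+z. \<integral>\<^sup>+t. indicator {0..1} t * H (unit_circle t * z) \<partial>lborel \<partial>lborel)"
  proof (rule nn_integral_mono)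
    fix z :: complex
    show "ennreal (cmod (h 0) powr q) * indicator (ball 0 R) z \<le> (\<integral>\<^sup>+t. indicator {0..1} t * H (unit_circle t * z) \<partial>lborel)"
    proof (cases "z \<in> ball 0 R")
      case True
      then show ?thesis using submean_circle[OF h _ q, of z] by (simp add: H norm_mult)
    qed simp
  qed
  also have "\<dots> = (\<integral>\<^sup>+t. \<integral>\<^sup>+z. indicator {0..1} t * H (unit_circle t * z) \<partial>lborel \<partial>lborel)"
    by (rule lborel_pair.Fubini') measurable
  also have "\<dots> = (\<integral>\<^sup>+t. indicator {0..1::real} t * (\<integral>\<^sup>+z. H z \<partial>lborel) \<partial>lborel)"
    by (subst nn_integral_cmult, measurable, subst nn_integral_lborel_rotate) auto
  also have "\<dots> = (\<integral>\<^sup>+z. H z \<partial>lborel) "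
    by (subst nn_integral_multc) auto
  finally show ?thesis by (simp add: H)
qed

lemma submean:
  assumes h: "h holomorphic_on ball c R" and R: "0 < R" and q: "1 \<le> q" and sub: "ball c R \<subseteq> unit_disc"
  shows "ennreal (cmod (h c) powr q * R\<^sup>2) \<le> (\<integral>\<^sup>+z. ennreal (cmod (h z) powr q) * indicator (ball c R) z \<partial>disc_area)"
proof -
  define H where "H z = ennreal (cmod (indicator (ball c R) z *\<^sub>R h z) powr q) * indicator (ball c R) z" for z
  have H: "H z = ennreal (cmod (h z) powr q) * indicator (ball c R) z" for z
    by (auto simp: H_def indicator_def)
  have [measurable]: "(\<lambda>z. indicator (ball c R) z *\<^sub>R h z) \<in> borel_measurable borel"
    by (rule borel_measurable_continuous_on_indicator)
      (auto intro: holomorphic_on_imp_continuous_on h)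
  have [measurable]: "ball c R \<in> sets (borel :: complex measure)" by simp
  have Hm[measurable]: "H \<in> borel_measurable borel"
    unfolding H_def by measurable
  have "(\<lambda>z. h (c + z)) holomorphic_on ball 0 R"
    by (rule holomorphic_on_compose[of "\<lambda>z. c + z" _ h, unfolded o_def])
      (auto intro!: holomorphic_intros holomorphic_on_subset[OF h] simp: dist_norm)
  from submean_0[OF this R q]
  have "ennreal (cmod (h c) powr q * (pi * R\<^sup>2)) \<le> (\<integral>\<^sup>+z. ennreal (cmod (h (c + z)) powr q) * indicator (ball 0 R) z \<partial>lborel)"
    by simp
  also have "\<dots> = (\<integral>\<^sup>+z. H (c + z) \<partial>lborel)"
    by (intro nn_integral_cong) (auto simp: H indicator_def dist_norm)
  also have "\<dots> = (\<integral>\<^sup>+z. H z \<partial>distr lborel borel ((+) c))"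
    by (subst nn_integral_distr) auto
  also have "\<dots> = (\<integral>\<^sup>+z. H z * indicator unit_disc z \<partial>lborel)"
    unfolding lborel_distr_plus by (intro nn_integral_cong) (use sub in \<open>auto simp: H indicator_def\<close>)
  finally have "ennreal (cmod (h c) powr q * (pi * R\<^sup>2)) / ennreal pi \<le> (\<integral>\<^sup>+z. H z * indicator unit_disc z \<partial>lborel) / ennreal pi"
    by (rule divide_right_mono_ennreal)
  also have "ennreal (cmod (h c) powr q * (pi * R\<^sup>2)) / ennreal pi = ennreal (cmod (h c) powr q * R\<^sup>2)"
    by (subst divide_ennreal) auto
  also have "(\<integral>\<^sup>+z. H z * indicator unit_disc z \<partial>lborel) / ennreal pi = (\<integral>\<^sup>+z. H z \<partial>disc_area)"
    by (rule nn_integral_disc_area[symmetric]) measurable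
  finally show ?thesis by (simp add: H)
qed

section \<open>Inclusion of the Besov space in the Dirichlet space\<close>

lemma ennreal_finiteE:
  assumes "x < (\<infinity> :: ennreal)"
  obtains K where "0 \<le> K" "x = ennreal K"
  using assms by (cases x rule: ennreal_cases) auto

text \<open>The submean inequality on a disc of radius comparable to \<open>1 - cmod z\<close>
  bounds \<open>cmod (h z) * (1 - cmod z)\<close>. In
  \<open>cmod h powr 2 = cmod h powr p * cmod h powr (2 - p)\<close> the last factor is then at most
  a multiple of \<open>(1 - cmod z) powr (p - 2)\<close>; for this the exponent \<open>2 - p\<close>
  must be nonnegative.\<close>

lemma besov_imp_dirichlet:
  assumes p: "1 < p" "p \<le> 2" and h: "h holomorphic_on unit_disc"
    and fin: "(\<integral>\<^sup>+z. ennreal ((1 - cmod z) powr (p - 2) * cmod (h z) powr p) \<partial>disc_area) < \<infinity>"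
  shows "(\<integral>\<^sup>+z. ennreal ((cmod (h z))\<^sup>2) \<partial>disc_area) < \<infinity>"
proof -
  obtain K where K: "0 \<le> K" "(\<integral>\<^sup>+z. ennreal ((1 - cmod z) powr (p - 2) * cmod (h z) powr p) \<partial>disc_area) = ennreal K"
    using fin by (rule ennreal_finiteE)
  have hm[measurable]: "(\<lambda>z. indicator unit_disc z *\<^sub>R h z) \<in> borel_measurable borel"
    by (rule borel_measurable_continuous_on_indicator)
      (auto intro: holomorphic_on_imp_continuous_on h)
  \<comment> \<open>The constant is \<open>4 * 4\<close>: one factor from the squared radius
    \<open>(\<delta> / 2)\<^sup>2\<close>, the other from \<open>2 powr (p - 2) \<ge> 1 / 4\<close>.
    Since \<open>p - 2\<close> is not positive, \<open>1 - cmod w \<le> 2 * \<delta>\<close> bounds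
    the weight from below on the small disc.\<close>
  have bound: "cmod (h z) powr p \<le> 16 * K * (1 - cmod z) powr - p" if z: "z \<in> unit_disc" for z
  proof -
    define \<delta> where "\<delta> = 1 - cmod z"
    have \<delta>: "0 < \<delta>" using z by (simp add: \<delta>_def)
    have [measurable]: "ball z (\<delta> / 2) \<in> sets (borel :: complex measure)" by simp
    have near: "cmod w < 1" "1 - cmod w \<le> 2 * \<delta>" if "w \<in> ball z (\<delta> / 2)" for w
      using that norm_triangle_ineq3[of z w] \<delta> by (auto simp: dist_norm \<delta>_def)
    then have sub: "ball z (\<delta> / 2) \<subseteq> unit_disc" by auto
    have "ennreal ((2 * \<delta>) powr (p - 2)) * ennreal (cmod (h z) powr p * (\<delta> / 2)\<^sup>2)
        \<le> ennreal ((2 * \<delta>) powr (p - 2)) * (\<integral>\<^sup>+w. ennreal (cmod (h w) powr p) * indicator (ball z (\<delta> / 2)) w \<partial>disc_area)"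
      by (intro mult_left_mono submean holomorphic_on_subset[OF h sub] sub) (use \<delta> p in auto)
    also have "(\<integral>\<^sup>+w. ennreal (cmod (h w) powr p) * indicator (ball z (\<delta> / 2)) w \<partial>disc_area)
       = (\<integral>\<^sup>+w. ennreal (cmod (indicator unit_disc w *\<^sub>R h w) powr p) * indicator (ball z (\<delta> / 2)) w \<partial>disc_area)"
      using sub by (intro nn_integral_cong) (auto simp: indicator_def)
    also have "ennreal ((2 * \<delta>) powr (p - 2)) * \<dots>
       = (\<integral>\<^sup>+w. ennreal ((2 * \<delta>) powr (p - 2)) * (ennreal (cmod (indicator unit_disc w *\<^sub>R h w) powr p) * indicator (ball z (\<delta> / 2)) w) \<partial>disc_area)"
      by (rule nn_integral_cmult[symmetric]) measurable
    also have "\<dots> \<le> (\<integral>\<^sup>+z. ennreal ((1 - cmod z) powr (p - 2) * cmod (h z) powr p) \<partial>disc_area)"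
    proof (rule nn_integral_mono)
      fix w
      show "ennreal ((2 * \<delta>) powr (p - 2)) * (ennreal (cmod (indicator unit_disc w *\<^sub>R h w) powr p) * indicator (ball z (\<delta> / 2)) w)
        \<le> ennreal ((1 - cmod w) powr (p - 2) * cmod (h w) powr p)"
      proof (cases "w \<in> ball z (\<delta> / 2)")
        case True
        have "(2 * \<delta>) powr (p - 2) \<le> (1 - cmod w) powr (p - 2)"
          using near[OF True] p by (intro powr_mono2') auto
        then show ?thesis using True near(1)[OF True]
          by (simp add: ennreal_mult mult_right_mono ennreal_leI)
      qed simp
    qed
    also have "\<dots> = ennreal K" by (rule K)
    finally have "(2 * \<delta>) powr (p - 2) * (cmod (h z) powr p * (\<delta> / 2)\<^sup>2) \<le> K"
      using K(1) by (simp flip: ennreal_mult)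
    also have "(2 * \<delta>) powr (p - 2) = 2 powr (p - 2) * \<delta> powr (p - 2)"
      using \<delta> by (simp add: powr_mult)
    also have "\<delta> powr (p - 2) = \<delta> powr p / \<delta>\<^sup>2"
      using \<delta> by (simp add: powr_diff powr_numeral)
    also have "2 powr (p - 2) * (\<delta> powr p / \<delta>\<^sup>2) * (cmod (h z) powr p * (\<delta> / 2)\<^sup>2) = 2 powr (p - 2) / 4 * (cmod (h z) powr p * \<delta> powr p)"
      using \<delta> by (simp add: power2_eq_square field_simps)
    finally have "2 powr (p - 2) / 4 * (cmod (h z) powr p * \<delta> powr p) \<le> K" .
    moreover have "2 powr (p - 2) \<ge> 2 powr (- 2)" using p by (intro powr_mono) auto
    then have "2 powr (p - 2) / 4 \<ge> 1 / 16" by (simp add: powr_minus powr_numeral)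
    then have "1 / 16 * (cmod (h z) powr p * \<delta> powr p) \<le> 2 powr (p - 2) / 4 * (cmod (h z) powr p * \<delta> powr p)"
      by (rule mult_right_mono) simp
    ultimately have "cmod (h z) powr p * \<delta> powr p \<le> 16 * K" by linarith
    then show ?thesis using \<delta>
      by (simp add: \<delta>_def[symmetric] powr_minus field_simps)
  qed
  define M where "M = (16 * K) powr ((2 - p) / p)"
  have "(\<integral>\<^sup>+z. ennreal ((cmod (h z))\<^sup>2) \<partial>disc_area)
     = (\<integral>\<^sup>+z. ennreal ((cmod (indicator unit_disc z *\<^sub>R h z))\<^sup>2) \<partial>disc_area)"
    by (rule nn_integral_cong_AE, use AE_disc_area in eventually_elim) (simp add: indicator_def)
  also have "\<dots>
     \<le> (\<integral>\<^sup>+z. ennreal M * ennreal ((1 - cmod z) powr (p - 2) * cmod (indicator unit_disc z *\<^sub>R h z) powr p) \<partial>disc_area)"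
  proof (rule nn_integral_mono_AE, use AE_disc_area in eventually_elim)
    fix z assume z: "z \<in> unit_disc"
    define \<delta> where "\<delta> = 1 - cmod z"
    have \<delta>: "0 < \<delta>" using z by (simp add: \<delta>_def)
    have "(cmod (h z))\<^sup>2 = cmod (h z) powr p * (cmod (h z) powr p) powr ((2 - p) / p)"
      using p by (cases "h z = 0") (simp_all add: powr_powr powr_add[symmetric])
    also have "\<dots> \<le> cmod (h z) powr p * (16 * K * \<delta> powr - p) powr ((2 - p) / p)"
      using bound[OF z] p by (intro mult_left_mono powr_mono2) (auto simp: \<delta>_def)
    also have "(16 * K * \<delta> powr - p) powr ((2 - p) / p) = M * \<delta> powr (p - 2)"
      using p K(1) by (simp add: M_def powr_mult powr_powr)
    finally show "ennreal ((cmod (indicator unit_disc z *\<^sub>R h z))\<^sup>2) \<le> ennreal M * ennreal ((1 - cmod z) powr (p - 2) * cmod (indicator unit_disc z *\<^sub>R h z) powr p)"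
      using z by (simp add: \<delta>_def M_def indicator_def mult_ac flip: ennreal_mult')
  qed
  also have "\<dots> = ennreal M * (\<integral>\<^sup>+z. ennreal ((1 - cmod z) powr (p - 2) * cmod (indicator unit_disc z *\<^sub>R h z) powr p) \<partial>disc_area)"
    by (rule nn_integral_cmult) measurable
  also have "(\<integral>\<^sup>+z. ennreal ((1 - cmod z) powr (p - 2) * cmod (indicator unit_disc z *\<^sub>R h z) powr p) \<partial>disc_area) = ennreal K"
    unfolding K(2)[symmetric]
    by (rule nn_integral_cong_AE, use AE_disc_area in eventually_elim) (simp add: indicator_def)
  finally show ?thesis
    by (rule le_less_trans) (simp add: ennreal_mult_less_top)
qed

section \<open>The reproducing formula of the Dirichlet space\<close>

lemma measurable_cnj[measurable]: "cnj \<in> borel_measurable borel"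
  by (intro borel_measurable_continuous_onI continuous_intros)

text \<open>Off the disc the values of a function holomorphic there are arbitrary. Wherever
  measurability matters it is replaced by this cut-off, which agrees with it almost everywhere for
  \<open>disc_area\<close>.\<close>

lemma borel_measurable_indicator_holomorphic:
  assumes "h holomorphic_on unit_disc"
  shows "(\<lambda>z. indicator unit_disc z *\<^sub>R h z) \<in> borel_measurable borel"
  by (rule borel_measurable_continuous_on_indicator)
    (auto intro: holomorphic_on_imp_continuous_on assms)

lemma integral_disc_area_rotate:
  fixes f :: "complex \<Rightarrow> complex"
  assumes [measurable]: "f \<in> borel_measurable borel" and u: "cmod u = 1"
  shows "(\<integral>z. f (u * z) \<partial>disc_area) = (\<integral>z. f z \<partial>disc_area)"
    and "(\<integral>z. norm (f (u * z)) \<partial>disc_area) = (\<integral>z. norm (f z) \<partial>disc_area)"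
    and "integrable disc_area (\<lambda>z. f (u * z)) = integrable disc_area f"
  using integral_distr[of "(*) u" disc_area borel f] integral_distr[of "(*) u" disc_area borel "\<lambda>z. norm (f z)"]
    integrable_distr_eq[of "(*) u" disc_area borel f]
  by (simp_all add: distr_disc_area_rotate[OF u])

lemma integral_disc_area_radial:
  fixes k :: "real \<Rightarrow> complex"
  assumes [measurable]: "k \<in> borel_measurable borel"
  shows "(\<integral>u. k ((cmod u)\<^sup>2) \<partial>disc_area) = (\<integral>r. indicator {0..1} r *\<^sub>R k r \<partial>lborel)"
proof -
  have *: "uniform_measure lborel {0..1::real} = density lborel (\<lambda>x. ennreal (indicator {0..1} x))"
    unfolding uniform_measure_def by (simp add: divide_ennreal_def ennreal_indicator)
  have "(\<integral>u. k ((cmod u)\<^sup>2) \<partial>disc_area) = (\<integral>r. k r \<partial>distr disc_area borel (\<lambda>z. (cmod z)\<^sup>2))"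
    by (rule integral_distr[symmetric]) auto
  also have "\<dots> = (\<integral>r. indicator {0..1} r *\<^sub>R k r \<partial>lborel)"
    unfolding disc_area_radial * by (rule integral_density) auto
  finally show ?thesis .
qed

lemma integrable_of_square:
  assumes m[measurable]: "F \<in> borel_measurable borel"
    and fin: "(\<integral>\<^sup>+z. ennreal ((cmod (F z))\<^sup>2) \<partial>disc_area) < \<infinity>"
  shows "integrable disc_area F"
proof (rule integrableI_bounded)
  have "(\<integral>\<^sup>+z. ennreal (cmod (F z)) \<partial>disc_area) \<le> (\<integral>\<^sup>+z. 1 + ennreal ((cmod (F z))\<^sup>2) \<partial>disc_area)"
  proof (rule nn_integral_mono)
    fix z
    have "0 \<le> (cmod (F z) - 1)\<^sup>2" by simp
    then have "2 * cmod (F z) \<le> (cmod (F z))\<^sup>2 + 1"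
      by (simp add: power2_diff)
    then have "cmod (F z) \<le> 1 + (cmod (F z))\<^sup>2"
      using norm_ge_zero[of "F z"] by linarith
    then have "ennreal (cmod (F z)) \<le> ennreal (1 + (cmod (F z))\<^sup>2)" by (rule ennreal_leI)
    then show "ennreal (cmod (F z)) \<le> 1 + ennreal ((cmod (F z))\<^sup>2)"
      by (simp add: ennreal_plus)
  qed
  also have "\<dots> = 1 + (\<integral>\<^sup>+z. ennreal ((cmod (F z))\<^sup>2) \<partial>disc_area)"
    by (subst nn_integral_add) (auto simp: disc_area.emeasure_space_1[simplified])
  also have "\<dots> < \<infinity>" using fin by simp
  finally show "(\<integral>\<^sup>+z. ennreal (cmod (F z)) \<partial>disc_area) < \<infinity>" .
qed simp

text \<open>Averaging over rotations of \<open>u\<close> turns the integrand into \<open>w f'(|u|\<^sup>2 w)\<close> by Cauchy's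
  formula, and \<open>|u|\<^sup>2\<close> is uniformly distributed on the unit interval.\<close>

lemma dirichlet_reproducing:
  assumes f: "f holomorphic_on unit_disc"
    and fin: "dirichlet_energy f < \<infinity>"
    and w: "w \<in> unit_disc"
  shows "integrable disc_area (\<lambda>u. (indicator unit_disc u *\<^sub>R deriv f u) * w / (1 - cnj u * w))"
    and "(\<integral>u. (indicator unit_disc u *\<^sub>R deriv f u) * w / (1 - cnj u * w) \<partial>disc_area) = f w - f 0"
proof -
  define F where "F u = indicator unit_disc u *\<^sub>R deriv f u" for u
  define K where "K u = F u * w / (1 - cnj u * w)" for u
  have df: "deriv f holomorphic_on unit_disc"
    by (rule holomorphic_deriv[OF f]) simp
  have F[measurable]: "F \<in> borel_measurable borel"
    unfolding F_def by (rule borel_measurable_indicator_holomorphic[OF df])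
  have K[measurable]: "K \<in> borel_measurable borel"
    unfolding K_def by measurable
  have w1: "cmod w < 1" using w by simp
  have "(\<integral>\<^sup>+z. ennreal ((cmod (F z))\<^sup>2) \<partial>disc_area) < \<infinity>"
    using fin by (rule le_less_trans[rotated]) (auto simp: F_def indicator_def intro!: nn_integral_mono)
  then have intF: "integrable disc_area F" by (rule integrable_of_square[OF F])
  have normK: "cmod (K u) \<le> cmod (F u) * (1 / (1 - cmod w))" for u
  proof (cases "u \<in> unit_disc")
    case True
    have "cmod w / kernel_norm u w \<le> 1 / (1 - cmod w)"
      using unit_disc_kernel(2)[OF True w] w1 by (intro frac_le) auto
    from mult_left_mono[OF this, of "cmod (F u)"] show ?thesis
      by (simp add: K_def norm_mult norm_divide)
  qed (simp add: K_def F_def)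
  have intK: "integrable disc_area K"
    by (rule Bochner_Integration.integrable_bound[OF integrable_mult_left[OF integrable_norm[OF intF]], of _ "1 / (1 - cmod w)"])
      (use normK w1 in auto)
  then show "integrable disc_area (\<lambda>u. (indicator unit_disc u *\<^sub>R deriv f u) * w / (1 - cnj u * w))"
    unfolding K_def F_def .
  interpret P: pair_sigma_finite lborel disc_area ..
  let ?G = "\<lambda>t u. indicator {0..1::real} t *\<^sub>R K (unit_circle t * u)"
  have intG: "integrable (lborel \<Otimes>\<^sub>M disc_area) (case_prod ?G)"
  proof (rule P.Fubini_integrable)
    show "case_prod ?G \<in> borel_measurable (lborel \<Otimes>\<^sub>M disc_area)"
      by measurable
    have "(\<lambda>t. \<integral>u. norm (case (t, u) of (t, u) \<Rightarrow> ?G t u) \<partial>disc_area) = (\<lambda>t. indicator {0..1} t *\<^sub>R (\<integral>u. norm (K u) \<partial>disc_area))"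
      using integral_disc_area_rotate(2)[OF K norm_unit_circle] by (auto simp: fun_eq_iff)
    then show "integrable lborel (\<lambda>t. \<integral>u. norm (case (t, u) of (t, u) \<Rightarrow> ?G t u) \<partial>disc_area)"
      by simp
    show "AE t in lborel. integrable disc_area (\<lambda>u. case (t, u) of (t, u) \<Rightarrow> ?G t u)"
      using integral_disc_area_rotate(3)[OF K norm_unit_circle] intK by simp
  qed
  have inner: "(\<integral>t. ?G t u \<partial>lborel) = w * deriv f (of_real ((cmod u)\<^sup>2) * w)" if u: "u \<in> unit_disc" for u
  proof -
    have u1: "cmod u < 1" using u by simp
    have p1: "cmod (cnj u * w) < 1"
      using mult_strict_mono[OF u1 w1] by (simp add: norm_mult)
    have "(\<lambda>x. deriv f (x * u)) holomorphic_on cball 0 1"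
    proof (rule holomorphic_on_compose[of "\<lambda>x. x * u" _ "deriv f", unfolded o_def])
      show "deriv f holomorphic_on (\<lambda>x. x * u) ` cball 0 1"
      proof (rule holomorphic_on_subset[OF df], clarsimp simp: norm_mult)
        fix x :: complex assume "cmod x \<le> 1"
        then show "cmod x * cmod u < 1"
          using u1 mult_right_mono[of "cmod x" 1 "cmod u"] by simp
      qed
    qed (intro holomorphic_intros)
    from has_integral_mult_right[OF circle_mean[OF this p1], of w]
    have "((\<lambda>t. w * (deriv f (unit_circle t * u) * unit_circle t / (unit_circle t - cnj u * w))) has_integral
        w * deriv f (cnj u * w * u)) {0..1}" .
    \<comment> \<open>On the unit circle conjugation is inversion. This turns the kernel,
      antiholomorphic in \<open>u\<close>, into a Cauchy kernel with pole at
      \<open>cnj u * w\<close>, inside the circle.\<close>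
    moreover have eq: "w * (deriv f (unit_circle t * u) * unit_circle t / (unit_circle t - cnj u * w)) = K (unit_circle t * u)" for t
    proof -
      have "cnj (unit_circle t) * unit_circle t = 1"
        by (metis complex_norm_square mult.commute norm_unit_circle of_real_1 power_one)
      then have "cnj (unit_circle t) = 1 / unit_circle t" by (simp add: field_simps)
      then have "1 - cnj (unit_circle t * u) * w = (unit_circle t - cnj u * w) / unit_circle t"
        by (simp add: field_simps)
      then show ?thesis
        using u1 by (simp add: K_def F_def norm_mult)
    qed
    ultimately have mean: "((\<lambda>t. K (unit_circle t * u)) has_integral w * deriv f (cnj u * w * u)) {0..1}"
      by simp
    have "continuous_on {0..1} (\<lambda>t. w * (deriv f (unit_circle t * u) * unit_circle t / (unit_circle t - cnj u * w)))"
    proof (intro continuous_intros continuous_on_compose2[OF holomorphic_on_imp_continuous_on[OF df]])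
      show "\<forall>t\<in>{0..1}. unit_circle t - cnj u * w \<noteq> 0"
        using p1 by (metis less_irrefl norm_unit_circle right_minus_eq)
    qed (use u1 in \<open>auto simp: norm_mult\<close>)
    then have "set_integrable lborel {0..1} (\<lambda>t. K (unit_circle t * u))"
      unfolding eq by (rule borel_integrable_atLeastAtMost')
    from set_borel_integral_eq_integral(2)[OF this] mean
    have "(\<integral>t. ?G t u \<partial>lborel) = w * deriv f (cnj u * w * u)"
      by (simp add: set_lebesgue_integral_def integral_unique)
    also have "cnj u * w * u = of_real ((cmod u)\<^sup>2) * w"
      by (simp add: complex_norm_square mult_ac del: of_real_power)
    finally show ?thesis .
  qed
  define k where "k r = indicator {0..1} r *\<^sub>R (w * deriv f (of_real r * w))" for r :: real
  have rw: "of_real r * w \<in> unit_disc" if "r \<in> {0..1}" for r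
    using that w1 mult_right_mono[of r 1 "cmod w"] by (auto simp: norm_mult)
  have contk: "continuous_on {0..1} (\<lambda>r::real. w * deriv f (of_real r * w))"
    by (intro continuous_intros continuous_on_compose2[OF holomorphic_on_imp_continuous_on[OF df]])
      (use rw in auto)
  have [measurable]: "k \<in> borel_measurable borel"
    unfolding k_def by (rule borel_measurable_continuous_on_indicator[OF _ contk]) simp
  have "(\<integral>u. K u \<partial>disc_area) = (\<integral>t. indicator {0..1::real} t *\<^sub>R (\<integral>u. K u \<partial>disc_area) \<partial>lborel)"
    by simp
  also have "\<dots> = (\<integral>t. (\<integral>u. ?G t u \<partial>disc_area) \<partial>lborel)"
    using integral_disc_area_rotate(1)[OF K norm_unit_circle] by simp
  also have "\<dots> = (\<integral>u. (\<integral>t. ?G t u \<partial>lborel) \<partial>disc_area)"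
    by (rule P.Fubini_integral[OF intG, symmetric])
  also have "\<dots> = (\<integral>u. k ((cmod u)\<^sup>2) \<partial>disc_area)"
  proof (rule integral_cong_AE)
    show "AE u in disc_area. (\<integral>t. ?G t u \<partial>lborel) = k ((cmod u)\<^sup>2)"
      using AE_disc_area
    proof eventually_elim
      case (elim u)
      then have "(cmod u)\<^sup>2 \<in> {0..1}" by (simp add: power_le_one)
      then show ?case using inner[OF elim] by (simp add: k_def)
    qed
  qed measurable
  also have "\<dots> = (\<integral>r. indicator {0..1} r *\<^sub>R k r \<partial>lborel)"
    by (rule integral_disc_area_radial) simp
  also have "\<dots> = (LINT r:{0..1}|lborel. w * deriv f (of_real r * w))"
    unfolding set_lebesgue_integral_def k_def by (intro Bochner_Integration.integral_cong) (auto simp: indicator_def)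
  also have "\<dots> = integral {0..1} (\<lambda>r. w * deriv f (of_real r * w))"
    by (rule set_borel_integral_eq_integral(2)[OF borel_integrable_atLeastAtMost'[OF contk]])
  \<comment> \<open>The integrand is the derivative of \<open>f\<close> along the segment from
    \<open>0\<close> to \<open>w\<close>.\<close>
  also have "\<dots> = f (of_real 1 * w) - f (of_real 0 * w)"
  proof (intro integral_unique fundamental_theorem_of_calculus)
    fix r :: real assume r: "r \<in> {0..1}"
    have "(f has_field_derivative deriv f (of_real r * w)) (at (of_real r * w))"
      using f rw[OF r] by (intro holomorphic_derivI[of f unit_disc]) auto
    moreover have "((\<lambda>r. of_real r * w) has_vector_derivative w) (at r within {0..1})"
      by (auto intro!: derivative_eq_intros)
    ultimately show "((\<lambda>r. f (of_real r * w)) has_vector_derivative w * deriv f (of_real r * w)) (at r within {0..1})"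
      using field_vector_diff_chain_within[of "\<lambda>r. of_real r * w" w r "{0..1}" f "deriv f (of_real r * w)"]
      by (simp add: o_def has_field_derivative_at_within)
  qed simp
  finally show "(\<integral>u. (indicator unit_disc u *\<^sub>R deriv f u) * w / (1 - cnj u * w) \<partial>disc_area) = f w - f 0"
    unfolding K_def F_def by simp
qed

text \<open>Subtract the reproducing formulas at \<open>z\<close> and \<open>a\<close>: the constant
  \<open>f 0\<close> drops out, and the difference of the two kernels has numerator
  \<open>z - a\<close>. This zero on the diagonal is what makes the weighted estimate of the
  oscillation possible.\<close>

lemma dirichlet_difference:
  assumes f: "f holomorphic_on unit_disc"
    and fin: "dirichlet_energy f < \<infinity>"
    and z: "z \<in> unit_disc" and a: "a \<in> unit_disc"
  shows "ennreal (cmod (f z - f a)) \<le> (\<integral>\<^sup>+u. ennreal (cmod (deriv f u) * (cmod (z - a) / (kernel_norm u z * kernel_norm u a))) \<partial>disc_area)"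
proof -
  define K where "K w u = (indicator unit_disc u *\<^sub>R deriv f u) * w / (1 - cnj u * w)" for w u
  note rep = dirichlet_reproducing[OF f fin, folded K_def]
  have "f z - f a = (\<integral>u. K z u - K a u \<partial>disc_area)"
    using rep[OF z] rep[OF a] by simp
  moreover have "integrable disc_area (\<lambda>u. K z u - K a u)"
    using rep[OF z] rep[OF a] by simp
  ultimately have "ennreal (cmod (f z - f a)) \<le> (\<integral>\<^sup>+u. ennreal (cmod (K z u - K a u)) \<partial>disc_area)"
    by (simp add: integral_norm_bound_ennreal)
  also have "\<dots> = (\<integral>\<^sup>+u. ennreal (cmod (deriv f u) * (cmod (z - a) / (kernel_norm u z * kernel_norm u a))) \<partial>disc_area)"
  proof (rule nn_integral_cong_AE, use AE_disc_area in eventually_elim)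
    fix u assume u: "u \<in> unit_disc"
    have nz: "1 - cnj u * z \<noteq> 0" "1 - cnj u * a \<noteq> 0"
      using unit_disc_kernel(5) u z a by auto
    have "K z u - K a u = deriv f u * ((z - a) / ((1 - cnj u * z) * (1 - cnj u * a)))"
      using u nz by (simp add: K_def divide_simps) (simp add: algebra_simps)
    then show "ennreal (cmod (K z u - K a u)) = ennreal (cmod (deriv f u) * (cmod (z - a) / (kernel_norm u z * kernel_norm u a)))"
      by (simp add: norm_mult norm_divide)
  qed
  finally show ?thesis .
qed

section \<open>Green function and Moebius weight\<close>

lemma norm_square_identity:
  "(kernel_norm a z)\<^sup>2 - (cmod (a - z))\<^sup>2 = (1 - (cmod a)\<^sup>2) * (1 - (cmod z)\<^sup>2)"
  unfolding cmod_power2 by (simp add: power2_eq_square algebra_simps)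

lemma one_minus_phi:
  assumes "a \<in> unit_disc" "z \<in> unit_disc"
  shows "1 - (cmod (phi a z))\<^sup>2 = (1 - (cmod a)\<^sup>2) * (1 - (cmod z)\<^sup>2) / (kernel_norm a z)\<^sup>2"
proof -
  have "0 < (kernel_norm a z)\<^sup>2" using unit_disc_kernel(4)[OF assms] by simp
  then show ?thesis
    using norm_square_identity[of a z]
    by (simp add: phi_def norm_divide power_divide field_simps)
qed

lemma phi_bounds:
  assumes "a \<in> unit_disc" "z \<in> unit_disc"
  shows "0 < 1 - (cmod (phi a z))\<^sup>2" "cmod (phi a z) < 1" "cmod (a - z) \<le> kernel_norm a z"
proof -
  have "0 < (1 - (cmod a)\<^sup>2) * (1 - (cmod z)\<^sup>2)"
    using assms by (simp add: power_less_one_iff)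
  then show 1: "0 < 1 - (cmod (phi a z))\<^sup>2"
    unfolding one_minus_phi[OF assms] using unit_disc_kernel(4)[OF assms] by simp
  then show 2: "cmod (phi a z) < 1"
    by (metis diff_gt_0_iff_gt norm_ge_zero not_less one_le_power)
  show "cmod (a - z) \<le> kernel_norm a z"
    using 2 unit_disc_kernel(4)[OF assms] by (simp add: phi_def norm_divide)
qed

lemma green_eq: "green z a = - ln (cmod (phi a z))"
  by (cases "a = z"; cases "1 - cnj a * z = 0")
    (simp_all add: green_def phi_def norm_divide ln_div)

lemma AE_disc_area_neq: "AE z in disc_area. z \<noteq> a"
  unfolding disc_area_def
  by (rule AE_uniform_measureI) (use AE_lborel_singleton[of a] in auto)

text \<open>For \<open>x = cmod (phi a z)\<close> this is
  \<open>1 - x\<^sup>2 \<le> - ln (x\<^sup>2)\<close>. The case \<open>z = a\<close> is excluded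
  because the conventional value of \<open>green\<close> there is \<open>0\<close>, while the left
  side is \<open>1\<close>.\<close>

lemma powr_one_minus_phi_le_green:
  assumes "a \<in> unit_disc" "z \<in> unit_disc" "z \<noteq> a" "0 < s" "s < 1"
  shows "(1 - (cmod (phi a z))\<^sup>2) powr s \<le> 2 * green z a powr s"
proof -
  have x: "0 < cmod (phi a z)" "cmod (phi a z) < 1"
    using phi_bounds(2)[OF assms(1,2)] assms(3) unit_disc_kernel(5)[OF assms(1,2)] by (auto simp: phi_def)
  have "ln ((cmod (phi a z))\<^sup>2) \<le> (cmod (phi a z))\<^sup>2 - 1"
    using x by (intro ln_le_minus_one) simp
  then have "1 - (cmod (phi a z))\<^sup>2 \<le> 2 * green z a"
    using x by (simp add: green_eq ln_realpow)
  then have "(1 - (cmod (phi a z))\<^sup>2) powr s \<le> (2 * green z a) powr s"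
    using phi_bounds(1)[OF assms(1,2)] assms(4) by (intro powr_mono2) auto
  also have "\<dots> = 2 powr s * green z a powr s"
    by (rule powr_mult)
  also have "\<dots> \<le> 2 powr 1 * green z a powr s"
    using assms by (intro mult_right_mono powr_mono) auto
  finally show ?thesis by simp
qed

lemma nn_integral_complex_affine:
  fixes c :: complex
  assumes [measurable]: "f \<in> borel_measurable borel" and R: "R \<noteq> 0"
  shows "(\<integral>\<^sup>+z. f z \<partial>lborel) = ennreal (R\<^sup>2) * (\<integral>\<^sup>+z. f (c + of_real R * z) \<partial>lborel)"
  by (subst lborel_affine[OF R, of c])
    (simp add: nn_integral_density nn_integral_distr nn_integral_cmult scaleR_conv_of_real)

text \<open>Scaling to the unit disc leaves the integral of \<open>r powr - (s / 2)\<close> over the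
  unit interval, with \<open>r\<close> the squared modulus; its value \<open>1 / (1 - s / 2)\<close>
  is at most \<open>2\<close>.\<close>

lemma disc_area_powr_distance:
  assumes s: "0 < s" "s < 1" and R: "0 < R"
  shows "(\<integral>\<^sup>+z. ennreal ((R / cmod (a - z)) powr s) * indicator (ball a R) z \<partial>disc_area) \<le> ennreal (2 * R\<^sup>2)"
proof -
  have [measurable]: "ball a R \<in> sets (borel :: complex measure)" "unit_disc \<in> sets borel" by simp_all
  let ?f = "\<lambda>z. ennreal ((R / cmod (a - z)) powr s) * indicator (ball a R) z"
  have *: "?f (a + of_real R * u) = ennreal (cmod u powr - s) * indicator unit_disc u" for u
  proof -
    have "(a + of_real R * u \<in> ball a R) = (u \<in> unit_disc)"
      using R by (simp add: dist_norm norm_mult)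
    moreover have "(R / cmod (a - (a + of_real R * u))) powr s = cmod u powr - s"
      using R by (simp add: norm_mult powr_divide powr_minus field_simps)
    ultimately show ?thesis by (simp add: indicator_def)
  qed
  have "(\<integral>\<^sup>+z. ?f z \<partial>disc_area) \<le> (\<integral>\<^sup>+z. ?f z \<partial>lborel) / ennreal pi"
    by (subst nn_integral_disc_area) (auto intro!: divide_right_mono_ennreal nn_integral_mono simp: indicator_def)
  also have "(\<integral>\<^sup>+z. ?f z \<partial>lborel) = ennreal (R\<^sup>2) * (\<integral>\<^sup>+u. ennreal (cmod u powr - s) * indicator unit_disc u \<partial>lborel)"
    using nn_integral_complex_affine[of ?f R a] R unfolding * by simp
  also have "\<dots> / ennreal pi = ennreal (R\<^sup>2) * (\<integral>\<^sup>+u. ennreal (cmod u powr - s) \<partial>disc_area)"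
    by (subst nn_integral_disc_area) (auto simp: ennreal_times_divide)
  also have "(\<integral>\<^sup>+u. ennreal (cmod u powr - s) \<partial>disc_area) = (\<integral>\<^sup>+u. ennreal (((cmod u)\<^sup>2) powr - (s / 2)) \<partial>disc_area)"
    by (intro nn_integral_cong) (simp add: powr_powr flip: powr_numeral)
  also have "\<dots> = (\<integral>\<^sup>+r. ennreal (r powr - (s / 2)) * indicator {0..1} r \<partial>lborel)"
    by (rule nn_integral_disc_area_radial) simp
  also have "\<dots> = ennreal (1 powr (1 - s / 2) / (1 - s / 2))"
    using nn_integral_powr_from_0[of "s / 2" 1] s by (simp add: mult.commute)
  also have "ennreal (R\<^sup>2) * \<dots> = ennreal (R\<^sup>2 * (1 / (1 - s / 2)))"
    using s by (simp flip: ennreal_mult)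
  also have "\<dots> \<le> ennreal (2 * R\<^sup>2)"
  proof (rule ennreal_leI)
    have "1 / (1 - s / 2) \<le> 2" using s by (simp add: field_simps)
    then show "R\<^sup>2 * (1 / (1 - s / 2)) \<le> 2 * R\<^sup>2"
      using mult_left_mono[of "1 / (1 - s / 2)" 2 "R\<^sup>2"] by simp
  qed
  finally show ?thesis .
qed

text \<open>The pseudohyperbolic disc of radius \<open>1 / 2\<close> about \<open>a\<close> has
  Euclidean size at most a multiple of \<open>\<delta>\<close> and keeps a distance of that order
  from the circle. With \<open>k\<close> the kernel, \<open>cmod (a - z) < k / 2\<close> fed into
  \<open>k \<le> 2 * \<delta> + cmod (a - z)\<close> gives \<open>k \<le> 4 * \<delta>\<close>; the
  last bound follows from \<open>3 / 4 \<le> 1 - (cmod (phi a z))\<^sup>2\<close> and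
  \<open>\<delta> \<le> k\<close>.\<close>

lemma near_pole_bounds:
  assumes a: "a \<in> unit_disc" and z: "z \<in> unit_disc" and near: "cmod (phi a z) < 1 / 2"
  defines "\<delta> \<equiv> 1 - cmod a"
  shows "kernel_norm a z \<le> 4 * \<delta>" "cmod (a - z) < 4 * \<delta>" "3 / 16 * \<delta> \<le> 1 - cmod z"
proof -
  have \<delta>: "0 < \<delta>" "\<delta> \<le> 1" using a by (auto simp: \<delta>_def)
  have k0: "0 < kernel_norm a z" by (rule unit_disc_kernel(4)[OF a z])
  have near': "cmod (a - z) < kernel_norm a z / 2"
    using near k0 by (simp add: phi_def norm_divide field_simps)
  have a2: "1 - (cmod a)\<^sup>2 = \<delta> * (1 + cmod a)" by (simp add: \<delta>_def power2_eq_square algebra_simps)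
  then have a2': "1 - (cmod a)\<^sup>2 \<le> 2 * \<delta>" using a \<delta> by simp
  have a1: "0 < 1 - (cmod a)\<^sup>2" using a by (simp add: power_less_one_iff)
  have "1 - cnj a * z = of_real (1 - (cmod a)\<^sup>2) + cnj a * (a - z)"
    by (simp add: complex_norm_square algebra_simps del: of_real_power)
  then have "kernel_norm a z \<le> cmod (of_real (1 - (cmod a)\<^sup>2)) + cmod (cnj a * (a - z))"
    by (metis norm_triangle_ineq)
  also have "cmod (of_real (1 - (cmod a)\<^sup>2)) = 1 - (cmod a)\<^sup>2"
    using a1 by (simp del: of_real_diff of_real_power)
  also have "cmod (cnj a * (a - z)) \<le> cmod (a - z)"
    using a by (simp add: norm_mult mult_left_le_one_le)
  finally show k4: "kernel_norm a z \<le> 4 * \<delta>" using near' a2' by linarith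
  then show "cmod (a - z) < 4 * \<delta>" using near' \<delta> by linarith
  have "(cmod (phi a z))\<^sup>2 \<le> (1 / 2)\<^sup>2" using near by (intro power_mono) auto
  then have "3 / 4 \<le> 1 - (cmod (phi a z))\<^sup>2" by (simp add: power2_eq_square)
  then have "3 / 4 * (kernel_norm a z)\<^sup>2 \<le> (1 - (cmod a)\<^sup>2) * (1 - (cmod z)\<^sup>2)"
    using k0 by (simp add: one_minus_phi[OF a z] field_simps)
  also have "\<dots> \<le> (2 * \<delta>) * (2 * (1 - cmod z))"
  proof (rule mult_mono)
    have "0 \<le> (1 - cmod z) * (1 - cmod z)" by simp
    then show "1 - (cmod z)\<^sup>2 \<le> 2 * (1 - cmod z)" by (simp add: power2_eq_square algebra_simps)
  qed (use a2' \<delta> z in \<open>auto simp: power_le_one\<close>)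
  finally have "3 / 4 * (kernel_norm a z)\<^sup>2 \<le> 4 * (\<delta> * (1 - cmod z))"
    by (simp add: algebra_simps)
  moreover have "\<delta> * \<delta> \<le> (kernel_norm a z)\<^sup>2"
    using unit_disc_kernel(1)[OF a z] \<delta> unfolding power2_eq_square \<delta>_def by (intro mult_mono) auto
  ultimately have "\<delta> * (3 / 16 * \<delta>) \<le> \<delta> * (1 - cmod z)" by simp
  then show "3 / 16 * \<delta> \<le> 1 - cmod z" using \<delta> by simp
qed

text \<open>At the pole \<open>green\<close> is unbounded while the Moebius weight is at most
  \<open>1\<close>, so no pointwise comparison is possible there. For
  \<open>cmod (phi a z) < 1 / 2\<close> the factor \<open>(cmod (h z))\<^sup>2\<close> is bounded by
  the weighted integral itself, which leaves an integrable power of \<open>cmod (a - z)\<close>;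
  elsewhere the two weights are comparable.\<close>

lemma green_integral_le:
  assumes s: "0 < s" "s < 1" and h: "h holomorphic_on unit_disc" and a: "a \<in> unit_disc"
  shows "(\<integral>\<^sup>+z. ennreal ((cmod (h z))\<^sup>2 * green z a powr s) \<partial>disc_area)
    \<le> ennreal 2000000 * (\<integral>\<^sup>+z. ennreal ((cmod (h z))\<^sup>2 * (1 - (cmod (phi a z))\<^sup>2) powr s) \<partial>disc_area)"
    (is "_ \<le> _ * ?I")
proof (cases "?I < \<infinity>")
  case True
  then obtain I where I: "0 \<le> I" "?I = ennreal I" by (rule ennreal_finiteE)
  define \<delta> where "\<delta> = 1 - cmod a"
  have \<delta>: "0 < \<delta>" "\<delta> \<le> 1" using a by (auto simp: \<delta>_def)
  have [measurable]: "phi a \<in> borel_measurable borel" unfolding phi_def by measurable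
  define H where "H z = indicator unit_disc z *\<^sub>R h z" for z
  have [measurable]: "H \<in> borel_measurable borel"
    unfolding H_def by (rule borel_measurable_indicator_holomorphic[OF h])
  have [measurable]: "ball c r \<in> sets (borel :: complex measure)" for c r by simp
  have IH: "(\<integral>\<^sup>+z. ennreal ((cmod (H z))\<^sup>2 * (1 - (cmod (phi a z))\<^sup>2) powr s) \<partial>disc_area) = ennreal I"
    unfolding I(2)[symmetric]
    by (rule nn_integral_cong_AE, use AE_disc_area in eventually_elim) (simp add: H_def)
  \<comment> \<open>Submean inequality on the disc of radius \<open>\<delta> / 16\<close>, where the
    Moebius weight is at least \<open>1 / 200\<close>:
    \<open>51200 = 200 * 16\<^sup>2\<close>.\<close>
  have near: "(cmod (h z))\<^sup>2 \<le> 51200 * I / \<delta>\<^sup>2" if z: "z \<in> unit_disc" "cmod (phi a z) < 1 / 2" for z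
  proof -
    note b = near_pole_bounds[OF a z, folded \<delta>_def]
    \<comment> \<open>On this disc \<open>1 - cmod w \<ge> (3 / 16 - 1 / 16) * \<delta>\<close> and
      the kernel is at most \<open>5 * \<delta>\<close>, so
      \<open>1 - (cmod (phi a w))\<^sup>2\<close> is at least \<open>(1 / 8) / 25 = 1 / 200\<close>.
      As \<open>s < 1\<close>, taking the power \<open>s\<close> does not decrease it.\<close>
    have nb: "w \<in> unit_disc" "1 / 200 \<le> (1 - (cmod (phi a w))\<^sup>2) powr s" if w: "w \<in> ball z (\<delta> / 16)" for w
    proof -
      have zw: "cmod (z - w) < \<delta> / 16" using w by (simp add: dist_norm)
      have w8: "\<delta> / 8 \<le> 1 - cmod w" using b(3) zw norm_triangle_ineq3[of z w] by linarith
      then show wd: "w \<in> unit_disc" using \<delta> by simp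
      have "1 - cnj a * w = (1 - cnj a * z) + cnj a * (z - w)" by (simp add: algebra_simps)
      then have "kernel_norm a w \<le> kernel_norm a z + cmod (cnj a * (z - w))"
        by (metis norm_triangle_ineq)
      also have "cmod (cnj a * (z - w)) \<le> cmod (z - w)"
        using a by (simp add: norm_mult mult_left_le_one_le)
      finally have "kernel_norm a w \<le> 5 * \<delta>" using b(1) zw \<delta> by linarith
      then have k5: "(kernel_norm a w)\<^sup>2 \<le> 25 * \<delta>\<^sup>2"
        using power_mono[of "kernel_norm a w" "5 * \<delta>" 2] by (simp add: power_mult_distrib)
      have "\<delta> * (\<delta> / 8) \<le> (1 - (cmod a)\<^sup>2) * (1 - (cmod w)\<^sup>2)"
      proof (rule mult_mono)
        show "\<delta> \<le> 1 - (cmod a)\<^sup>2" using a by (simp add: \<delta>_def power2_eq_square mult_left_le)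
        have "(cmod w)\<^sup>2 \<le> cmod w" using wd by (simp add: power2_eq_square mult_left_le)
        then show "\<delta> / 8 \<le> 1 - (cmod w)\<^sup>2" using w8 by linarith
      qed (use \<delta> a in \<open>auto simp: power_le_one\<close>)
      moreover from this have "0 \<le> (1 - (cmod a)\<^sup>2) * (1 - (cmod w)\<^sup>2)"
        by (rule order_trans[rotated]) (use \<delta> in simp)
      ultimately have "\<delta> * (\<delta> / 8) / (25 * \<delta>\<^sup>2) \<le> 1 - (cmod (phi a w))\<^sup>2"
        unfolding one_minus_phi[OF a wd] using k5 \<delta> unit_disc_kernel(4)[OF a wd] by (intro frac_le) auto
      also have "\<delta> * (\<delta> / 8) / (25 * \<delta>\<^sup>2) = 1 / 200" using \<delta> by (simp add: power2_eq_square)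
      finally have lb: "1 / 200 \<le> 1 - (cmod (phi a w))\<^sup>2" .
      have "(1 - (cmod (phi a w))\<^sup>2) powr 1 \<le> (1 - (cmod (phi a w))\<^sup>2) powr s"
        using lb s by (intro powr_mono') auto
      then show "1 / 200 \<le> (1 - (cmod (phi a w))\<^sup>2) powr s" using lb by simp
    qed
    then have sub: "ball z (\<delta> / 16) \<subseteq> unit_disc" by blast
    have "ennreal (cmod (h z) powr 2 * (\<delta> / 16)\<^sup>2) \<le> (\<integral>\<^sup>+w. ennreal (cmod (h w) powr 2) * indicator (ball z (\<delta> / 16)) w \<partial>disc_area)"
      by (intro submean holomorphic_on_subset[OF h sub] sub) (use \<delta> in auto)
    also have "\<dots> \<le> (\<integral>\<^sup>+w. ennreal 200 * ennreal ((cmod (H w))\<^sup>2 * (1 - (cmod (phi a w))\<^sup>2) powr s) \<partial>disc_area)"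
    proof (rule nn_integral_mono)
      fix w
      show "ennreal (cmod (h w) powr 2) * indicator (ball z (\<delta> / 16)) w \<le> ennreal 200 * ennreal ((cmod (H w))\<^sup>2 * (1 - (cmod (phi a w))\<^sup>2) powr s)"
      proof (cases "w \<in> ball z (\<delta> / 16)")
        case True
        have "(cmod (h w))\<^sup>2 * 1 \<le> (cmod (h w))\<^sup>2 * (200 * (1 - (cmod (phi a w))\<^sup>2) powr s)"
          using nb[OF True] by (intro mult_left_mono) auto
        then have "ennreal ((cmod (h w))\<^sup>2) \<le> ennreal (200 * ((cmod (h w))\<^sup>2 * (1 - (cmod (phi a w))\<^sup>2) powr s))"
          by (intro ennreal_leI) (simp add: mult_ac)
        also have "\<dots> = ennreal 200 * ennreal ((cmod (h w))\<^sup>2 * (1 - (cmod (phi a w))\<^sup>2) powr s)"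
          by (rule ennreal_mult) auto
        finally show ?thesis using True nb(1)[OF True]
          by (simp add: H_def)
      qed simp
    qed
    also have "\<dots> = ennreal (200 * I)"
      by (subst nn_integral_cmult, measurable, simp only: IH)
        (rule ennreal_mult[symmetric], use I(1) in auto)
    finally have "cmod (h z) powr 2 * (\<delta> / 16)\<^sup>2 \<le> 200 * I"
      using I(1) by (subst (asm) ennreal_le_iff) auto
    then have "(cmod (h z))\<^sup>2 * \<delta>\<^sup>2 \<le> 51200 * I"
      by (simp add: power_divide)
    then show ?thesis using \<delta> by (simp add: pos_le_divide_eq)
  qed
  define M where "M = 51200 * I / \<delta>\<^sup>2"
  have M: "0 \<le> M" using I(1) by (simp add: M_def)
  have split: "ennreal (2 * A + M * (B * indicator S z)) = ennreal 2 * ennreal A + ennreal M * (ennreal B * indicator S z)"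
    if "0 \<le> A" "0 \<le> B" for A B S and z :: complex
    by (cases "z \<in> S") (use that M in \<open>simp_all add: ennreal_plus ennreal_mult\<close>)
  have pointwise: "(cmod (h z))\<^sup>2 * green z a powr s \<le> 2 * ((cmod (H z))\<^sup>2 * (1 - (cmod (phi a z))\<^sup>2) powr s)
      + M * ((4 * \<delta> / cmod (a - z)) powr s * indicator (ball a (4 * \<delta>)) z)"
    if z: "z \<in> unit_disc" "z \<noteq> a" for z
  proof -
    define x where "x = cmod (phi a z)"
    have x: "0 < x" "x < 1"
      using phi_bounds(2)[OF a z(1)] z(2) unit_disc_kernel(5)[OF a z(1)] by (auto simp: phi_def x_def)
    have nn: "0 \<le> M * ((4 * \<delta> / cmod (a - z)) powr s * indicator (ball a (4 * \<delta>)) z)"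
      using M by simp
    show ?thesis
    proof (cases "x < 1 / 2")
      case True
      note b = near_pole_bounds[OF a z(1) True[unfolded x_def], folded \<delta>_def]
      have az: "0 < cmod (a - z)" using z(2) by simp
      have "green z a \<le> kernel_norm a z / cmod (a - z)"
        unfolding green_def using unit_disc_kernel(4)[OF a z(1)] az by (intro less_imp_le ln_less_self) simp
      also have "\<dots> \<le> 4 * \<delta> / cmod (a - z)" using b(1) az by (intro divide_right_mono) auto
      finally have "green z a powr s \<le> (4 * \<delta> / cmod (a - z)) powr s"
        using s x by (intro powr_mono2) (auto simp: green_eq x_def[symmetric])
      from mult_mono[OF near[OF z(1) True[unfolded x_def], folded M_def] this]
      have le: "(cmod (h z))\<^sup>2 * green z a powr s \<le> M * (4 * \<delta> / cmod (a - z)) powr s"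
        using M by simp
      have ind: "indicator (ball a (4 * \<delta>)) z = (1::real)" using b(2) by (simp add: dist_norm)
      have "0 \<le> 2 * ((cmod (H z))\<^sup>2 * (1 - (cmod (phi a z))\<^sup>2) powr s)" by simp
      from add_mono[OF this le] show ?thesis unfolding ind by simp
    next
      case False
      have "ln (1 / x) \<le> 1 / x - 1" using x by (intro ln_le_minus_one) simp
      also have "\<dots> = (1 - x) / x" using x by (simp add: field_simps)
      also have "\<dots> \<le> (1 - x) / (1 / 2)" using x False by (intro divide_left_mono) auto
      also have "\<dots> \<le> 2 * (1 - x\<^sup>2)" using x by (simp add: power2_eq_square mult_left_le)
      finally have "green z a \<le> 2 * (1 - x\<^sup>2)"
        using x by (simp add: green_eq x_def[symmetric] ln_div)
      then have "green z a powr s \<le> (2 * (1 - x\<^sup>2)) powr s"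
        using s x by (intro powr_mono2) (auto simp: green_eq x_def[symmetric])
      also have "\<dots> = 2 powr s * (1 - x\<^sup>2) powr s"
        by (rule powr_mult)
      also have "\<dots> \<le> 2 powr 1 * (1 - x\<^sup>2) powr s"
        using s by (intro mult_right_mono powr_mono) auto
      finally have "(cmod (h z))\<^sup>2 * green z a powr s \<le> (cmod (h z))\<^sup>2 * (2 * (1 - x\<^sup>2) powr s)"
        by (intro mult_left_mono) auto
      then have "(cmod (h z))\<^sup>2 * green z a powr s \<le> 2 * ((cmod (H z))\<^sup>2 * (1 - (cmod (phi a z))\<^sup>2) powr s)"
        using z(1) by (simp add: H_def x_def mult_ac)
      from add_mono[OF this nn] show ?thesis by simp
    qed
  qed
  have "(\<integral>\<^sup>+z. ennreal ((cmod (h z))\<^sup>2 * green z a powr s) \<partial>disc_area)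
     \<le> (\<integral>\<^sup>+z. ennreal 2 * ennreal ((cmod (H z))\<^sup>2 * (1 - (cmod (phi a z))\<^sup>2) powr s)
      + ennreal (M) * (ennreal ((4 * \<delta> / cmod (a - z)) powr s) * indicator (ball a (4 * \<delta>)) z) \<partial>disc_area)"
  proof (rule nn_integral_mono_AE, use AE_disc_area AE_disc_area_neq[of a] in eventually_elim)
    fix z assume "z \<in> unit_disc" "z \<noteq> a"
    from ennreal_leI[OF pointwise[OF this]]
    show "ennreal ((cmod (h z))\<^sup>2 * green z a powr s) \<le> ennreal 2 * ennreal ((cmod (H z))\<^sup>2 * (1 - (cmod (phi a z))\<^sup>2) powr s)
      + ennreal (M) * (ennreal ((4 * \<delta> / cmod (a - z)) powr s) * indicator (ball a (4 * \<delta>)) z)"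
      by (subst (asm) split) auto
  qed
  also have "\<dots> = ennreal 2 * ennreal I + ennreal (M) * (\<integral>\<^sup>+z. ennreal ((4 * \<delta> / cmod (a - z)) powr s) * indicator (ball a (4 * \<delta>)) z \<partial>disc_area)"
    by (subst nn_integral_add, measurable, subst nn_integral_cmult, measurable, subst nn_integral_cmult, measurable)
      (simp add: IH)
  also have "\<dots> \<le> ennreal 2 * ennreal I + ennreal (M) * ennreal (2 * (4 * \<delta>)\<^sup>2)"
    by (intro add_left_mono mult_left_mono disc_area_powr_distance s) (use \<delta> in auto)
  also have "\<dots> = ennreal (2 * I + M * (2 * (4 * \<delta>)\<^sup>2))"
    using split[where A = I and B = "2 * (4 * \<delta>)\<^sup>2" and S = UNIV, OF I(1)]
    by (simp only: indicator_UNIV mult_1_right) simp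
  \<comment> \<open>The powers of \<open>\<delta>\<close> cancel, so the bound is uniform in
    \<open>a\<close>. The value is \<open>32 * 51200\<close>; with the \<open>2\<close> from the
    region away from the pole it is rounded up to \<open>2000000\<close>.\<close>
  also have "M * (2 * (4 * \<delta>)\<^sup>2) = 1638400 * I"
  proof -
    have "M * (2 * (4 * \<delta>)\<^sup>2) = 32 * (M * \<delta>\<^sup>2)" by (simp add: power_mult_distrib)
    also have "M * \<delta>\<^sup>2 = 51200 * I" using \<delta> by (simp add: M_def)
    finally show ?thesis by simp
  qed
  also have "ennreal (2 * I + 1638400 * I) \<le> ennreal (2000000 * I)"
    using I(1) by (intro ennreal_leI) simp
  also have "\<dots> = ennreal 2000000 * ?I"
    unfolding I(2) by (rule ennreal_mult) (use I(1) in auto)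
  finally show ?thesis .
next
  case False
  then have top: "?I = top" unfolding infinity_ennreal_def using less_top by blast
  show ?thesis unfolding top by (simp add: ennreal_mult_top)
qed

section \<open>Derivative of the integral operator\<close>

lemma T_op_deriv:
  assumes g: "g holomorphic_on unit_disc" and f: "f holomorphic_on unit_disc"
  shows "T_op g f holomorphic_on unit_disc"
    and "z \<in> unit_disc \<Longrightarrow> deriv (T_op g f) z = deriv g z * f z"
proof -
  have "(\<lambda>z. deriv g z * f z) holomorphic_on unit_disc"
    by (rule holomorphic_on_mult[OF holomorphic_deriv[OF g open_ball] f])
  then obtain F where F: "\<And>z. z \<in> unit_disc \<Longrightarrow> (F has_field_derivative deriv g z * f z) (at z within unit_disc)"
    using holomorphic_convex_primitive'[OF convex_ball open_ball] by blast
  \<comment> \<open>On the convex disc the integrand has a primitive, so the integral along the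
    segment depends only on its endpoints.\<close>
  have T: "T_op g f z = F z - F 0" if z: "z \<in> unit_disc" for z
  proof -
    have "path_image (linepath 0 z) \<subseteq> unit_disc"
      using z by (simp add: closed_segment_subset)
    then show ?thesis
      unfolding T_op_def
      using contour_integral_unique[OF contour_integral_primitive[of unit_disc F "\<lambda>z. deriv g z * f z" "linepath 0 z"]] F
      by simp
  qed
  have D: "(T_op g f has_field_derivative deriv g z * f z) (at z)" if z: "z \<in> unit_disc" for z
  proof (rule has_field_derivative_transform_within_open[of "\<lambda>z. F z - F 0"])
    have "(F has_field_derivative deriv g z * f z) (at z)"
      using F[OF z] unfolding at_within_open[OF z open_ball] .
    then show "((\<lambda>z. F z - F 0) has_field_derivative deriv g z * f z) (at z)"
      using DERIV_diff[OF _ DERIV_const] by fastforce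
    show "F w - F 0 = T_op g f w" if "w \<in> unit_disc" for w
      by (rule T[OF that, symmetric])
  qed (use z in simp_all)
  then show "T_op g f holomorphic_on unit_disc"
    unfolding holomorphic_on_open[OF open_ball] by blast
  show "z \<in> unit_disc \<Longrightarrow> deriv (T_op g f) z = deriv g z * f z"
    by (rule DERIV_imp_deriv[OF D])
qed

section \<open>Carleson estimate for the Dirichlet space\<close>

definition Q_weight :: "real \<Rightarrow> complex \<Rightarrow> complex \<Rightarrow> real" where
  "Q_weight s a z = (1 - (cmod (phi a z))\<^sup>2) powr s"

text \<open>The factor \<open>h\<close> stands where the spaces have \<open>deriv f\<close>. Keeping
  it arbitrary allows products such as \<open>deriv g z * f z\<close>, also with a factor that is
  not holomorphic.\<close>

definition Q_mass :: "real \<Rightarrow> (complex \<Rightarrow> complex) \<Rightarrow> complex \<Rightarrow> ennreal" where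
  "Q_mass s h a = (\<integral>\<^sup>+z. ennreal ((cmod (h z))\<^sup>2 * Q_weight s a z) \<partial>disc_area)"

lemma Q_weight_nonneg[simp]: "0 \<le> Q_weight s a z"
  by (simp add: Q_weight_def)

lemma Q_weight_measurable[measurable (raw)]:
  assumes [measurable]: "f \<in> borel_measurable M" "g \<in> borel_measurable M"
  shows "(\<lambda>x. Q_weight s (f x) (g x)) \<in> borel_measurable M"
  unfolding Q_weight_def phi_def by measurable

lemma Q_weight_pos:
  assumes "a \<in> unit_disc" "z \<in> unit_disc"
  shows "0 < Q_weight s a z"
  using phi_bounds(1)[OF assms] by (simp add: Q_weight_def)

lemma Q_weight_eq:
  assumes "a \<in> unit_disc" "z \<in> unit_disc"
  shows "Q_weight s a z = (1 - (cmod a)\<^sup>2) powr s * (1 - (cmod z)\<^sup>2) powr s * kernel_norm a z powr (- 2 * s)"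
proof -
  have k: "0 < kernel_norm a z" by (rule unit_disc_kernel(4)[OF assms])
  have n: "0 \<le> 1 - (cmod a)\<^sup>2" "0 \<le> 1 - (cmod z)\<^sup>2" using assms by (auto simp: power_le_one)
  have "Q_weight s a z = (1 - (cmod a)\<^sup>2) powr s * (1 - (cmod z)\<^sup>2) powr s / ((kernel_norm a z)\<^sup>2) powr s"
    unfolding Q_weight_def one_minus_phi[OF assms] using n by (simp add: powr_divide powr_mult)
  also have "((kernel_norm a z)\<^sup>2) powr s = kernel_norm a z powr (2 * s)"
    using k by (simp add: powr_powr flip: powr_numeral)
  finally show ?thesis by (simp add: powr_minus_divide)
qed

lemma one_minus_square_bounds:
  assumes "a \<in> unit_disc"
  shows "1 - cmod a \<le> 1 - (cmod a)\<^sup>2" "1 - (cmod a)\<^sup>2 \<le> 2 * (1 - cmod a)"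
proof -
  have "0 \<le> (1 - cmod a) * (1 - cmod a)" by simp
  then show "1 - (cmod a)\<^sup>2 \<le> 2 * (1 - cmod a)" by (simp add: power2_eq_square algebra_simps)
  show "1 - cmod a \<le> 1 - (cmod a)\<^sup>2" using assms by (simp add: power2_eq_square mult_left_le)
qed

text \<open>Since \<open>|u - z| \<le> |1 - cnj u * z|\<close>, the kernel satisfies a triangle inequality.\<close>

lemma kernel_triangle:
  assumes "a \<in> unit_disc" "z \<in> unit_disc" "u \<in> unit_disc"
  shows "kernel_norm a z \<le> kernel_norm a u + kernel_norm u z"
proof -
  have "1 - cnj a * z = (1 - cnj a * u) + cnj a * (u - z)" by (simp add: algebra_simps)
  then have "kernel_norm a z \<le> kernel_norm a u + cmod (cnj a * (u - z))"
    by (metis norm_triangle_ineq)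
  also have "cmod (cnj a * (u - z)) \<le> cmod (u - z)"
    using assms(1) by (simp add: norm_mult mult_left_le_one_le)
  also have "cmod (u - z) \<le> kernel_norm u z" by (rule phi_bounds(3)[OF assms(3,2)])
  finally show ?thesis by simp
qed

text \<open>Up to factors in \<open>a\<close> and \<open>z\<close>, this bounds the square of the
  kernel in the difference formula divided by \<open>Q_weight s u z\<close>.\<close>

abbreviation triple_kernel :: "real \<Rightarrow> complex \<Rightarrow> complex \<Rightarrow> complex \<Rightarrow> real" where
  "triple_kernel s z a u \<equiv> (1 - cmod u) powr - s * (kernel_norm z u powr (2 * s - 2) * kernel_norm a u powr - 2)"

text \<open>A two-point version of the classical kernel integrals. With
  \<open>h = kernel_norm a z\<close>, the triangle inequality prevents both kernels from being below
  \<open>h / 2\<close>. Where the \<open>z\<close>-kernel is small the \<open>a\<close>-kernel is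
  frozen at \<open>h\<close> and the truncated integral remains; elsewhere the
  \<open>z\<close>-kernel, whose exponent is negative, is frozen and the integral around
  \<open>a\<close> remains.\<close>

lemma kernel_integral_triple:
  assumes s: "0 < s" "s < 1"
  obtains C where "0 < C" "\<And>a z. a \<in> unit_disc \<Longrightarrow> z \<in> unit_disc \<Longrightarrow>
    (\<integral>\<^sup>+u. ennreal (triple_kernel s z a u) \<partial>disc_area)
    \<le> ennreal (C * (kernel_norm a z powr (2 * s - 2) * (1 - cmod a) powr - s))"
proof -
  obtain C1 where C1: "0 < C1" "\<And>a. a \<in> unit_disc \<Longrightarrow>
    (\<integral>\<^sup>+u. ennreal ((1 - cmod u) powr - s * kernel_norm a u powr - 2) \<partial>disc_area) \<le> ennreal (C1 * (1 - cmod a) powr - s)"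
    using kernel_integral_powr[OF s] by blast
  obtain C2 where C2: "0 < C2" "\<And>z h. z \<in> unit_disc \<Longrightarrow> 0 < h \<Longrightarrow>
    (\<integral>\<^sup>+u. ennreal ((1 - cmod u) powr - s * (kernel_norm z u powr (2 * s - 2)
        * indicator {u. kernel_norm z u \<le> h} u)) \<partial>disc_area) \<le> ennreal (C2 * h powr s)"
    using kernel_integral_truncated[OF s] by blast
  show ?thesis
  proof (rule that[of "4 * C1 + 4 * C2"])
    show "0 < 4 * C1 + 4 * C2" using C1 C2 by simp
    fix a z assume a: "a \<in> unit_disc" and z: "z \<in> unit_disc"
    define h \<delta> where "h = kernel_norm a z" and "\<delta> = 1 - cmod a"
    have h: "0 < h" unfolding h_def by (rule unit_disc_kernel(4)[OF a z])
    have \<delta>: "0 < \<delta>" "\<delta> \<le> h" using a unit_disc_kernel(1)[OF a z] by (auto simp: \<delta>_def h_def)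
    have h2: "(h / 2) powr (2 * s - 2) \<le> 4 * h powr (2 * s - 2)"
    proof -
      have "(h / 2) powr (2 * s - 2) = h powr (2 * s - 2) * 2 powr (2 - 2 * s)"
        using h powr_minus_divide[of 2 "2 * s - 2"] by (simp add: powr_divide)
      also have "\<dots> \<le> h powr (2 * s - 2) * 2 powr 2"
        using s by (intro mult_left_mono powr_mono) auto
      finally show ?thesis by (simp add: mult.commute)
    qed
    have [measurable]: "{u. kernel_norm z u \<le> h} \<in> sets borel" by measurable
    let ?A = "\<lambda>u. (1 - cmod u) powr - s * kernel_norm a u powr - 2"
    let ?B = "\<lambda>u. (1 - cmod u) powr - s * (kernel_norm z u powr (2 * s - 2) * indicator {u. kernel_norm z u \<le> h} u)"
    have "(\<integral>\<^sup>+u. ennreal (triple_kernel s z a u) \<partial>disc_area)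
      \<le> (\<integral>\<^sup>+u. ennreal (4 * h powr (2 * s - 2)) * ennreal (?A u) + ennreal (4 * h powr - 2) * ennreal (?B u) \<partial>disc_area)"
    proof (rule nn_integral_mono_AE, use AE_disc_area in eventually_elim)
      fix u assume u: "u \<in> unit_disc"
      have kz: "0 < kernel_norm z u" and ka: "0 < kernel_norm a u"
        using unit_disc_kernel(4) u z a by auto
      have A0: "0 \<le> ?A u" and B0: "0 \<le> ?B u" by auto
      have "triple_kernel s z a u
        \<le> 4 * h powr (2 * s - 2) * ?A u + 4 * h powr - 2 * ?B u"
      proof (cases "kernel_norm z u < h / 2")
        case True
        then have "h / 2 \<le> kernel_norm a u"
          using kernel_triangle[OF a z u] kernel_swap[of u z] by (simp add: h_def)
        then have "kernel_norm a u powr - 2 \<le> (h / 2) powr - 2" using h by (intro powr_mono2') auto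
        also have "(h / 2) powr - 2 = 4 * h powr - 2" using h by (simp add: powr_minus_divide power_divide)
        finally have "triple_kernel s z a u
          \<le> (1 - cmod u) powr - s * (kernel_norm z u powr (2 * s - 2) * (4 * h powr - 2))"
          by (intro mult_left_mono) auto
        also have "\<dots> = 4 * h powr - 2 * ?B u" using True h by (simp add: mult_ac)
        finally show ?thesis using A0 by (simp add: add_increasing)
      next
        case False
        then have "kernel_norm z u powr (2 * s - 2) \<le> (h / 2) powr (2 * s - 2)"
          using h s by (intro powr_mono2') auto
        also note h2
        finally have "triple_kernel s z a u
          \<le> (1 - cmod u) powr - s * (4 * h powr (2 * s - 2) * kernel_norm a u powr - 2)"
          by (intro mult_left_mono mult_right_mono) auto
        also have "\<dots> = 4 * h powr (2 * s - 2) * ?A u" by (simp add: mult_ac)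
        finally show ?thesis using B0 by (simp add: add_increasing2)
      qed
      then have "ennreal (triple_kernel s z a u)
        \<le> ennreal (4 * h powr (2 * s - 2) * ?A u + 4 * h powr - 2 * ?B u)" by (rule ennreal_leI)
      also have "\<dots> = ennreal (4 * h powr (2 * s - 2)) * ennreal (?A u) + ennreal (4 * h powr - 2) * ennreal (?B u)"
        by (subst ennreal_plus) (use A0 B0 in \<open>auto simp only: ennreal_mult' mult_nonneg_nonneg powr_ge_zero zero_le_numeral\<close>)
      finally show "ennreal (triple_kernel s z a u)
        \<le> ennreal (4 * h powr (2 * s - 2)) * ennreal (?A u) + ennreal (4 * h powr - 2) * ennreal (?B u)" .
    qed
    also have "\<dots> = ennreal (4 * h powr (2 * s - 2)) * (\<integral>\<^sup>+u. ennreal (?A u) \<partial>disc_area) + ennreal (4 * h powr - 2) * (\<integral>\<^sup>+u. ennreal (?B u) \<partial>disc_area)"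
      by (subst nn_integral_add, measurable, subst nn_integral_cmult, measurable, subst nn_integral_cmult, measurable)
    also have "\<dots> \<le> ennreal (4 * h powr (2 * s - 2)) * ennreal (C1 * \<delta> powr - s) + ennreal (4 * h powr - 2) * ennreal (C2 * h powr s)"
      unfolding \<delta>_def by (intro add_mono mult_left_mono C1(2)[OF a] C2(2)[OF z h]) auto
    also have "\<dots> = ennreal (4 * h powr (2 * s - 2) * (C1 * \<delta> powr - s) + 4 * h powr - 2 * (C2 * h powr s))"
      using C1(1) C2(1) by (subst ennreal_plus) (auto simp only: ennreal_mult' mult_nonneg_nonneg powr_ge_zero zero_le_numeral less_imp_le)
    also have "\<dots> \<le> ennreal ((4 * C1 + 4 * C2) * (h powr (2 * s - 2) * \<delta> powr - s))"
    proof (rule ennreal_leI)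
      \<comment> \<open>The region around \<open>z\<close> yields \<open>h powr (s - 2)\<close>,
        which is absorbed into the target because \<open>\<delta> \<le> h\<close>.\<close>
      have "h powr - 2 * h powr s = h powr (2 * s - 2) * h powr - s" by (simp flip: powr_add)
      also have "\<dots> \<le> h powr (2 * s - 2) * \<delta> powr - s"
        using \<delta> s by (intro mult_left_mono powr_mono2') auto
      finally have "4 * C2 * (h powr - 2 * h powr s) \<le> 4 * C2 * (h powr (2 * s - 2) * \<delta> powr - s)"
        using C2(1) by (intro mult_left_mono) auto
      then show "4 * h powr (2 * s - 2) * (C1 * \<delta> powr - s) + 4 * h powr - 2 * (C2 * h powr s)
        \<le> (4 * C1 + 4 * C2) * (h powr (2 * s - 2) * \<delta> powr - s)"
        by (simp add: algebra_simps)
    qed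
    finally show "(\<integral>\<^sup>+u. ennreal (triple_kernel s z a u) \<partial>disc_area)
      \<le> ennreal ((4 * C1 + 4 * C2) * (kernel_norm a z powr (2 * s - 2) * (1 - cmod a) powr - s))"
      by (simp only: h_def \<delta>_def)
  qed
qed

text \<open>Cauchy--Schwarz with a free positive weight \<open>r\<close>: the Moebius weight
  \<open>r u = Q_weight s u z\<close> serves for the oscillation, and \<open>r = 1\<close> for the
  growth of \<open>f\<close>.\<close>

lemma dirichlet_square_le:
  assumes f: "f holomorphic_on unit_disc"
    and fin: "dirichlet_energy f < \<infinity>"
    and z: "z \<in> unit_disc" and a: "a \<in> unit_disc"
    and r[measurable]: "r \<in> borel_measurable borel" and r0: "\<And>u. u \<in> unit_disc \<Longrightarrow> 0 < r u"
  shows "ennreal ((cmod (f z - f a))\<^sup>2) \<le> (\<integral>\<^sup>+u. ennreal ((cmod (deriv f u))\<^sup>2 * r u) \<partial>disc_area)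
    * (\<integral>\<^sup>+u. ennreal ((cmod (z - a) / (kernel_norm u z * kernel_norm u a))\<^sup>2 / r u) \<partial>disc_area)"
proof -
  define F where "F u = indicator unit_disc u *\<^sub>R deriv f u" for u
  have [measurable]: "F \<in> borel_measurable borel"
    unfolding F_def by (intro borel_measurable_indicator_holomorphic holomorphic_deriv f open_ball)
  define k where "k u = cmod (z - a) / (kernel_norm u z * kernel_norm u a)" for u
  have [measurable]: "k \<in> borel_measurable borel" unfolding k_def by measurable
  have "ennreal (cmod (f z - f a)) \<le> (\<integral>\<^sup>+u. ennreal (cmod (deriv f u) * k u) \<partial>disc_area)"
    unfolding k_def by (rule dirichlet_difference[OF f fin z a])
  also have "\<dots> = (\<integral>\<^sup>+u. ennreal (cmod (F u) * sqrt (r u)) * ennreal (k u / sqrt (r u)) \<partial>disc_area)"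
  proof (rule nn_integral_cong_AE, use AE_disc_area in eventually_elim)
    fix u assume u: "u \<in> unit_disc"
    have "cmod (deriv f u) * k u = (cmod (F u) * sqrt (r u)) * (k u / sqrt (r u))"
      using u r0[OF u] by (simp add: F_def)
    then show "ennreal (cmod (deriv f u) * k u) = ennreal (cmod (F u) * sqrt (r u)) * ennreal (k u / sqrt (r u))"
      using r0[OF u] by (subst ennreal_mult[symmetric]) (auto simp: k_def)
  qed
  finally have "ennreal (cmod (f z - f a)) ^ 2 \<le> (\<integral>\<^sup>+u. ennreal (cmod (F u) * sqrt (r u)) * ennreal (k u / sqrt (r u)) \<partial>disc_area) ^ 2"
    by (rule power_mono) simp
  also have "\<dots> \<le> (\<integral>\<^sup>+u. ennreal (cmod (F u) * sqrt (r u)) ^ 2 \<partial>disc_area) * (\<integral>\<^sup>+u. ennreal (k u / sqrt (r u)) ^ 2 \<partial>disc_area)"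
    by (rule Cauchy_Schwarz_nn_integral) measurable
  also have "(\<integral>\<^sup>+u. ennreal (cmod (F u) * sqrt (r u)) ^ 2 \<partial>disc_area) = (\<integral>\<^sup>+u. ennreal ((cmod (deriv f u))\<^sup>2 * r u) \<partial>disc_area)"
  proof (rule nn_integral_cong_AE, use AE_disc_area in eventually_elim)
    fix u assume u: "u \<in> unit_disc"
    show "ennreal (cmod (F u) * sqrt (r u)) ^ 2 = ennreal ((cmod (deriv f u))\<^sup>2 * r u)"
      using u r0[OF u] by (subst ennreal_power) (simp_all add: F_def power_mult_distrib)
  qed
  also have "(\<integral>\<^sup>+u. ennreal (k u / sqrt (r u)) ^ 2 \<partial>disc_area) = (\<integral>\<^sup>+u. ennreal ((k u)\<^sup>2 / r u) \<partial>disc_area)"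
  proof (rule nn_integral_cong_AE, use AE_disc_area in eventually_elim)
    fix u assume u: "u \<in> unit_disc"
    show "ennreal (k u / sqrt (r u)) ^ 2 = ennreal ((k u)\<^sup>2 / r u)"
      using u r0[OF u] by (subst ennreal_power) (simp_all add: k_def power_divide power_mult_distrib)
  qed
  finally show ?thesis by (simp add: k_def ennreal_power)
qed

text \<open>Integrated against a measure \<open>\<mu>\<close>, this says that bounds on \<open>\<integral> Q_weight s b d\<mu>\<close>, uniform
  in \<open>b\<close>, make \<open>\<mu>\<close> a Carleson measure for the Dirichlet space.\<close>

lemma dirichlet_difference_weighted:
  assumes s: "0 < s" "s < 1"
  obtains C where "0 < C" "\<And>f a z. f holomorphic_on unit_disc \<Longrightarrow>
    dirichlet_energy f < \<infinity> \<Longrightarrow> z \<in> unit_disc \<Longrightarrow> a \<in> unit_disc \<Longrightarrow>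
    ennreal ((cmod (f z - f a))\<^sup>2 * Q_weight s a z)
      \<le> ennreal C * (\<integral>\<^sup>+u. ennreal ((cmod (deriv f u))\<^sup>2 * Q_weight s u z) \<partial>disc_area)"
proof -
  obtain C where C: "0 < C" "\<And>a z. a \<in> unit_disc \<Longrightarrow> z \<in> unit_disc \<Longrightarrow>
    (\<integral>\<^sup>+u. ennreal (triple_kernel s z a u) \<partial>disc_area)
    \<le> ennreal (C * (kernel_norm a z powr (2 * s - 2) * (1 - cmod a) powr - s))"
    using kernel_integral_triple[OF s] by blast
  show ?thesis
  proof (rule that[of "2 * C"])
    show "0 < 2 * C" using C by simp
    fix f a z
    assume f: "f holomorphic_on unit_disc"
      and fin: "dirichlet_energy f < \<infinity>"
      and z: "z \<in> unit_disc" and a: "a \<in> unit_disc"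
    define h \<delta> where "h = kernel_norm a z" and "\<delta> = 1 - cmod a"
    have h: "0 < h" unfolding h_def by (rule unit_disc_kernel(4)[OF a z])
    have \<delta>: "0 < \<delta>" using a by (auto simp: \<delta>_def)
    define K where "K u = cmod (z - a) / (kernel_norm u z * kernel_norm u a)" for u
    \<comment> \<open>The factors independent of \<open>u\<close>. Up to a constant,
      \<open>V\<close> is the reciprocal of the bound for the integral of
      \<open>triple_kernel\<close>, so both \<open>\<delta>\<close> and \<open>h\<close> cancel at
      the end and only \<open>C * 2 powr s\<close> remains.\<close>
    define V where "V = (2 * \<delta>) powr s * h powr (2 - 2 * s)"
    define D where "D = (\<integral>\<^sup>+u. ennreal ((cmod (deriv f u))\<^sup>2 * Q_weight s u z) \<partial>disc_area)"
    have Km[measurable]: "(\<lambda>u. (K u)\<^sup>2 / Q_weight s u z) \<in> borel_measurable borel"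
      unfolding K_def by measurable
    have "ennreal ((cmod (f z - f a))\<^sup>2) \<le> D * (\<integral>\<^sup>+u. ennreal ((K u)\<^sup>2 / Q_weight s u z) \<partial>disc_area)"
      unfolding K_def D_def by (rule dirichlet_square_le[OF f fin z a]) (use Q_weight_pos z in auto)
    then have "ennreal ((cmod (f z - f a))\<^sup>2) * ennreal (Q_weight s a z)
      \<le> D * (\<integral>\<^sup>+u. ennreal ((K u)\<^sup>2 / Q_weight s u z) \<partial>disc_area) * ennreal (Q_weight s a z)"
      by (rule mult_right_mono) simp
    also have "\<dots> = D * (\<integral>\<^sup>+u. ennreal ((K u)\<^sup>2 / Q_weight s u z) * ennreal (Q_weight s a z) \<partial>disc_area)"
      by (subst nn_integral_multc) (auto simp: mult.assoc)
    finally have le: "ennreal ((cmod (f z - f a))\<^sup>2) * ennreal (Q_weight s a z)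
      \<le> D * (\<integral>\<^sup>+u. ennreal ((K u)\<^sup>2 / Q_weight s u z) * ennreal (Q_weight s a z) \<partial>disc_area)" .
    have "(\<integral>\<^sup>+u. ennreal ((K u)\<^sup>2 / Q_weight s u z) * ennreal (Q_weight s a z) \<partial>disc_area)
      \<le> (\<integral>\<^sup>+u. ennreal V * ennreal (triple_kernel s z a u) \<partial>disc_area)"
    proof (rule nn_integral_mono_AE, use AE_disc_area in eventually_elim)
      fix u assume u: "u \<in> unit_disc"
      define x y where "x = kernel_norm z u" and "y = kernel_norm a u"
      have x: "0 < x" "kernel_norm u z = x" and y: "0 < y" "kernel_norm u a = y"
        using unit_disc_kernel(4) u z a kernel_swap[of u] by (auto simp: x_def y_def)
      have u1: "0 < 1 - (cmod u)\<^sup>2" and z1: "0 < 1 - (cmod z)\<^sup>2" and a1: "0 < 1 - (cmod a)\<^sup>2"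
        using u z a by (auto simp: power_less_one_iff)
      \<comment> \<open>Here the numerator \<open>z - a\<close> of the kernel is used: it is at most
        \<open>h\<close>, which supplies the two powers of \<open>h\<close> that \<open>V\<close>
        needs.\<close>
      have K2: "(K u)\<^sup>2 \<le> h\<^sup>2 * (x powr - 2 * y powr - 2)"
      proof -
        have "(K u)\<^sup>2 = (cmod (z - a))\<^sup>2 * (x powr - 2 * y powr - 2)"
          using x y by (simp add: K_def power_divide power_mult_distrib powr_minus divide_inverse power_inverse)
        also have "\<dots> \<le> h\<^sup>2 * (x powr - 2 * y powr - 2)"
          using phi_bounds(3)[OF a z] unfolding h_def
          by (intro mult_right_mono power_mono) (auto simp: norm_minus_commute)
        finally show ?thesis .
      qed
      \<comment> \<open>Both weights contain the same power of \<open>1 - (cmod z)\<^sup>2\<close>,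
        so the distance of \<open>z\<close> from the circle disappears from the quotient.\<close>
      have "(K u)\<^sup>2 / Q_weight s u z * Q_weight s a z
          = (K u)\<^sup>2 * ((1 - (cmod a)\<^sup>2) powr s * h powr (- 2 * s) * x powr (2 * s) * (1 - (cmod u)\<^sup>2) powr - s)"
      proof -
        have aux: "k / (U * Z * P) * (A * Z * R) = k * (A * R * (1 / P) * (1 / U))" if "Z \<noteq> 0" for k U Z P A R :: real
          using that by simp
        have pw: "x powr (2 * s) = 1 / x powr (- 2 * s)" "(1 - (cmod u)\<^sup>2) powr - s = 1 / (1 - (cmod u)\<^sup>2) powr s"
          by (simp_all add: powr_minus_divide)
        have "(1 - (cmod z)\<^sup>2) powr s \<noteq> 0" using z1 by simp
        then show ?thesis
          unfolding Q_weight_eq[OF u z] Q_weight_eq[OF a z] x(2) h_def[symmetric] pw by (rule aux)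
      qed
      also have "\<dots> \<le> (h\<^sup>2 * (x powr - 2 * y powr - 2)) * ((2 * \<delta>) powr s * h powr (- 2 * s) * x powr (2 * s) * (1 - cmod u) powr - s)"
      proof (intro mult_mono K2)
        show "(1 - (cmod a)\<^sup>2) powr s \<le> (2 * \<delta>) powr s"
          using one_minus_square_bounds(2)[OF a] a1 s by (intro powr_mono2) (auto simp: \<delta>_def)
        show "(1 - (cmod u)\<^sup>2) powr - s \<le> (1 - cmod u) powr - s"
          using one_minus_square_bounds(1)[OF u] u s by (intro powr_mono2') auto
      qed auto
      also have "\<dots> = V * ((1 - cmod u) powr - s * (x powr (2 * s - 2) * y powr - 2))"
      proof -
        have "x powr (2 * s - 2) = x powr - 2 * x powr (2 * s)" by (simp flip: powr_add)
        moreover have "h powr (2 - 2 * s) = h powr 2 * h powr (- 2 * s)" by (simp flip: powr_add)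
        then have "h powr (2 - 2 * s) = h\<^sup>2 * h powr (- 2 * s)" using h by simp
        ultimately show ?thesis by (simp only: V_def mult_ac)
      qed
      finally have le: "ennreal ((K u)\<^sup>2 / Q_weight s u z * Q_weight s a z) \<le> ennreal (V * ((1 - cmod u) powr - s * (x powr (2 * s - 2) * y powr - 2)))"
        by (rule ennreal_leI)
      have e1: "ennreal ((K u)\<^sup>2 / Q_weight s u z * Q_weight s a z) = ennreal ((K u)\<^sup>2 / Q_weight s u z) * ennreal (Q_weight s a z)"
        by (rule ennreal_mult) auto
      have e2: "ennreal (V * ((1 - cmod u) powr - s * (x powr (2 * s - 2) * y powr - 2))) = ennreal V * ennreal ((1 - cmod u) powr - s * (x powr (2 * s - 2) * y powr - 2))"
        by (rule ennreal_mult) (auto simp: V_def)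
      show "ennreal ((K u)\<^sup>2 / Q_weight s u z) * ennreal (Q_weight s a z)
        \<le> ennreal V * ennreal (triple_kernel s z a u)"
        using le unfolding e1 e2 unfolding x_def y_def .
    qed
    also have "\<dots> = ennreal V * (\<integral>\<^sup>+u. ennreal (triple_kernel s z a u) \<partial>disc_area)"
      by (rule nn_integral_cmult) measurable
    also have "\<dots> \<le> ennreal V * ennreal (C * (h powr (2 * s - 2) * \<delta> powr - s))"
      unfolding h_def \<delta>_def by (intro mult_left_mono C(2) a z) simp
    also have "\<dots> = ennreal (V * (C * (h powr (2 * s - 2) * \<delta> powr - s)))"
      by (rule ennreal_mult[symmetric]) (use C(1) in \<open>auto simp: V_def\<close>)
    also have "\<dots> \<le> ennreal (2 * C)"
    proof (rule ennreal_leI)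
      have "V * (C * (h powr (2 * s - 2) * \<delta> powr - s)) = C * 2 powr s * (\<delta> powr s * \<delta> powr - s) * (h powr (2 - 2 * s) * h powr (2 * s - 2))"
        unfolding V_def powr_mult by (simp only: mult_ac)
      also have "\<delta> powr s * \<delta> powr - s = 1" using \<delta> by (simp flip: powr_add)
      also have "h powr (2 - 2 * s) * h powr (2 * s - 2) = 1" using h by (simp flip: powr_add)
      also have "C * 2 powr s * 1 * 1 \<le> C * 2 powr 1 * 1 * 1"
        using C(1) s by (intro mult_right_mono mult_left_mono powr_mono) auto
      finally show "V * (C * (h powr (2 * s - 2) * \<delta> powr - s)) \<le> 2 * C" by (simp add: mult.commute)
    qed
    finally have "D * (\<integral>\<^sup>+u. ennreal ((K u)\<^sup>2 / Q_weight s u z) * ennreal (Q_weight s a z) \<partial>disc_area) \<le> D * ennreal (2 * C)"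
      by (rule mult_left_mono) simp
    with le have "ennreal ((cmod (f z - f a))\<^sup>2) * ennreal (Q_weight s a z) \<le> D * ennreal (2 * C)"
      by (rule order_trans)
    then show "ennreal ((cmod (f z - f a))\<^sup>2 * Q_weight s a z)
      \<le> ennreal (2 * C) * (\<integral>\<^sup>+u. ennreal ((cmod (deriv f u))\<^sup>2 * Q_weight s u z) \<partial>disc_area)"
      by (simp add: D_def ennreal_mult mult.commute)
  qed
qed

section \<open>The spaces in terms of the Moebius weight\<close>

lemma Q_mass_indicator:
  "Q_mass s (\<lambda>z. indicator unit_disc z *\<^sub>R h z) a = Q_mass s h a"
  unfolding Q_mass_def
  by (rule nn_integral_cong_AE, use AE_disc_area in eventually_elim) simp

lemma Q_mass_mono:
  assumes "\<And>z. z \<in> unit_disc \<Longrightarrow> cmod (h z) \<le> cmod (k z)"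
  shows "Q_mass s h a \<le> Q_mass s k a"
  unfolding Q_mass_def
  by (rule nn_integral_mono_AE, use AE_disc_area in eventually_elim)
    (auto intro!: ennreal_leI mult_right_mono power_mono assms)

text \<open>The two comparisons between the weights have constants independent of \<open>a\<close>,
  so they pass to the suprema. Every later use of \<open>Q_space\<close> goes through this
  form.\<close>

lemma Q_space_iff:
  assumes s: "0 < s" "s < 1"
  shows "f \<in> Q_space s \<longleftrightarrow> f holomorphic_on unit_disc \<and> (SUP a\<in>unit_disc. Q_mass s (deriv f) a) < \<infinity>"
proof (cases "f holomorphic_on unit_disc")
  case True
  let ?G = "\<lambda>a. \<integral>\<^sup>+z. ennreal ((cmod (deriv f z))\<^sup>2 * green z a powr s) \<partial>disc_area"
  have df: "deriv f holomorphic_on unit_disc" by (rule holomorphic_deriv[OF True open_ball])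
  have m[measurable]: "(\<lambda>z. indicator unit_disc z *\<^sub>R deriv f z) \<in> borel_measurable borel"
    by (rule borel_measurable_indicator_holomorphic[OF df])
  have le1: "?G a \<le> ennreal 2000000 * Q_mass s (deriv f) a" if "a \<in> unit_disc" for a
    unfolding Q_mass_def Q_weight_def by (rule green_integral_le[OF s df that])
  have le2: "Q_mass s (deriv f) a \<le> ennreal 2 * ?G a" if a: "a \<in> unit_disc" for a
  proof -
    have gm[measurable]: "(\<lambda>z. green z a) \<in> borel_measurable borel"
      unfolding green_def by measurable
    have "Q_mass s (deriv f) a \<le> (\<integral>\<^sup>+z. ennreal 2 * ennreal ((cmod (indicator unit_disc z *\<^sub>R deriv f z))\<^sup>2 * green z a powr s) \<partial>disc_area)"
      unfolding Q_mass_def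
    proof (rule nn_integral_mono_AE, use AE_disc_area AE_disc_area_neq[of a] in eventually_elim)
      fix z assume z: "z \<in> unit_disc" "z \<noteq> a"
      have "(cmod (deriv f z))\<^sup>2 * Q_weight s a z \<le> (cmod (deriv f z))\<^sup>2 * (2 * green z a powr s)"
        unfolding Q_weight_def by (intro mult_left_mono powr_one_minus_phi_le_green a z s) auto
      then have "ennreal ((cmod (deriv f z))\<^sup>2 * Q_weight s a z) \<le> ennreal (2 * ((cmod (deriv f z))\<^sup>2 * green z a powr s))"
        by (intro ennreal_leI) (simp add: mult_ac)
      also have "\<dots> = ennreal 2 * ennreal ((cmod (deriv f z))\<^sup>2 * green z a powr s)"
        by (rule ennreal_mult) auto
      finally show "ennreal ((cmod (deriv f z))\<^sup>2 * Q_weight s a z) \<le> ennreal 2 * ennreal ((cmod (indicator unit_disc z *\<^sub>R deriv f z))\<^sup>2 * green z a powr s)"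
        using z(1) by simp
    qed
    also have "\<dots> = ennreal 2 * (\<integral>\<^sup>+z. ennreal ((cmod (indicator unit_disc z *\<^sub>R deriv f z))\<^sup>2 * green z a powr s) \<partial>disc_area)"
      by (rule nn_integral_cmult) measurable
    also have "(\<integral>\<^sup>+z. ennreal ((cmod (indicator unit_disc z *\<^sub>R deriv f z))\<^sup>2 * green z a powr s) \<partial>disc_area) = ?G a"
      by (rule nn_integral_cong_AE, use AE_disc_area in eventually_elim) simp
    finally show ?thesis .
  qed
  have "(SUP a\<in>unit_disc. ?G a) \<le> ennreal 2000000 * (SUP a\<in>unit_disc. Q_mass s (deriv f) a)"
    by (intro SUP_least order_trans[OF le1] mult_left_mono SUP_upper) auto
  moreover have "(SUP a\<in>unit_disc. Q_mass s (deriv f) a) \<le> ennreal 2 * (SUP a\<in>unit_disc. ?G a)"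
    by (intro SUP_least order_trans[OF le2] mult_left_mono SUP_upper) auto
  ultimately have "(SUP a\<in>unit_disc. ?G a) < \<infinity> \<longleftrightarrow> (SUP a\<in>unit_disc. Q_mass s (deriv f) a) < \<infinity>"
    by (auto elim!: le_less_trans simp: ennreal_mult_less_top)
  then show ?thesis using True by (simp add: Q_space_def)
qed (simp add: Q_space_def)

lemma SUP_finiteE:
  assumes "(SUP a\<in>A. F a) < (\<infinity> :: ennreal)"
  obtains M where "0 \<le> M" "\<And>a. a \<in> A \<Longrightarrow> F a \<le> ennreal M"
proof -
  obtain M where "0 \<le> M" "(SUP a\<in>A. F a) = ennreal M" using assms by (rule ennreal_finiteE)
  then show ?thesis using that[of M] by (metis SUP_upper)
qed

text \<open>Cauchy--Schwarz with the constant weight and base point \<open>0\<close>, where the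
  second kernel is \<open>1\<close>. The remaining integral of the inverse square of the kernel is
  the logarithmic one at the exponent \<open>2\<close>.\<close>

lemma dirichlet_growth:
  obtains C where "0 < C" "\<And>f a D. f holomorphic_on unit_disc \<Longrightarrow> 0 \<le> D \<Longrightarrow>
    dirichlet_energy f = ennreal D \<Longrightarrow> a \<in> unit_disc \<Longrightarrow>
    (cmod (f a - f 0))\<^sup>2 \<le> C * D * log_weight a"
proof -
  obtain C where C: "0 < C" "\<And>a. a \<in> unit_disc \<Longrightarrow>
    (\<integral>\<^sup>+u. ennreal ((1 - cmod u) powr (2 - 2) * kernel_norm a u powr - 2) \<partial>disc_area) \<le> ennreal (C * log_weight a)"
    using kernel_integral_log[of 2] by auto
  show ?thesis
  proof (rule that[OF C(1)])
    fix f a D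
    assume f: "f holomorphic_on unit_disc" and D: "0 \<le> D"
      and fin: "dirichlet_energy f = ennreal D" and a: "a \<in> unit_disc"
    have "ennreal ((cmod (f a - f 0))\<^sup>2) \<le> (\<integral>\<^sup>+u. ennreal ((cmod (deriv f u))\<^sup>2 * 1) \<partial>disc_area)
      * (\<integral>\<^sup>+u. ennreal ((cmod (a - 0) / (kernel_norm u a * kernel_norm u 0))\<^sup>2 / 1) \<partial>disc_area)"
      by (rule dirichlet_square_le[OF f _ a]) (auto simp: fin)
    also have "\<dots> \<le> ennreal D * (\<integral>\<^sup>+u. ennreal ((1 - cmod u) powr (2 - 2) * kernel_norm a u powr - 2) \<partial>disc_area)"
    proof (intro mult_mono nn_integral_mono_AE)
      show "AE u in disc_area. ennreal ((cmod (a - 0) / (kernel_norm u a * kernel_norm u 0))\<^sup>2 / 1)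
         \<le> ennreal ((1 - cmod u) powr (2 - 2) * kernel_norm a u powr - 2)"
        using AE_disc_area
      proof eventually_elim
        fix u assume u: "u \<in> unit_disc"
        have k: "0 < kernel_norm a u" by (rule unit_disc_kernel(4)[OF a u])
        have "(cmod (a - 0) / (kernel_norm u a * kernel_norm u 0))\<^sup>2 / 1 \<le> (1 / kernel_norm a u)\<^sup>2"
          unfolding kernel_swap[of u a] using a k by (auto intro!: power_mono divide_right_mono)
        also have "\<dots> = (1 - cmod u) powr (2 - 2) * kernel_norm a u powr - 2"
          using u k by (simp add: power_divide powr_minus divide_inverse power_inverse)
        finally show "ennreal ((cmod (a - 0) / (kernel_norm u a * kernel_norm u 0))\<^sup>2 / 1)
         \<le> ennreal ((1 - cmod u) powr (2 - 2) * kernel_norm a u powr - 2)" by (rule ennreal_leI)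
      qed
    qed (simp_all add: fin)
    also have "\<dots> \<le> ennreal D * ennreal (C * log_weight a)"
      by (intro mult_left_mono C(2) a) simp
    also have "\<dots> = ennreal (C * D * log_weight a)"
      using C(1) D log_weight_pos[OF a] by (subst ennreal_mult[symmetric]) (auto simp: mult_ac)
    finally show "(cmod (f a - f 0))\<^sup>2 \<le> C * D * log_weight a"
      using C(1) D log_weight_pos[OF a] by (subst (asm) ennreal_le_iff) auto
  qed
qed

section \<open>Sufficiency of the logarithmic condition\<close>

lemma Q_log_spaceE:
  assumes "g \<in> Q_log_space s \<alpha>"
  obtains M where "0 \<le> M" "\<And>a. a \<in> unit_disc \<Longrightarrow> ennreal (log_weight a powr (2 * \<alpha>)) * Q_mass s (deriv g) a \<le> ennreal M"
proof -
  have "(SUP a\<in>unit_disc. ennreal (log_weight a powr (2 * \<alpha>)) * Q_mass s (deriv g) a) < \<infinity>"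
    using assms by (simp add: Q_log_space_def Q_mass_def Q_weight_def log_weight_def)
  then show ?thesis using that by (rule SUP_finiteE) auto
qed

text \<open>As \<open>log_weight\<close> is bounded below by \<open>ln 2\<close>, lowering its
  exponent costs only a constant. The exponents \<open>0\<close> and \<open>1\<close> are the ones
  needed later.\<close>

lemma Q_log_mass_le:
  assumes M: "0 \<le> M" "ennreal (log_weight a powr (2 * \<alpha>)) * Q \<le> ennreal M"
    and a: "a \<in> unit_disc" and \<beta>: "\<beta> \<le> 2 * \<alpha>"
  shows "ennreal (log_weight a powr \<beta>) * Q \<le> ennreal (ln 2 powr (\<beta> - 2 * \<alpha>) * M)"
proof -
  have "log_weight a powr \<beta> = log_weight a powr (\<beta> - 2 * \<alpha>) * log_weight a powr (2 * \<alpha>)"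
    by (simp flip: powr_add)
  then have "ennreal (log_weight a powr \<beta>) * Q = ennreal (log_weight a powr (\<beta> - 2 * \<alpha>)) * (ennreal (log_weight a powr (2 * \<alpha>)) * Q)"
    by (simp add: ennreal_mult mult.assoc)
  also have "\<dots> \<le> ennreal (ln 2 powr (\<beta> - 2 * \<alpha>)) * ennreal M"
    by (intro mult_mono M(2) ennreal_leI powr_mono2') (use \<beta> log_weight_ge[OF a] in auto)
  also have "\<dots> = ennreal (ln 2 powr (\<beta> - 2 * \<alpha>) * M)"
    by (rule ennreal_mult[symmetric]) (use M in auto)
  finally show ?thesis .
qed

lemma T_op_Q_mass:
  assumes g: "g holomorphic_on unit_disc" and f: "f holomorphic_on unit_disc"
  shows "Q_mass s (deriv (T_op g f)) a = Q_mass s (\<lambda>z. deriv g z * f z) a"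
  unfolding Q_mass_def
  by (rule nn_integral_cong_AE, use AE_disc_area in eventually_elim) (simp add: T_op_deriv(2)[OF g f])

text \<open>After Fubini the inner integral over \<open>z\<close> is the mass of \<open>h\<close> at
  the point \<open>u\<close>, bounded by \<open>M\<close> uniformly in \<open>u\<close>; what is
  left over is the Dirichlet energy of \<open>f\<close>.\<close>

lemma dirichlet_multiplier_difference:
  assumes s: "0 < s" "s < 1"
  obtains C where "0 < C" "\<And>f h a M D. f holomorphic_on unit_disc \<Longrightarrow> h holomorphic_on unit_disc \<Longrightarrow>
    0 \<le> D \<Longrightarrow> dirichlet_energy f = ennreal D \<Longrightarrow>
    0 \<le> M \<Longrightarrow> (\<And>b. b \<in> unit_disc \<Longrightarrow> Q_mass s h b \<le> ennreal M) \<Longrightarrow> a \<in> unit_disc \<Longrightarrow>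
    Q_mass s (\<lambda>z. h z * (f z - f a)) a \<le> ennreal (C * D * M)"
proof -
  obtain C where C: "0 < C" "\<And>f a z. f holomorphic_on unit_disc \<Longrightarrow>
    dirichlet_energy f < \<infinity> \<Longrightarrow> z \<in> unit_disc \<Longrightarrow> a \<in> unit_disc \<Longrightarrow>
    ennreal ((cmod (f z - f a))\<^sup>2 * Q_weight s a z)
      \<le> ennreal C * (\<integral>\<^sup>+u. ennreal ((cmod (deriv f u))\<^sup>2 * Q_weight s u z) \<partial>disc_area)"
    using dirichlet_difference_weighted[OF s] by blast
  show ?thesis
  proof (rule that[OF C(1)])
    fix f h a M D
    assume f: "f holomorphic_on unit_disc" and h: "h holomorphic_on unit_disc" and D: "0 \<le> D"
      and fD: "dirichlet_energy f = ennreal D"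
      and M: "0 \<le> M" and hM: "\<And>b. b \<in> unit_disc \<Longrightarrow> Q_mass s h b \<le> ennreal M" and a: "a \<in> unit_disc"
    define F where "F u = indicator unit_disc u *\<^sub>R deriv f u" for u
    define H where "H z = indicator unit_disc z *\<^sub>R h z" for z
    have [measurable]: "F \<in> borel_measurable borel" "H \<in> borel_measurable borel"
      unfolding F_def H_def
      by (intro borel_measurable_indicator_holomorphic holomorphic_deriv f h open_ball)+
    have FD: "(\<integral>\<^sup>+z. ennreal ((cmod (F z))\<^sup>2) \<partial>disc_area) = ennreal D"
      unfolding fD[symmetric] F_def
      by (rule nn_integral_cong_AE, use AE_disc_area in eventually_elim) simp
    have Fu: "(\<integral>\<^sup>+u. ennreal ((cmod (deriv f u))\<^sup>2 * Q_weight s u z) \<partial>disc_area) = (\<integral>\<^sup>+u. ennreal ((cmod (F u))\<^sup>2 * Q_weight s u z) \<partial>disc_area)" for z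
      unfolding F_def by (rule nn_integral_cong_AE, use AE_disc_area in eventually_elim) simp
    interpret DD: pair_sigma_finite disc_area disc_area ..
    have "Q_mass s (\<lambda>z. h z * (f z - f a)) a
      \<le> (\<integral>\<^sup>+z. ennreal C * (\<integral>\<^sup>+u. ennreal ((cmod (H z))\<^sup>2) * ennreal ((cmod (F u))\<^sup>2 * Q_weight s u z) \<partial>disc_area) \<partial>disc_area)"
      unfolding Q_mass_def
    proof (rule nn_integral_mono_AE, use AE_disc_area in eventually_elim)
      fix z assume z: "z \<in> unit_disc"
      have "ennreal ((cmod (h z * (f z - f a)))\<^sup>2 * Q_weight s a z) = ennreal ((cmod (H z))\<^sup>2) * ennreal ((cmod (f z - f a))\<^sup>2 * Q_weight s a z)"
        using z by (subst ennreal_mult[symmetric]) (auto simp: H_def norm_mult power_mult_distrib mult.assoc)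
      also have "\<dots> \<le> ennreal ((cmod (H z))\<^sup>2) * (ennreal C * (\<integral>\<^sup>+u. ennreal ((cmod (F u))\<^sup>2 * Q_weight s u z) \<partial>disc_area))"
        using C(2)[OF f _ z a] fD by (intro mult_left_mono) (auto simp: Fu)
      also have "\<dots> = ennreal C * (\<integral>\<^sup>+u. ennreal ((cmod (H z))\<^sup>2) * ennreal ((cmod (F u))\<^sup>2 * Q_weight s u z) \<partial>disc_area)"
        by (subst nn_integral_cmult, measurable) (simp add: mult.left_commute)
      finally show "ennreal ((cmod (h z * (f z - f a)))\<^sup>2 * Q_weight s a z) \<le> \<dots>" .
    qed
    also have "\<dots> = ennreal C * (\<integral>\<^sup>+z. (\<integral>\<^sup>+u. ennreal ((cmod (H z))\<^sup>2) * ennreal ((cmod (F u))\<^sup>2 * Q_weight s u z) \<partial>disc_area) \<partial>disc_area)"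
      by (rule nn_integral_cmult) measurable
    also have "(\<integral>\<^sup>+z. (\<integral>\<^sup>+u. ennreal ((cmod (H z))\<^sup>2) * ennreal ((cmod (F u))\<^sup>2 * Q_weight s u z) \<partial>disc_area) \<partial>disc_area)
       = (\<integral>\<^sup>+u. (\<integral>\<^sup>+z. ennreal ((cmod (H z))\<^sup>2) * ennreal ((cmod (F u))\<^sup>2 * Q_weight s u z) \<partial>disc_area) \<partial>disc_area)"
      by (rule DD.Fubini') measurable
    also have "\<dots> = (\<integral>\<^sup>+u. ennreal ((cmod (F u))\<^sup>2) * Q_mass s H u \<partial>disc_area)"
    proof (rule nn_integral_cong)
      fix u
      have "ennreal ((cmod (H z))\<^sup>2) * ennreal ((cmod (F u))\<^sup>2 * Q_weight s u z) = ennreal ((cmod (F u))\<^sup>2) * ennreal ((cmod (H z))\<^sup>2 * Q_weight s u z)" for z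
        by (simp add: ennreal_mult mult_ac)
      then show "(\<integral>\<^sup>+z. ennreal ((cmod (H z))\<^sup>2) * ennreal ((cmod (F u))\<^sup>2 * Q_weight s u z) \<partial>disc_area) = ennreal ((cmod (F u))\<^sup>2) * Q_mass s H u"
        unfolding Q_mass_def by (simp only:) (rule nn_integral_cmult, measurable)
    qed
    also have "\<dots> \<le> (\<integral>\<^sup>+u. ennreal ((cmod (F u))\<^sup>2) * ennreal M \<partial>disc_area)"
    proof (rule nn_integral_mono_AE, use AE_disc_area in eventually_elim)
      fix u assume u: "u \<in> unit_disc"
      have "Q_mass s H u \<le> ennreal M" unfolding H_def Q_mass_indicator by (rule hM[OF u])
      then show "ennreal ((cmod (F u))\<^sup>2) * Q_mass s H u \<le> ennreal ((cmod (F u))\<^sup>2) * ennreal M"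
        by (intro mult_left_mono) auto
    qed
    also have "\<dots> = ennreal D * ennreal M"
      by (subst nn_integral_multc, measurable) (simp add: FD)
    finally have "Q_mass s (\<lambda>z. h z * (f z - f a)) a \<le> ennreal C * (ennreal D * ennreal M)"
      by (auto simp: mult_left_mono)
    also have "\<dots> = ennreal (C * D * M)"
      using C(1) D M by (simp add: ennreal_mult mult.assoc)
    finally show "Q_mass s (\<lambda>z. h z * (f z - f a)) a \<le> ennreal (C * D * M)" .
  qed
qed

lemma Q_mass_add_le:
  assumes h: "h holomorphic_on unit_disc" and f: "f holomorphic_on unit_disc"
  shows "Q_mass s (\<lambda>z. h z * f z) a \<le> ennreal 2 * Q_mass s (\<lambda>z. h z * (f z - c)) a + ennreal (2 * (cmod c)\<^sup>2) * Q_mass s h a"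
proof -
  let ?I = "indicator unit_disc :: complex \<Rightarrow> real"
  have [measurable]: "(\<lambda>z. ?I z *\<^sub>R (h z * (f z - c))) \<in> borel_measurable borel" "(\<lambda>z. ?I z *\<^sub>R h z) \<in> borel_measurable borel"
    by (intro borel_measurable_indicator_holomorphic holomorphic_intros h f)+
  have "Q_mass s (\<lambda>z. h z * f z) a \<le> (\<integral>\<^sup>+z. ennreal 2 * ennreal ((cmod (?I z *\<^sub>R (h z * (f z - c))))\<^sup>2 * Q_weight s a z)
      + ennreal (2 * (cmod c)\<^sup>2) * ennreal ((cmod (?I z *\<^sub>R h z))\<^sup>2 * Q_weight s a z) \<partial>disc_area)"
    unfolding Q_mass_def
  proof (rule nn_integral_mono_AE, use AE_disc_area in eventually_elim)
    fix z assume z: "z \<in> unit_disc"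
    define x y W where "x = cmod (f z - c)" and "y = cmod c" and "W = (cmod (h z))\<^sup>2 * Q_weight s a z"
    have W: "0 \<le> W" by (simp add: W_def)
    have "cmod (f z) \<le> x + y" unfolding x_def y_def using norm_triangle_ineq[of "f z - c" c] by simp
    then have "(cmod (f z))\<^sup>2 \<le> (x + y)\<^sup>2" by (rule power_mono) simp
    also have "\<dots> \<le> 2 * x\<^sup>2 + 2 * y\<^sup>2"
      using zero_le_power2[of "x - y"] by (simp add: power2_sum power2_diff)
    finally have "(cmod (f z))\<^sup>2 * W \<le> (2 * x\<^sup>2 + 2 * y\<^sup>2) * W" using W by (rule mult_right_mono)
    then have "ennreal ((cmod (f z))\<^sup>2 * W) \<le> ennreal (2 * (x\<^sup>2 * W) + 2 * y\<^sup>2 * W)"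
      by (intro ennreal_leI) (simp add: algebra_simps)
    also have "\<dots> = ennreal 2 * ennreal (x\<^sup>2 * W) + ennreal (2 * y\<^sup>2) * ennreal W"
      using W by (subst ennreal_plus) (auto simp only: ennreal_mult' mult_nonneg_nonneg zero_le_power2 zero_le_numeral)
    finally show "ennreal ((cmod (h z * f z))\<^sup>2 * Q_weight s a z) \<le> ennreal 2 * ennreal ((cmod (?I z *\<^sub>R (h z * (f z - c))))\<^sup>2 * Q_weight s a z)
      + ennreal (2 * (cmod c)\<^sup>2) * ennreal ((cmod (?I z *\<^sub>R h z))\<^sup>2 * Q_weight s a z)"
      using z by (simp add: x_def y_def W_def norm_mult power_mult_distrib mult_ac)
  qed
  also have "\<dots> = ennreal 2 * Q_mass s (\<lambda>z. ?I z *\<^sub>R (h z * (f z - c))) a + ennreal (2 * (cmod c)\<^sup>2) * Q_mass s (\<lambda>z. ?I z *\<^sub>R h z) a"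
    unfolding Q_mass_def
    by (subst nn_integral_add, measurable, subst nn_integral_cmult, measurable, subst nn_integral_cmult, measurable)
  finally show ?thesis unfolding Q_mass_indicator .
qed

lemma T_op_maps_besov_Q:
  assumes p: "1 < p" "p \<le> 2" and s: "0 < s" "s < 1" and g: "g holomorphic_on unit_disc"
    and \<alpha>: "1 / 2 < \<alpha>" and gQ: "g \<in> Q_log_space s \<alpha>" and fB: "f \<in> besov p"
  shows "T_op g f \<in> Q_space s"
proof -
  have f: "f holomorphic_on unit_disc" using fB by (simp add: besov_def)
  have dg: "deriv g holomorphic_on unit_disc" and df: "deriv f holomorphic_on unit_disc"
    by (auto intro!: holomorphic_deriv f g)
  have "dirichlet_energy f < \<infinity>"
    by (rule besov_imp_dirichlet[OF p df]) (use fB in \<open>simp add: besov_def\<close>)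
  then obtain D where D: "0 \<le> D" "dirichlet_energy f = ennreal D"
    by (rule ennreal_finiteE)
  obtain M where M: "0 \<le> M" "\<And>a. a \<in> unit_disc \<Longrightarrow> ennreal (log_weight a powr (2 * \<alpha>)) * Q_mass s (deriv g) a \<le> ennreal M"
    using Q_log_spaceE[OF gQ] by blast
  \<comment> \<open>Exponent \<open>0\<close> gives the uniform mass bound for the oscillation of
    \<open>f\<close>; exponent \<open>1\<close>, admissible since
    \<open>1 \<le> 2 * \<alpha>\<close>, pays for \<open>(cmod (f a))\<^sup>2\<close>, which may
    grow like \<open>log_weight a\<close>.\<close>
  have L0: "Q_mass s (deriv g) a \<le> ennreal (ln 2 powr (0 - 2 * \<alpha>) * M)" if "a \<in> unit_disc" for a
    using Q_log_mass_le[OF M(1) M(2)[OF that] that, of 0] \<alpha> log_weight_pos[OF that] by simp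
  have L1: "ennreal (log_weight a) * Q_mass s (deriv g) a \<le> ennreal (ln 2 powr (1 - 2 * \<alpha>) * M)" if "a \<in> unit_disc" for a
    using Q_log_mass_le[OF M(1) M(2)[OF that] that, of 1] \<alpha> log_weight_pos[OF that] by simp
  obtain C1 where C1: "0 < C1" "\<And>f a D. f holomorphic_on unit_disc \<Longrightarrow> 0 \<le> D \<Longrightarrow>
    dirichlet_energy f = ennreal D \<Longrightarrow> a \<in> unit_disc \<Longrightarrow>
    (cmod (f a - f 0))\<^sup>2 \<le> C1 * D * log_weight a"
    using dirichlet_growth by blast
  obtain C2 where C2: "0 < C2" "\<And>f h a M D. f holomorphic_on unit_disc \<Longrightarrow> h holomorphic_on unit_disc \<Longrightarrow>
    0 \<le> D \<Longrightarrow> dirichlet_energy f = ennreal D \<Longrightarrow>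
    0 \<le> M \<Longrightarrow> (\<And>b. b \<in> unit_disc \<Longrightarrow> Q_mass s h b \<le> ennreal M) \<Longrightarrow> a \<in> unit_disc \<Longrightarrow>
    Q_mass s (\<lambda>z. h z * (f z - f a)) a \<le> ennreal (C2 * D * M)"
    using dirichlet_multiplier_difference[OF s] by blast
  \<comment> \<open>The second summand absorbs the constant \<open>f 0\<close> into the logarithm,
    again by \<open>ln 2 \<le> log_weight a\<close>.\<close>
  define E where "E = 2 * C1 * D + 2 * (cmod (f 0))\<^sup>2 / ln 2"
  have E: "0 \<le> E" using C1(1) D(1) by (simp add: E_def)
  have growth: "(cmod (f a))\<^sup>2 \<le> E * log_weight a" if a: "a \<in> unit_disc" for a
  proof -
    have "cmod (f a) \<le> cmod (f a - f 0) + cmod (f 0)" using norm_triangle_ineq[of "f a - f 0" "f 0"] by simp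
    then have "(cmod (f a))\<^sup>2 \<le> (cmod (f a - f 0) + cmod (f 0))\<^sup>2" by (rule power_mono) simp
    also have "\<dots> \<le> 2 * (cmod (f a - f 0))\<^sup>2 + 2 * (cmod (f 0))\<^sup>2"
      using zero_le_power2[of "cmod (f a - f 0) - cmod (f 0)"] by (simp add: power2_sum power2_diff)
    also have "(cmod (f a - f 0))\<^sup>2 \<le> C1 * D * log_weight a" by (rule C1(2)[OF f D a])
    also have "2 * (cmod (f 0))\<^sup>2 \<le> 2 * (cmod (f 0))\<^sup>2 / ln 2 * log_weight a"
    proof -
      have "2 * (cmod (f 0))\<^sup>2 / ln 2 * ln 2 \<le> 2 * (cmod (f 0))\<^sup>2 / ln 2 * log_weight a"
        by (intro mult_left_mono log_weight_ge a) auto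
      then show ?thesis by simp
    qed
    finally show ?thesis by (simp add: E_def algebra_simps)
  qed
  define N where "N = 2 * (C2 * D * (ln 2 powr (0 - 2 * \<alpha>) * M)) + 2 * E * (ln 2 powr (1 - 2 * \<alpha>) * M)"
  have "Q_mass s (deriv (T_op g f)) a \<le> ennreal N" if a: "a \<in> unit_disc" for a
  proof -
    have "Q_mass s (deriv (T_op g f)) a = Q_mass s (\<lambda>z. deriv g z * f z) a"
      by (rule T_op_Q_mass[OF g f])
    also have "\<dots> \<le> ennreal 2 * Q_mass s (\<lambda>z. deriv g z * (f z - f a)) a + ennreal (2 * (cmod (f a))\<^sup>2) * Q_mass s (deriv g) a"
      by (rule Q_mass_add_le[OF dg f])
    also have "\<dots> \<le> ennreal 2 * ennreal (C2 * D * (ln 2 powr (0 - 2 * \<alpha>) * M)) + ennreal (2 * E) * (ennreal (log_weight a) * Q_mass s (deriv g) a)"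
    proof (intro add_mono mult_left_mono)
      show "Q_mass s (\<lambda>z. deriv g z * (f z - f a)) a \<le> ennreal (C2 * D * (ln 2 powr (0 - 2 * \<alpha>) * M))"
        by (rule C2(2)[OF f dg D _ L0 a]) (use M in auto)
      have "ennreal (2 * (cmod (f a))\<^sup>2) \<le> ennreal (2 * E * log_weight a)"
        using growth[OF a] by (intro ennreal_leI) simp
      also have "\<dots> = ennreal (2 * E) * ennreal (log_weight a)"
        using E log_weight_pos[OF a] by (intro ennreal_mult) auto
      finally show "ennreal (2 * (cmod (f a))\<^sup>2) * Q_mass s (deriv g) a \<le> ennreal (2 * E) * (ennreal (log_weight a) * Q_mass s (deriv g) a)"
        unfolding mult.assoc[symmetric] by (rule mult_right_mono) simp
    qed simp
    also have "\<dots> \<le> ennreal 2 * ennreal (C2 * D * (ln 2 powr (0 - 2 * \<alpha>) * M)) + ennreal (2 * E) * ennreal (ln 2 powr (1 - 2 * \<alpha>) * M)"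
      by (intro add_left_mono mult_left_mono L1 a) simp
    also have "\<dots> = ennreal N"
      unfolding N_def using C2(1) D(1) M(1) E
      by (subst ennreal_plus) (auto simp only: ennreal_mult' mult_nonneg_nonneg powr_ge_zero zero_le_numeral less_imp_le)
    finally show ?thesis .
  qed
  then have "(SUP a\<in>unit_disc. Q_mass s (deriv (T_op g f)) a) \<le> ennreal N"
    by (rule SUP_least)
  then show ?thesis
    unfolding Q_space_iff[OF s] using T_op_deriv(1)[OF g f] by (auto intro: le_less_trans)
qed

section \<open>Logarithmic test functions and necessity\<close>

text \<open>The tangent argument for series: sum the tangent inequalities at the weighted mean
  \<open>c\<close>; the weights have total mass \<open>1\<close>, so the linear terms combine to
  \<open>c powr p\<close>.\<close>

lemma suminf_powr_jensen:
  fixes w t :: "nat \<Rightarrow> real"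
  assumes p: "1 \<le> p" and w: "\<And>n. 0 \<le> w n" "w sums 1" and t: "\<And>n. 0 \<le> t n"
    and sum: "summable (\<lambda>n. w n * t n)" "summable (\<lambda>n. w n * t n powr p)"
  shows "(\<Sum>n. w n * t n) powr p \<le> (\<Sum>n. w n * t n powr p)"
proof -
  define c where "c = (\<Sum>n. w n * t n)"
  have c: "0 \<le> c" unfolding c_def by (intro suminf_nonneg sum mult_nonneg_nonneg w t)
  have s1: "(\<lambda>n. p * c powr (p - 1) * (w n * t n)) sums (p * c powr (p - 1) * c)"
    unfolding c_def by (intro sums_mult summable_sums sum)
  have s2: "(\<lambda>n. w n * t n powr p + (p - 1) * c powr p * w n) sums ((\<Sum>n. w n * t n powr p) + (p - 1) * c powr p * 1)"
    by (intro sums_add sums_mult w summable_sums sum)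
  have s3: "p * c powr (p - 1) * (w n * t n) \<le> w n * t n powr p + (p - 1) * c powr p * w n" for n
    using mult_left_mono[OF powr_tangent_le[OF p t[of n] c] w(1)[of n]] by (simp add: algebra_simps)
  have le: "p * c powr (p - 1) * c \<le> (\<Sum>n. w n * t n powr p) + (p - 1) * c powr p * 1"
    by (rule sums_le[OF s3 s1 s2])
  have eq: "p * c powr (p - 1) * c = p * c powr p"
    using powr_mult_base[OF c, of "p - 1"] by (simp add: mult.commute)
  have "c powr p \<le> (\<Sum>n. w n * t n powr p)"
    using le unfolding eq by (simp add: algebra_simps)
  then show ?thesis unfolding c_def .
qed

text \<open>The point \<open>b\<close> lies on the radius of \<open>a\<close> at distance
  \<open>q = 2 ^ k * (1 - cmod a)\<close> from the circle, or is \<open>0\<close> if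
  \<open>q > 1\<close>. Where the \<open>a\<close>-kernel has size about \<open>q\<close>, the
  \<open>b\<close>-kernel is at most of that size too, so the two weights differ essentially by the
  ratio \<open>(1 - cmod a) / q = 1 / 2 ^ k\<close>. The constant is \<open>8 * 4\<close>:
  \<open>8\<close> from estimating the weight of \<open>a\<close>, \<open>4\<close> from that of
  \<open>b\<close>.\<close>

lemma phi_weight_dyadic_shift:
  assumes a: "a \<in> unit_disc" and z: "z \<in> unit_disc"
    and k: "2 ^ k * (1 - cmod a) \<le> 2 * kernel_norm a z" "kernel_norm a z \<le> 2 ^ k * (1 - cmod a)"
  defines "b \<equiv> of_real (max 0 (1 - 2 ^ k * (1 - cmod a))) * sgn a"
  shows "1 - (cmod (phi a z))\<^sup>2 \<le> 32 / 2 ^ k * (1 - (cmod (phi b z))\<^sup>2)" "b \<in> unit_disc"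
proof -
  define \<delta> q X where "\<delta> = 1 - cmod a" and "q = 2 ^ k * \<delta>" and "X = kernel_norm a z"
  have \<delta>: "0 < \<delta>" "\<delta> \<le> 1" using a by (auto simp: \<delta>_def)
  have q: "\<delta> \<le> q" using \<delta> mult_right_mono[of 1 "2 ^ k" \<delta>] by (simp add: q_def)
  have q0: "0 < q" using \<delta> q by simp
  have X: "q \<le> 2 * X" "X \<le> q" using k by (simp_all add: X_def q_def \<delta>_def)
  have X0: "0 < X" using X q0 by linarith
  have z1: "0 < 1 - (cmod z)\<^sup>2" using z by (simp add: power_less_one_iff)
  have kq: "1 / 2 ^ k = \<delta> / q" using \<delta> by (simp add: q_def)
  \<comment> \<open>Only an inequality, since \<open>sgn a\<close> vanishes for
    \<open>a = 0\<close>.\<close>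
  have bq: "cmod b \<le> max 0 (1 - q)" by (simp add: b_def q_def \<delta>_def norm_mult norm_sgn)
  have "max 0 (1 - q) < 1" using q0 by simp
  with bq show b: "b \<in> unit_disc" by simp
  define P where "P = 1 - (cmod (phi b z))\<^sup>2"
  have "1 - (cmod (phi a z))\<^sup>2 \<le> (2 * \<delta>) * (1 - (cmod z)\<^sup>2) / (q\<^sup>2 / 4)"
    unfolding one_minus_phi[OF a z]
  proof (intro frac_le mult_right_mono)
    show "q\<^sup>2 / 4 \<le> (kernel_norm a z)\<^sup>2"
      using power_mono[OF X(1), of 2] q0 by (simp add: X_def power_mult_distrib)
  qed (use one_minus_square_bounds(2)[OF a] z1 q0 \<delta> in \<open>auto simp: \<delta>_def\<close>)
  also have "\<dots> = 8 * (\<delta> / q) * ((1 - (cmod z)\<^sup>2) / q)"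
    using q0 by (simp add: power2_eq_square)
  also have "\<dots> \<le> 8 * (\<delta> / q) * (4 * P)"
  proof (intro mult_left_mono)
    show "(1 - (cmod z)\<^sup>2) / q \<le> 4 * P"
    proof (cases "q \<le> 1")
      case True
      have a_eq: "a = of_real (cmod a) * sgn a"
        by (cases "a = 0") (simp_all add: sgn_eq)
      have sgn1: "cmod (sgn a) \<le> 1" by (simp add: norm_sgn)
      have "a - b = of_real (q - \<delta>) * sgn a"
        using True by (subst a_eq) (simp add: b_def q_def \<delta>_def algebra_simps)
      then have ab: "cmod (a - b) \<le> q - \<delta>"
        using q sgn1 by (simp add: norm_mult mult_left_le del: of_real_diff)
      have "1 - cnj b * z = (1 - cnj a * z) + cnj (a - b) * z" by (simp add: algebra_simps)
      then have "kernel_norm b z \<le> X + cmod (cnj (a - b) * z)"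
        unfolding X_def by (metis norm_triangle_ineq)
      also have "cmod (cnj (a - b) * z) \<le> cmod (a - b)"
        using z by (simp add: norm_mult mult_left_le flip: complex_cnj_diff)
      finally have "kernel_norm b z \<le> 2 * q" using X ab \<delta> by linarith
      then have kb: "(kernel_norm b z)\<^sup>2 \<le> 4 * q\<^sup>2"
        using power_mono[of "kernel_norm b z" "2 * q" 2] by (simp add: power_mult_distrib)
      have "q \<le> 1 - cmod b" using bq True by simp
      then have qb: "q \<le> 1 - (cmod b)\<^sup>2" using one_minus_square_bounds(1)[OF b] by simp
      have "q * (1 - (cmod z)\<^sup>2) / (4 * q\<^sup>2) \<le> P"
        unfolding P_def one_minus_phi[OF b z]
        using kb qb q0 z1 unit_disc_kernel(4)[OF b z] by (intro frac_le mult_right_mono) auto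
      then show ?thesis using q0 by (simp add: power2_eq_square)
    next
      case False
      then have "b = 0" by (simp add: b_def q_def \<delta>_def)
      then have "P = 1 - (cmod z)\<^sup>2" by (simp add: P_def phi_def)
      moreover have "(1 - (cmod z)\<^sup>2) / q \<le> (1 - (cmod z)\<^sup>2) / 1"
        using False z1 by (intro divide_left_mono) auto
      ultimately show ?thesis using z1 by simp
    qed
  qed (use \<delta> q0 in auto)
  also have "\<dots> = 32 / 2 ^ k * P" unfolding kq[symmetric] by simp
  finally show "1 - (cmod (phi a z))\<^sup>2 \<le> 32 / 2 ^ k * (1 - (cmod (phi b z))\<^sup>2)"
    by (simp add: P_def)
qed

text \<open>With \<open>t = |1 - cnj a * z| / (1 - |a|) \<le> 2 ^ k\<close>, the logarithmic factor is absorbed into the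
  decay gained by moving \<open>a\<close> towards the origin to the scale \<open>2 ^ k * (1 - |a|)\<close>.\<close>

lemma Q_weight_log_dyadic:
  assumes s: "0 < s" "s < 1" and a: "a \<in> unit_disc" and z: "z \<in> unit_disc"
  obtains k where "Q_weight s a z * (ln (kernel_norm a z / (1 - cmod a)))\<^sup>2
    \<le> 512 / s\<^sup>2 * (2 powr - (s / 2)) ^ k * Q_weight s (of_real (max 0 (1 - 2 ^ k * (1 - cmod a))) * sgn a) z"
proof -
  define \<delta> t where "\<delta> = 1 - cmod a" and "t = kernel_norm a z / \<delta>"
  have \<delta>: "0 < \<delta>" using a by (auto simp: \<delta>_def)
  obtain j where j: "2 ^ j * \<delta> \<le> kernel_norm a z" "kernel_norm a z < 2 ^ Suc j * \<delta>"
    using ex_dyadic[OF \<delta>] unit_disc_kernel(1)[OF a z] unfolding \<delta>_def by metis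
  \<comment> \<open>The upper end of the shell: this makes \<open>2 ^ k\<close> an upper bound for
    \<open>t\<close>, at the price of the factor \<open>2\<close> in the lower bound for the
    kernel.\<close>
  define k where "k = Suc j"
  have k: "2 ^ k * \<delta> \<le> 2 * kernel_norm a z" "kernel_norm a z \<le> 2 ^ k * \<delta>"
    using j by (simp_all add: k_def)
  define b where "b = of_real (max 0 (1 - 2 ^ k * \<delta>)) * sgn a"
  note shift = phi_weight_dyadic_shift[OF a z k[unfolded \<delta>_def], folded \<delta>_def, folded b_def]
  have t: "1 \<le> t" "t \<le> 2 ^ k"
    using \<delta> unit_disc_kernel(1)[OF a z] k(2) by (simp_all add: t_def \<delta>_def field_simps)
  \<comment> \<open>The exponent \<open>s / 4\<close> makes the squared logarithm cost
    \<open>(2 ^ k) powr (s / 2)\<close>, half of the decay \<open>(2 ^ k) powr - s\<close>; the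
    other half remains for a convergent geometric series. The constant is
    \<open>512 = 32 * 4\<^sup>2\<close>.\<close>
  have "ln t \<le> t powr (s / 4) / (s / 4)" using t s by (intro ln_powr_bound) auto
  also have "\<dots> \<le> (2 ^ k) powr (s / 4) / (s / 4)"
    using t s by (intro divide_right_mono powr_mono2) auto
  finally have "(ln t)\<^sup>2 \<le> ((2 ^ k) powr (s / 4) / (s / 4))\<^sup>2"
    using t by (intro power_mono) auto
  also have "\<dots> = 16 / s\<^sup>2 * ((2 ^ k) powr (s / 4) * (2 ^ k) powr (s / 4))"
    using s by (simp add: power2_eq_square field_simps)
  also have "(2 ^ k) powr (s / 4) * (2 ^ k) powr (s / 4) = (2 ^ k :: real) powr (s / 2)"
    by (simp flip: powr_add)
  finally have ln2: "(ln t)\<^sup>2 \<le> 16 / s\<^sup>2 * (2 ^ k) powr (s / 2)" .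
  have "Q_weight s a z \<le> (32 / 2 ^ k * (1 - (cmod (phi b z))\<^sup>2)) powr s"
    unfolding Q_weight_def using shift(1) phi_bounds(1)[OF a z] s by (intro powr_mono2) auto
  also have "\<dots> = 32 powr s * (2 ^ k) powr - s * Q_weight s b z"
    unfolding Q_weight_def powr_mult powr_divide powr_minus_divide by simp
  also have "\<dots> \<le> 32 powr 1 * (2 ^ k) powr - s * Q_weight s b z"
    using s by (intro mult_right_mono powr_mono) auto
  finally have W: "Q_weight s a z \<le> 32 * (2 ^ k) powr - s * Q_weight s b z" by simp
  have "Q_weight s a z * (ln t)\<^sup>2 \<le> (32 * (2 ^ k) powr - s * Q_weight s b z) * (16 / s\<^sup>2 * (2 ^ k) powr (s / 2))"
    by (intro mult_mono W ln2) auto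
  also have "\<dots> = 512 / s\<^sup>2 * ((2 ^ k) powr - s * (2 ^ k) powr (s / 2)) * Q_weight s b z"
    by simp
  also have "(2 ^ k) powr - s * (2 ^ k) powr (s / 2) = (2 ^ k :: real) powr - (s / 2)"
    by (simp flip: powr_add)
  also have "\<dots> = (2 powr - (s / 2)) ^ k" by (rule power2_powr)
  finally show ?thesis using that[of k] by (simp add: t_def b_def \<delta>_def)
qed

text \<open>The level \<open>k\<close> depends on \<open>z\<close>, but the shifted centres
  \<open>b k\<close> depend only on \<open>a\<close>. Summing over all levels removes the choice,
  and a single bound \<open>M\<close> applies at every centre.\<close>

lemma log_moment_bound:
  assumes s: "0 < s" "s < 1" and h: "h holomorphic_on unit_disc"
    and M: "0 \<le> M" "\<And>b. b \<in> unit_disc \<Longrightarrow> Q_mass s h b \<le> ennreal M"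
  obtains C where "0 \<le> C" "\<And>a. a \<in> unit_disc \<Longrightarrow>
    (\<integral>\<^sup>+z. ennreal ((cmod (h z))\<^sup>2 * (Q_weight s a z * (ln (kernel_norm a z / (1 - cmod a)))\<^sup>2)) \<partial>disc_area) \<le> ennreal C"
proof
  define r where "r = 2 powr - (s / 2)"
  have r: "0 \<le> r" "r < 1" using s by (auto simp: r_def powr_less_one)
  define C0 where "C0 = 512 / s\<^sup>2"
  have C0: "0 \<le> C0" by (simp add: C0_def)
  show "0 \<le> C0 * M / (1 - r)" using C0 M r by simp
  fix a assume a: "a \<in> unit_disc"
  define b where "b k = of_real (max 0 (1 - 2 ^ k * (1 - cmod a))) * sgn a" for k :: nat
  have b: "b k \<in> unit_disc" for k
  proof -
    have "cmod (b k) \<le> max 0 (1 - 2 ^ k * (1 - cmod a))" by (simp add: b_def norm_mult norm_sgn)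
    also have "\<dots> < 1" using a by simp
    finally show ?thesis by simp
  qed
  define H where "H z = indicator unit_disc z *\<^sub>R h z" for z
  have [measurable]: "H \<in> borel_measurable borel"
    unfolding H_def by (rule borel_measurable_indicator_holomorphic[OF h])
  have "(\<integral>\<^sup>+z. ennreal ((cmod (h z))\<^sup>2 * (Q_weight s a z * (ln (kernel_norm a z / (1 - cmod a)))\<^sup>2)) \<partial>disc_area)
    \<le> (\<integral>\<^sup>+z. (\<Sum>k. ennreal (C0 * r ^ k) * ennreal ((cmod (H z))\<^sup>2 * Q_weight s (b k) z)) \<partial>disc_area)"
  proof (rule nn_integral_mono_AE, use AE_disc_area in eventually_elim)
    fix z assume z: "z \<in> unit_disc"
    obtain k where "Q_weight s a z * (ln (kernel_norm a z / (1 - cmod a)))\<^sup>2 \<le> C0 * r ^ k * Q_weight s (b k) z"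
      using Q_weight_log_dyadic[OF s a z] unfolding C0_def r_def b_def by blast
    then have "(cmod (h z))\<^sup>2 * (Q_weight s a z * (ln (kernel_norm a z / (1 - cmod a)))\<^sup>2) \<le> (cmod (h z))\<^sup>2 * (C0 * r ^ k * Q_weight s (b k) z)"
      by (rule mult_left_mono) simp
    also have "\<dots> = (C0 * r ^ k) * ((cmod (H z))\<^sup>2 * Q_weight s (b k) z)"
      using z by (simp add: H_def)
    finally have "ennreal ((cmod (h z))\<^sup>2 * (Q_weight s a z * (ln (kernel_norm a z / (1 - cmod a)))\<^sup>2))
       \<le> ennreal ((C0 * r ^ k) * ((cmod (H z))\<^sup>2 * Q_weight s (b k) z))" by (rule ennreal_leI)
    also have "\<dots> = ennreal (C0 * r ^ k) * ennreal ((cmod (H z))\<^sup>2 * Q_weight s (b k) z)"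
      by (rule ennreal_mult) (use C0 r in auto)
    also have "\<dots> = sum (\<lambda>k. ennreal (C0 * r ^ k) * ennreal ((cmod (H z))\<^sup>2 * Q_weight s (b k) z)) {k}" by simp
    also have "\<dots> \<le> (\<Sum>k. ennreal (C0 * r ^ k) * ennreal ((cmod (H z))\<^sup>2 * Q_weight s (b k) z))"
      by (rule sum_le_suminf) auto
    finally show "ennreal ((cmod (h z))\<^sup>2 * (Q_weight s a z * (ln (kernel_norm a z / (1 - cmod a)))\<^sup>2)) \<le> \<dots>" .
  qed
  also have "\<dots> = (\<Sum>k. \<integral>\<^sup>+z. ennreal (C0 * r ^ k) * ennreal ((cmod (H z))\<^sup>2 * Q_weight s (b k) z) \<partial>disc_area)"
    by (rule nn_integral_suminf) measurable
  also have "\<dots> \<le> (\<Sum>k. ennreal (C0 * M * r ^ k))"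
  proof (intro suminf_le allI)
    fix k
    have "(\<integral>\<^sup>+z. ennreal (C0 * r ^ k) * ennreal ((cmod (H z))\<^sup>2 * Q_weight s (b k) z) \<partial>disc_area) = ennreal (C0 * r ^ k) * Q_mass s H (b k)"
      unfolding Q_mass_def by (rule nn_integral_cmult) measurable
    also have "\<dots> \<le> ennreal (C0 * r ^ k) * ennreal M"
      unfolding H_def Q_mass_indicator by (intro mult_left_mono M(2) b) simp
    also have "\<dots> = ennreal (C0 * M * r ^ k)"
      using C0 r M(1) by (subst ennreal_mult[symmetric]) (auto simp: mult_ac)
    finally show "(\<integral>\<^sup>+z. ennreal (C0 * r ^ k) * ennreal ((cmod (H z))\<^sup>2 * Q_weight s (b k) z) \<partial>disc_area) \<le> ennreal (C0 * M * r ^ k)" .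
  qed auto
  also have "\<dots> = ennreal (C0 * M / (1 - r))"
    using C0 M(1) r by (intro suminf_ennreal_geometric) auto
  finally show "(\<integral>\<^sup>+z. ennreal ((cmod (h z))\<^sup>2 * (Q_weight s a z * (ln (kernel_norm a z / (1 - cmod a)))\<^sup>2)) \<partial>disc_area)
    \<le> ennreal (C0 * M / (1 - r))" .
qed

text \<open>A branch of the logarithm of \<open>2 / (1 - cnj a * z)\<close>: written as a
  difference, it uses \<open>Ln\<close> only on the right half-plane, where
  \<open>1 - cnj a * z\<close> lies. The power of \<open>log_weight\<close> normalises the Besov
  integral.\<close>

definition log_test :: "real \<Rightarrow> complex \<Rightarrow> complex \<Rightarrow> complex" where
  "log_test p a z = of_real (log_weight a powr (- 1 / p)) * (of_real (ln 2) - Ln (1 - cnj a * z))"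

abbreviation log_test_deriv :: "real \<Rightarrow> complex \<Rightarrow> complex \<Rightarrow> complex" where
  "log_test_deriv p a z \<equiv> of_real (log_weight a powr (- 1 / p)) * (cnj a / (1 - cnj a * z))"

lemma Re_kernel_pos:
  assumes "a \<in> unit_disc" "z \<in> unit_disc"
  shows "0 < Re (1 - cnj a * z)"
proof -
  have "Re (cnj a * z) \<le> cmod (cnj a * z)" by (rule complex_Re_le_cmod)
  also have "\<dots> < 1"
    using mult_strict_mono[of "cmod a" 1 "cmod z" 1] assms by (simp add: norm_mult)
  finally show ?thesis by simp
qed

lemma has_field_derivative_log_test:
  assumes "a \<in> unit_disc" "z \<in> unit_disc"
  shows "(log_test p a has_field_derivative log_test_deriv p a z) (at z)"
proof -
  have "1 - cnj a * z \<notin> \<real>\<^sub>\<le>\<^sub>0"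
    using Re_kernel_pos[OF assms] by (auto simp: complex_nonpos_Reals_iff)
  then show ?thesis
    unfolding log_test_def[abs_def]
    by (auto intro!: derivative_eq_intros simp: field_simps)
qed

lemma Re_log_test:
  assumes "a \<in> unit_disc" "z \<in> unit_disc"
  shows "Re (log_test p a z) = log_weight a powr (- 1 / p) * (ln 2 - ln (kernel_norm a z))"
    and "0 \<le> Re (log_test p a z)"
proof -
  show 1: "Re (log_test p a z) = log_weight a powr (- 1 / p) * (ln 2 - ln (kernel_norm a z))"
    using unit_disc_kernel(5)[OF assms] by (simp add: log_test_def)
  have "ln (kernel_norm a z) \<le> ln 2"
    using unit_disc_kernel(3,4)[OF assms] by (intro ln_mono) auto
  then show "0 \<le> Re (log_test p a z)" unfolding 1 by simp
qed

lemma log_weight_powr_le: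
  assumes "a \<in> unit_disc" "0 < p"
  shows "log_weight a powr (- 1 / p) \<le> ln 2 powr (- 1 / p)"
  using log_weight_ge[OF assms(1)] assms(2) by (intro powr_mono2') auto

text \<open>The bound does not depend on \<open>a\<close>, so series of test functions with
  arbitrary centres converge locally uniformly. The summand \<open>pi\<close> bounds the
  argument.\<close>

lemma norm_log_test_le:
  assumes a: "a \<in> unit_disc" and z: "z \<in> unit_disc" and p: "0 < p" and d: "0 < d" "d \<le> 1 - cmod z"
  shows "cmod (log_test p a z) \<le> ln 2 powr (- 1 / p) * (ln 2 - ln d + pi)"
proof -
  define w where "w = 1 - cnj a * z"
  have w: "d \<le> cmod w" "cmod w \<le> 2" "w \<noteq> 0"
    using unit_disc_kernel[OF a z] d by (auto simp: w_def)
  have "cmod (of_real (ln 2) - Ln w) \<le> \<bar>Re (of_real (ln 2) - Ln w)\<bar> + \<bar>Im (of_real (ln 2) - Ln w)\<bar>"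
    by (rule cmod_le)
  also have "\<bar>Re (of_real (ln 2) - Ln w)\<bar> \<le> ln 2 - ln d"
  proof -
    have "ln d \<le> ln (cmod w)" "ln (cmod w) \<le> ln 2" using w d by (auto intro!: ln_mono)
    then show ?thesis using w(3) by simp
  qed
  also have "\<bar>Im (of_real (ln 2) - Ln w)\<bar> \<le> pi"
    using mpi_less_Im_Ln[OF w(3)] Im_Ln_le_pi[OF w(3)] by simp
  finally have "cmod (of_real (ln 2) - Ln w) \<le> ln 2 - ln d + pi" by simp
  then have "log_weight a powr (- 1 / p) * cmod (of_real (ln 2) - Ln w) \<le> ln 2 powr (- 1 / p) * (ln 2 - ln d + pi)"
    by (intro mult_mono log_weight_powr_le a p) auto
  then show ?thesis by (simp add: log_test_def w_def norm_mult)
qed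

text \<open>The \<open>p\<close>-th power of the normalising factor is
  \<open>1 / log_weight a\<close>, which cancels the logarithm of the kernel integral.\<close>

lemma log_test_besov_bound:
  assumes p: "1 < p" "p \<le> 2"
  obtains C where "0 < C" "\<And>a. a \<in> unit_disc \<Longrightarrow>
    (\<integral>\<^sup>+z. ennreal ((1 - cmod z) powr (p - 2) * cmod (log_test_deriv p a z) powr p) \<partial>disc_area) \<le> ennreal C"
proof -
  obtain C where C: "0 < C" "\<And>a. a \<in> unit_disc \<Longrightarrow>
    (\<integral>\<^sup>+u. ennreal ((1 - cmod u) powr (p - 2) * kernel_norm a u powr - p) \<partial>disc_area) \<le> ennreal (C * log_weight a)"
    using kernel_integral_log[OF p] by blast
  show ?thesis
  proof (rule that[OF C(1)])
    fix a assume a: "a \<in> unit_disc"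
    have L: "0 < log_weight a" by (rule log_weight_pos[OF a])
    have "(\<integral>\<^sup>+z. ennreal ((1 - cmod z) powr (p - 2) * cmod (log_test_deriv p a z) powr p) \<partial>disc_area)
      \<le> (\<integral>\<^sup>+z. ennreal (1 / log_weight a) * ennreal ((1 - cmod z) powr (p - 2) * kernel_norm a z powr - p) \<partial>disc_area)"
    proof (rule nn_integral_mono_AE, use AE_disc_area in eventually_elim)
      fix z assume z: "z \<in> unit_disc"
      have k: "0 < kernel_norm a z" by (rule unit_disc_kernel(4)[OF a z])
      have "cmod (log_test_deriv p a z) \<le> log_weight a powr (- 1 / p) * (1 / kernel_norm a z)"
        unfolding norm_mult norm_divide using a k by (intro mult_mono divide_right_mono) auto
      then have "cmod (log_test_deriv p a z) powr p \<le> (log_weight a powr (- 1 / p) * (1 / kernel_norm a z)) powr p"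
        using p by (intro powr_mono2) auto
      also have "\<dots> = (log_weight a powr (- 1 / p)) powr p * (1 / kernel_norm a z) powr p"
        by (rule powr_mult)
      also have "(log_weight a powr (- 1 / p)) powr p = 1 / log_weight a"
      proof -
        have "(log_weight a powr (- 1 / p)) powr p = log_weight a powr (- 1 / p * p)" by (rule powr_powr)
        also have "- 1 / p * p = - 1" using p by simp
        also have "log_weight a powr - 1 = 1 / log_weight a" using L by (simp add: powr_minus_divide)
        finally show ?thesis .
      qed
      also have "(1 / kernel_norm a z) powr p = kernel_norm a z powr - p"
        by (simp add: powr_divide powr_minus_divide)
      finally have "(1 - cmod z) powr (p - 2) * cmod (log_test_deriv p a z) powr p
        \<le> (1 - cmod z) powr (p - 2) * (1 / log_weight a * kernel_norm a z powr - p)"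
        by (rule mult_left_mono) simp
      also have "\<dots> = 1 / log_weight a * ((1 - cmod z) powr (p - 2) * kernel_norm a z powr - p)" by simp
      finally have "ennreal ((1 - cmod z) powr (p - 2) * cmod (log_test_deriv p a z) powr p)
        \<le> ennreal (1 / log_weight a * ((1 - cmod z) powr (p - 2) * kernel_norm a z powr - p))" by (rule ennreal_leI)
      also have "\<dots> = ennreal (1 / log_weight a) * ennreal ((1 - cmod z) powr (p - 2) * kernel_norm a z powr - p)"
        by (rule ennreal_mult) (use L in auto)
      finally show "ennreal ((1 - cmod z) powr (p - 2) * cmod (log_test_deriv p a z) powr p) \<le> \<dots>" .
    qed
    also have "\<dots> = ennreal (1 / log_weight a) * (\<integral>\<^sup>+z. ennreal ((1 - cmod z) powr (p - 2) * kernel_norm a z powr - p) \<partial>disc_area)"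
      by (rule nn_integral_cmult) measurable
    also have "\<dots> \<le> ennreal (1 / log_weight a) * ennreal (C * log_weight a)"
      by (intro mult_left_mono C(2) a) simp
    also have "\<dots> = ennreal C"
      using L C(1) by (subst ennreal_mult[symmetric]) auto
    finally show "(\<integral>\<^sup>+z. ennreal ((1 - cmod z) powr (p - 2) * cmod (log_test_deriv p a z) powr p) \<partial>disc_area) \<le> ennreal C" .
  qed
qed

text \<open>The real parts of the test functions are nonnegative, so no cancellation can occur in the
  series and each single term is a lower bound for it.\<close>

lemma log_test_series:
  fixes a :: "nat \<Rightarrow> complex"
  assumes p: "1 < p" "p \<le> 2" and a: "\<And>n. a n \<in> unit_disc"
  obtains f where "f \<in> besov p"
    "\<forall>n. \<forall>z\<in>unit_disc. (1 / 2) ^ Suc n * Re (log_test p (a n) z) \<le> cmod (f z)"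
proof -
  define T' where "T' n z = of_real (log_weight (a n) powr (- 1 / p)) * (cnj (a n) / (1 - cnj (a n) * z))" for n z
  \<comment> \<open>The exponent \<open>Suc n\<close> makes the weights sum to exactly
    \<open>1\<close>, as convexity requires.\<close>
  define w :: "nat \<Rightarrow> real" where "w n = (1 / 2) ^ Suc n" for n
  have w: "0 \<le> w n" "w sums 1" for n
    using power_half_series by (simp_all add: w_def[abs_def])
  have sumw: "summable (\<lambda>n. w n * B)" for B using w(2) by (intro summable_mult2) (auto simp: sums_iff)
  have "\<exists>g g'. \<forall>x\<in>unit_disc. ((\<lambda>n. of_real (w n) * log_test p (a n) x) sums g x) \<and> ((\<lambda>n. of_real (w n) * T' n x) sums g' x) \<and> (g has_field_derivative g' x) (at x)"
  proof (rule series_and_derivative_comparison_local[OF open_ball])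
    fix n x assume x: "x \<in> unit_disc"
    show "((\<lambda>x. of_real (w n) * log_test p (a n) x) has_field_derivative of_real (w n) * T' n x) (at x)"
      unfolding T'_def by (rule DERIV_cmult[OF has_field_derivative_log_test[OF a x]])
  next
    fix x :: complex assume x: "x \<in> unit_disc"
    \<comment> \<open>Half the distance to the circle: every point of the ball of radius
      \<open>d\<close> still has distance at least \<open>d\<close> from the circle.\<close>
    define d where "d = (1 - cmod x) / 2"
    have d: "0 < d" using x by (simp add: d_def)
    let ?B = "ln 2 powr (- 1 / p) * (ln 2 - ln d + pi)"
    have "norm (of_real (w n) * log_test p (a n) y) \<le> w n * ?B" if y: "y \<in> ball x d \<inter> unit_disc" for n y
    proof -
      have "cmod y \<le> cmod x + d" using y norm_triangle_ineq2[of y x] by (simp add: dist_norm norm_minus_commute)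
      then have "d \<le> 1 - cmod y" unfolding d_def by (simp add: field_simps)
      then have "cmod (log_test p (a n) y) \<le> ?B" using y p d by (intro norm_log_test_le a) auto
      from mult_left_mono[OF this w(1)[of n]] show ?thesis using w(1)[of n] by (simp add: norm_mult)
    qed
    then show "\<exists>d h. 0 < d \<and> summable h \<and> (\<forall>\<^sub>F n in sequentially. \<forall>y\<in>ball x d \<inter> unit_disc. norm (of_real (w n) * log_test p (a n) y) \<le> h n)"
      using d sumw[of ?B] by (intro exI[of _ d] exI[of _ "\<lambda>n. w n * ?B"] conjI always_eventually allI ballI) auto
  qed
  then obtain f f' where ff: "\<And>x. x \<in> unit_disc \<Longrightarrow> (\<lambda>n. of_real (w n) * log_test p (a n) x) sums f x"
    "\<And>x. x \<in> unit_disc \<Longrightarrow> (\<lambda>n. of_real (w n) * T' n x) sums f' x"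
    "\<And>x. x \<in> unit_disc \<Longrightarrow> (f has_field_derivative f' x) (at x)" by blast
  have holf: "f holomorphic_on unit_disc"
    unfolding holomorphic_on_open[OF open_ball] using ff(3) by blast
  have derf: "deriv f z = f' z" if "z \<in> unit_disc" for z by (rule DERIV_imp_deriv[OF ff(3)[OF that]])
  \<comment> \<open>Convexity takes the place of Minkowski's inequality. Integrated term by term, it
    bounds the Besov integral of the series by the common bound of the test functions.\<close>
  have jensen: "ennreal (cmod (deriv f z) powr p) \<le> (\<Sum>n. ennreal (w n * cmod (T' n z) powr p))" if z: "z \<in> unit_disc" for z
  proof -
    define B where "B = ln 2 powr (- 1 / p) * (1 / (1 - cmod z))"
    have TB: "cmod (T' n z) \<le> B" for n
      unfolding T'_def B_def norm_mult norm_divide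
    proof (intro mult_mono frac_le)
      show "cmod (of_real (log_weight (a n) powr (- 1 / p))) \<le> ln 2 powr (- 1 / p)"
        using log_weight_powr_le[OF a, of p n] p by simp
      show "cmod (cnj (a n)) \<le> 1" using a[of n] by simp
      show "1 - cmod z \<le> cmod (1 - cnj (a n) * z)" by (rule unit_disc_kernel(2)[OF a z])
    qed (use z in auto)
    have s1: "summable (\<lambda>n. w n * cmod (T' n z))"
      by (rule summable_comparison_test'[OF sumw[of B], of 0])
        (use TB w(1) in \<open>auto simp: abs_mult intro: mult_left_mono\<close>)
    have s2: "summable (\<lambda>n. w n * cmod (T' n z) powr p)"
      by (rule summable_comparison_test'[OF sumw[of "B powr p"], of 0])
        (use TB w(1) p in \<open>auto simp: abs_mult intro!: mult_left_mono powr_mono2\<close>)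
    have "cmod (deriv f z) = cmod (\<Sum>n. of_real (w n) * T' n z)"
      using derf[OF z] sums_unique[OF ff(2)[OF z]] by simp
    also have "\<dots> \<le> (\<Sum>n. cmod (of_real (w n) * T' n z))"
      by (rule summable_norm) (use s1 w(1) in \<open>simp add: norm_mult\<close>)
    also have "\<dots> = (\<Sum>n. w n * cmod (T' n z))" using w(1) by (simp add: norm_mult)
    finally have "cmod (deriv f z) powr p \<le> (\<Sum>n. w n * cmod (T' n z)) powr p"
      using p by (intro powr_mono2) auto
    also have "\<dots> \<le> (\<Sum>n. w n * cmod (T' n z) powr p)"
      using p by (intro suminf_powr_jensen w s1 s2) auto
    finally have "ennreal (cmod (deriv f z) powr p) \<le> ennreal (\<Sum>n. w n * cmod (T' n z) powr p)" by (rule ennreal_leI)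
    also have "\<dots> = (\<Sum>n. ennreal (w n * cmod (T' n z) powr p))"
      by (rule suminf_ennreal2[symmetric]) (use s2 w(1) in auto)
    finally show ?thesis .
  qed
  obtain C where C: "0 < C" "\<And>a. a \<in> unit_disc \<Longrightarrow>
    (\<integral>\<^sup>+z. ennreal ((1 - cmod z) powr (p - 2) * cmod (log_test_deriv p a z) powr p) \<partial>disc_area) \<le> ennreal C"
    using log_test_besov_bound[OF p] by blast
  have [measurable]: "T' n \<in> borel_measurable borel" for n
    unfolding T'_def by measurable
  have "(\<integral>\<^sup>+z. ennreal ((1 - cmod z) powr (p - 2) * cmod (deriv f z) powr p) \<partial>disc_area)
    \<le> (\<integral>\<^sup>+z. (\<Sum>n. ennreal (w n) * ennreal ((1 - cmod z) powr (p - 2) * cmod (T' n z) powr p)) \<partial>disc_area)"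
  proof (rule nn_integral_mono_AE, use AE_disc_area in eventually_elim)
    fix z assume z: "z \<in> unit_disc"
    have "ennreal ((1 - cmod z) powr (p - 2) * cmod (deriv f z) powr p) = ennreal ((1 - cmod z) powr (p - 2)) * ennreal (cmod (deriv f z) powr p)"
      by (rule ennreal_mult) auto
    also have "\<dots> \<le> ennreal ((1 - cmod z) powr (p - 2)) * (\<Sum>n. ennreal (w n * cmod (T' n z) powr p))"
      by (intro mult_left_mono jensen z) simp
    also have "\<dots> = (\<Sum>n. ennreal ((1 - cmod z) powr (p - 2)) * ennreal (w n * cmod (T' n z) powr p))"
      by (rule ennreal_suminf_cmult[symmetric])
    also have "\<dots> = (\<Sum>n. ennreal (w n) * ennreal ((1 - cmod z) powr (p - 2) * cmod (T' n z) powr p))"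
      using w(1) by (simp add: ennreal_mult mult_ac)
    finally show "ennreal ((1 - cmod z) powr (p - 2) * cmod (deriv f z) powr p) \<le> \<dots>" .
  qed
  also have "\<dots> = (\<Sum>n. \<integral>\<^sup>+z. ennreal (w n) * ennreal ((1 - cmod z) powr (p - 2) * cmod (T' n z) powr p) \<partial>disc_area)"
    by (rule nn_integral_suminf) measurable
  also have "\<dots> \<le> (\<Sum>n. ennreal (w n * C))"
  proof (intro suminf_le allI)
    fix n
    have "(\<integral>\<^sup>+z. ennreal (w n) * ennreal ((1 - cmod z) powr (p - 2) * cmod (T' n z) powr p) \<partial>disc_area)
      = ennreal (w n) * (\<integral>\<^sup>+z. ennreal ((1 - cmod z) powr (p - 2) * cmod (T' n z) powr p) \<partial>disc_area)"
      by (rule nn_integral_cmult) measurable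
    also have "\<dots> \<le> ennreal (w n) * ennreal C"
      unfolding T'_def by (intro mult_left_mono C(2) a) simp
    also have "\<dots> = ennreal (w n * C)"
      by (rule ennreal_mult[symmetric]) (use w C in auto)
    finally show "(\<integral>\<^sup>+z. ennreal (w n) * ennreal ((1 - cmod z) powr (p - 2) * cmod (T' n z) powr p) \<partial>disc_area) \<le> ennreal (w n * C)" .
  qed auto
  also have "\<dots> = ennreal (1 * C)"
    by (rule suminf_ennreal_eq[OF _ sums_mult2[OF w(2)]]) (use w C in auto)
  finally have fin: "(\<integral>\<^sup>+z. ennreal ((1 - cmod z) powr (p - 2) * cmod (deriv f z) powr p) \<partial>disc_area) < \<infinity>"
    by (rule le_less_trans) simp
  show ?thesis
  proof (rule that)
    show "f \<in> besov p" using holf fin by (simp add: besov_def)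
    show "\<forall>n. \<forall>z\<in>unit_disc. (1 / 2) ^ Suc n * Re (log_test p (a n) z) \<le> cmod (f z)"
    proof (intro allI ballI)
      fix n z assume z: "z \<in> unit_disc"
      have "(\<lambda>n. Re (of_real (w n) * log_test p (a n) z)) sums Re (f z)"
        by (rule sums_Re[OF ff(1)[OF z]])
      then have sr: "(\<lambda>n. w n * Re (log_test p (a n) z)) sums Re (f z)" by simp
      have "sum (\<lambda>n. w n * Re (log_test p (a n) z)) {n} \<le> (\<Sum>n. w n * Re (log_test p (a n) z))"
        by (rule sum_le_suminf) (use sr w(1) Re_log_test(2)[OF a z] in \<open>auto simp: sums_iff\<close>)
      also have "\<dots> = Re (f z)" by (rule sums_unique[OF sr, symmetric])
      also have "\<dots> \<le> cmod (f z)" by (rule complex_Re_le_cmod)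
      finally show "(1 / 2) ^ Suc n * Re (log_test p (a n) z) \<le> cmod (f z)" by (simp add: w_def)
    qed
  qed
qed

text \<open>Continuity is the right hypothesis here: the function it is applied to contains a real
  part and is not holomorphic in general.\<close>

lemma Q_mass_cmult:
  assumes h: "continuous_on unit_disc h"
  shows "Q_mass s (\<lambda>z. c * h z) a = ennreal ((cmod c)\<^sup>2) * Q_mass s h a"
proof -
  have [measurable]: "(\<lambda>z. indicator unit_disc z *\<^sub>R h z) \<in> borel_measurable borel"
    by (rule borel_measurable_continuous_on_indicator[OF _ h]) simp
  have "Q_mass s (\<lambda>z. c * h z) a = (\<integral>\<^sup>+z. ennreal ((cmod c)\<^sup>2) * ennreal ((cmod (indicator unit_disc z *\<^sub>R h z))\<^sup>2 * Q_weight s a z) \<partial>disc_area)"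
    unfolding Q_mass_def
    by (rule nn_integral_cong_AE, use AE_disc_area in eventually_elim)
      (simp add: norm_mult power_mult_distrib ennreal_mult mult_ac)
  also have "\<dots> = ennreal ((cmod c)\<^sup>2) * Q_mass s (\<lambda>z. indicator unit_disc z *\<^sub>R h z) a"
    unfolding Q_mass_def by (rule nn_integral_cmult) measurable
  finally show ?thesis unfolding Q_mass_indicator .
qed

section \<open>Necessity of the logarithmic condition\<close>

lemma log_test_mass_bounded:
  assumes p: "1 < p" "p \<le> 2" and s: "0 < s" "s < 1" and g: "g holomorphic_on unit_disc"
    and maps: "T_op g ` besov p \<subseteq> Q_space s"
  obtains B where "0 \<le> B"
    "\<And>a. a \<in> unit_disc \<Longrightarrow> Q_mass s (\<lambda>z. deriv g z * of_real (Re (log_test p a z))) a \<le> ennreal B"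
proof (rule ccontr)
  assume "\<not> thesis"
  let ?F = "\<lambda>a. Q_mass s (\<lambda>z. deriv g z * of_real (Re (log_test p a z))) a"
  \<comment> \<open>The growth \<open>8 ^ n\<close> outruns the squared coefficients
    \<open>(1 / 4) ^ Suc n\<close> of the series; their product \<open>2 ^ n / 4\<close> is still
    unbounded.\<close>
  have "\<exists>a. a \<in> unit_disc \<and> ennreal (8 ^ n) < ?F a" for n :: nat
  proof (rule ccontr)
    assume "\<not> (\<exists>a. a \<in> unit_disc \<and> ennreal (8 ^ n) < ?F a)"
    then have "?F a \<le> ennreal (8 ^ n)" if "a \<in> unit_disc" for a
      using that not_le by blast
    with \<open>\<not> thesis\<close> show False
      using that[of "8 ^ n", OF zero_le_power[OF zero_le_numeral]] by blast
  qed
  then have "\<exists>a. \<forall>n. a n \<in> unit_disc \<and> ennreal (8 ^ n) < ?F (a n)"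
    by (intro choice allI)
  then obtain a where ab: "\<forall>n. a n \<in> unit_disc \<and> ennreal (8 ^ n) < ?F (a n)"
    by (rule exE)
  have a: "a n \<in> unit_disc" and big: "ennreal (8 ^ n) < ?F (a n)" for n
    using spec[OF ab, of n] by (rule conjunct1, rule conjunct2)
  obtain f where f: "f \<in> besov p"
    "\<forall>n. \<forall>z\<in>unit_disc. (1 / 2) ^ Suc n * Re (log_test p (a n) z) \<le> cmod (f z)"
    by (rule log_test_series[OF p a])
  have holf: "f holomorphic_on unit_disc" using f(1) by (simp add: besov_def)
  have "T_op g f \<in> Q_space s" using maps f(1) by blast
  then have "(SUP a\<in>unit_disc. Q_mass s (deriv (T_op g f)) a) < \<infinity>" by (simp add: Q_space_iff[OF s])
  then obtain N where N: "0 \<le> N" "\<And>a. a \<in> unit_disc \<Longrightarrow> Q_mass s (deriv (T_op g f)) a \<le> ennreal N"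
    using SUP_finiteE by blast
  have "2 ^ n \<le> 4 * N" for n :: nat
  proof -
    define R where "R z = deriv g z * of_real (Re (log_test p (a n) z))" for z
    define c :: real where "c = (1 / 2) ^ Suc n"
    have contR: "continuous_on unit_disc R"
    proof -
      have "log_test p (a n) holomorphic_on unit_disc"
        unfolding holomorphic_on_open[OF open_ball] using has_field_derivative_log_test[OF a] by blast
      then show ?thesis
        unfolding R_def
        by (intro continuous_intros holomorphic_on_imp_continuous_on holomorphic_deriv[OF g open_ball])
    qed
    have "ennreal (c\<^sup>2 * 8 ^ n) = ennreal (c\<^sup>2) * ennreal (8 ^ n)" by (rule ennreal_mult) auto
    also have "\<dots> \<le> ennreal (c\<^sup>2) * Q_mass s R (a n)"
      using big[of n] unfolding R_def by (intro mult_left_mono) auto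
    also have "\<dots> = Q_mass s (\<lambda>z. of_real c * R z) (a n)"
      by (subst Q_mass_cmult[OF contR]) simp
    also have "\<dots> \<le> Q_mass s (\<lambda>z. deriv g z * f z) (a n)"
    proof (rule Q_mass_mono)
      fix z assume z: "z \<in> unit_disc"
      have "0 \<le> c" by (simp add: c_def)
      then have "cmod (of_real c * R z) = cmod (deriv g z) * (c * Re (log_test p (a n) z))"
        using Re_log_test(2)[OF a z, of p n] by (simp add: R_def norm_mult)
      also have "\<dots> \<le> cmod (deriv g z) * cmod (f z)"
        unfolding c_def by (intro mult_left_mono f(2)[rule_format] z) simp
      finally show "cmod (of_real c * R z) \<le> cmod (deriv g z * f z)" by (simp add: norm_mult)
    qed
    also have "\<dots> \<le> ennreal N"
      using N(2)[OF a] T_op_Q_mass[OF g holf] by simp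
    finally have "c\<^sup>2 * 8 ^ n \<le> N" using N(1) by simp
    moreover have "c\<^sup>2 * 8 ^ n = 2 ^ n / 4"
    proof -
      have "c\<^sup>2 = (1 / 4) ^ Suc n" unfolding c_def by (simp add: power2_eq_square flip: power_mult_distrib)
      moreover have "(1 / 4 :: real) ^ n * 8 ^ n = 2 ^ n" by (simp flip: power_mult_distrib)
      ultimately show ?thesis by (simp only: power_Suc mult.assoc)
    qed
    ultimately show ?thesis by simp
  qed
  moreover obtain n where "4 * N < 2 ^ n" using real_arch_pow[of 2 "4 * N"] by auto
  ultimately show False by (meson not_le)
qed

lemma Q_log_of_maps:
  assumes p: "1 < p" "p \<le> 2" and s: "0 < s" "s < 1" and g: "g holomorphic_on unit_disc"
    and maps: "T_op g ` besov p \<subseteq> Q_space s" and q: "1 / p + 1 / q = 1"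
  shows "g \<in> Q_log_space s (1 / q)"
proof -
  have dg: "deriv g holomorphic_on unit_disc" by (rule holomorphic_deriv[OF g open_ball])
  obtain B where B: "0 \<le> B"
    "\<And>a. a \<in> unit_disc \<Longrightarrow> Q_mass s (\<lambda>z. deriv g z * of_real (Re (log_test p a z))) a \<le> ennreal B"
    using log_test_mass_bounded[OF p s g maps] by blast
  \<comment> \<open>Testing the constant function shows that the masses of \<open>deriv g\<close>
    are bounded, which the estimate of the logarithmic defect requires.\<close>
  have "(\<lambda>_. 1) \<in> besov p" by (simp add: besov_def)
  then have "T_op g (\<lambda>_. 1) \<in> Q_space s" using maps by blast
  then have "(SUP a\<in>unit_disc. Q_mass s (deriv (T_op g (\<lambda>_. 1))) a) < \<infinity>" by (simp add: Q_space_iff[OF s])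
  then obtain M where M: "0 \<le> M" "\<And>a. a \<in> unit_disc \<Longrightarrow> Q_mass s (deriv g) a \<le> ennreal M"
    unfolding T_op_Q_mass[OF g holomorphic_on_const] mult_1_right using SUP_finiteE by blast
  obtain C where C: "0 \<le> C" "\<And>a. a \<in> unit_disc \<Longrightarrow>
    (\<integral>\<^sup>+z. ennreal ((cmod (deriv g z))\<^sup>2 * (Q_weight s a z * (ln (kernel_norm a z / (1 - cmod a)))\<^sup>2)) \<partial>disc_area) \<le> ennreal C"
    using log_moment_bound[OF s dg M] by blast
  define K where "K = ln 2 powr (- 2 / p)"
  have bound: "ennreal (log_weight a powr (2 * (1 / q))) * Q_mass s (deriv g) a \<le> ennreal (2 * B + 2 * K * C)" if a: "a \<in> unit_disc" for a
  proof -
    define L where "L = log_weight a"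
    have L: "ln 2 \<le> L" "0 < L" using log_weight_ge[OF a] log_weight_pos[OF a] by (simp_all add: L_def)
    define H where "H z = indicator unit_disc z *\<^sub>R deriv g z" for z
    have Hm[measurable]: "H \<in> borel_measurable borel"
      unfolding H_def by (rule borel_measurable_indicator_holomorphic[OF dg])
    define U where "U z = L powr (- 1 / p) * (ln 2 - ln (kernel_norm a z))" for z
    define V where "V z = ln (kernel_norm a z / (1 - cmod a))" for z
    have [measurable]: "U \<in> borel_measurable borel" "V \<in> borel_measurable borel"
      unfolding U_def V_def by measurable
    have QH: "Q_mass s (deriv g) a = Q_mass s H a" unfolding H_def Q_mass_indicator ..
    have "ennreal (L powr (2 * (1 / q))) * Q_mass s (deriv g) a
      = (\<integral>\<^sup>+z. ennreal (L powr (2 * (1 / q))) * ennreal ((cmod (H z))\<^sup>2 * Q_weight s a z) \<partial>disc_area)"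
      unfolding QH unfolding Q_mass_def by (rule nn_integral_cmult[symmetric]) measurable
    also have "\<dots> \<le> (\<integral>\<^sup>+z. ennreal 2 * ennreal ((cmod (H z))\<^sup>2 * (Q_weight s a z * (U z)\<^sup>2)) + ennreal (2 * K) * ennreal ((cmod (H z))\<^sup>2 * (Q_weight s a z * (V z)\<^sup>2)) \<partial>disc_area)"
    proof (rule nn_integral_mono_AE, use AE_disc_area in eventually_elim)
      fix z assume z: "z \<in> unit_disc"
      define G where "G = (cmod (H z))\<^sup>2 * Q_weight s a z"
      have G: "0 \<le> G" by (simp add: G_def)
      define y where "y = ln 2 - ln (kernel_norm a z)"
      have k: "0 < kernel_norm a z" by (rule unit_disc_kernel(4)[OF a z])
      \<comment> \<open>The large constant \<open>L\<close> splits into the unnormalised test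
        function \<open>y\<close> and the defect \<open>V z\<close>, valid on the whole disc, so no
        restriction to a neighbourhood of \<open>a\<close> is needed.\<close>
      have "L = y + V z"
        using k a by (simp add: L_def log_weight_def y_def V_def ln_div)
      then have "L\<^sup>2 \<le> 2 * y\<^sup>2 + 2 * (V z)\<^sup>2"
        using zero_le_power2[of "y - V z"] by (simp add: power2_sum power2_diff)
      \<comment> \<open>The conjugate exponent enters here: \<open>2 / q = 2 - 2 / p\<close>, where
        \<open>L\<^sup>2\<close> is split by the preceding line and \<open>L powr (- 2 / p)\<close>
        is the squared normalising factor.\<close>
      moreover have "L powr (2 * (1 / q)) = L powr (- 2 / p) * L\<^sup>2"
      proof -
        have "2 * (1 / q) = - 2 / p + 2" using q by simp
        then have "L powr (2 * (1 / q)) = L powr (- 2 / p) * L powr 2" by (simp only: powr_add)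
        then show ?thesis using L by simp
      qed
      ultimately have "L powr (2 * (1 / q)) \<le> L powr (- 2 / p) * (2 * y\<^sup>2 + 2 * (V z)\<^sup>2)"
        by (simp add: mult_left_mono)
      also have "\<dots> = 2 * (L powr (- 2 / p) * y\<^sup>2) + 2 * (L powr (- 2 / p) * (V z)\<^sup>2)" by (simp add: algebra_simps)
      also have "L powr (- 2 / p) * y\<^sup>2 = (U z)\<^sup>2"
      proof -
        have "(L powr (- 1 / p))\<^sup>2 = L powr (- 2 / p)" by (simp add: power2_eq_square flip: powr_add)
        then show ?thesis by (simp add: U_def y_def power_mult_distrib)
      qed
      \<comment> \<open>The defect term does not need the decay of \<open>L powr (- 2 / p)\<close>;
        bounding it by its value \<open>K\<close> at \<open>ln 2\<close> is enough.\<close>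
      also have "2 * (U z)\<^sup>2 + 2 * (L powr (- 2 / p) * (V z)\<^sup>2) \<le> 2 * (U z)\<^sup>2 + 2 * (K * (V z)\<^sup>2)"
        unfolding K_def using L p by (intro add_left_mono mult_left_mono mult_right_mono powr_mono2') auto
      finally have "L powr (2 * (1 / q)) * G \<le> (2 * (U z)\<^sup>2 + 2 * (K * (V z)\<^sup>2)) * G"
        using G by (rule mult_right_mono)
      also have "\<dots> = 2 * ((cmod (H z))\<^sup>2 * (Q_weight s a z * (U z)\<^sup>2)) + 2 * K * ((cmod (H z))\<^sup>2 * (Q_weight s a z * (V z)\<^sup>2))"
        by (simp add: G_def algebra_simps)
      finally have "ennreal (L powr (2 * (1 / q)) * G) \<le> ennreal (2 * ((cmod (H z))\<^sup>2 * (Q_weight s a z * (U z)\<^sup>2)) + 2 * K * ((cmod (H z))\<^sup>2 * (Q_weight s a z * (V z)\<^sup>2)))"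
        by (rule ennreal_leI)
      also have "\<dots> = ennreal (2 * ((cmod (H z))\<^sup>2 * (Q_weight s a z * (U z)\<^sup>2))) + ennreal (2 * K * ((cmod (H z))\<^sup>2 * (Q_weight s a z * (V z)\<^sup>2)))"
        by (rule ennreal_plus) (auto simp: K_def)
      also have "ennreal (2 * ((cmod (H z))\<^sup>2 * (Q_weight s a z * (U z)\<^sup>2))) = ennreal 2 * ennreal ((cmod (H z))\<^sup>2 * (Q_weight s a z * (U z)\<^sup>2))"
        by (rule ennreal_mult) auto
      also have "ennreal (2 * K * ((cmod (H z))\<^sup>2 * (Q_weight s a z * (V z)\<^sup>2))) = ennreal (2 * K) * ennreal ((cmod (H z))\<^sup>2 * (Q_weight s a z * (V z)\<^sup>2))"
        by (rule ennreal_mult) (auto simp: K_def)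
      also have "ennreal (L powr (2 * (1 / q)) * G) = ennreal (L powr (2 * (1 / q))) * ennreal G"
        by (rule ennreal_mult) (use G in auto)
      finally show "ennreal (L powr (2 * (1 / q))) * ennreal ((cmod (H z))\<^sup>2 * Q_weight s a z)
        \<le> ennreal 2 * ennreal ((cmod (H z))\<^sup>2 * (Q_weight s a z * (U z)\<^sup>2)) + ennreal (2 * K) * ennreal ((cmod (H z))\<^sup>2 * (Q_weight s a z * (V z)\<^sup>2))"
        unfolding G_def .
    qed
    also have "\<dots> = ennreal 2 * (\<integral>\<^sup>+z. ennreal ((cmod (H z))\<^sup>2 * (Q_weight s a z * (U z)\<^sup>2)) \<partial>disc_area)
      + ennreal (2 * K) * (\<integral>\<^sup>+z. ennreal ((cmod (H z))\<^sup>2 * (Q_weight s a z * (V z)\<^sup>2)) \<partial>disc_area)"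
      by (subst nn_integral_add, measurable, subst nn_integral_cmult, measurable, subst nn_integral_cmult, measurable)
    also have "(\<integral>\<^sup>+z. ennreal ((cmod (H z))\<^sup>2 * (Q_weight s a z * (U z)\<^sup>2)) \<partial>disc_area)
      = Q_mass s (\<lambda>z. deriv g z * of_real (Re (log_test p a z))) a"
      unfolding Q_mass_def
    proof (rule nn_integral_cong_AE, use AE_disc_area in eventually_elim)
      fix z assume z: "z \<in> unit_disc"
      have "U z = Re (log_test p a z)" unfolding Re_log_test(1)[OF a z] U_def L_def ..
      then show "ennreal ((cmod (H z))\<^sup>2 * (Q_weight s a z * (U z)\<^sup>2)) = ennreal ((cmod (deriv g z * of_real (Re (log_test p a z))))\<^sup>2 * Q_weight s a z)"
        using z by (simp add: H_def norm_mult power_mult_distrib mult_ac)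
    qed
    also have "(\<integral>\<^sup>+z. ennreal ((cmod (H z))\<^sup>2 * (Q_weight s a z * (V z)\<^sup>2)) \<partial>disc_area)
      = (\<integral>\<^sup>+z. ennreal ((cmod (deriv g z))\<^sup>2 * (Q_weight s a z * (V z)\<^sup>2)) \<partial>disc_area)"
      by (rule nn_integral_cong_AE, use AE_disc_area in eventually_elim) (simp add: H_def)
    also have "ennreal 2 * Q_mass s (\<lambda>z. deriv g z * of_real (Re (log_test p a z))) a
       + ennreal (2 * K) * (\<integral>\<^sup>+z. ennreal ((cmod (deriv g z))\<^sup>2 * (Q_weight s a z * (V z)\<^sup>2)) \<partial>disc_area)
       \<le> ennreal 2 * ennreal B + ennreal (2 * K) * ennreal C"
      unfolding V_def by (intro add_mono mult_left_mono B(2) C(2) a) auto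
    also have "\<dots> = ennreal (2 * B) + ennreal (2 * K * C)"
      using B(1) C(1) by (subst (1 2) ennreal_mult) (auto simp: K_def)
    also have "\<dots> = ennreal (2 * B + 2 * K * C)"
      by (rule ennreal_plus[symmetric]) (use B C in \<open>auto simp: K_def\<close>)
    finally show ?thesis unfolding L_def .
  qed
  have "(SUP a\<in>unit_disc. ennreal (log_weight a powr (2 * (1 / q))) * Q_mass s (deriv g) a) \<le> ennreal (2 * B + 2 * K * C)"
    by (rule SUP_least[OF bound])
  also have "\<dots> < \<infinity>" by simp
  finally show ?thesis
    using g by (simp add: Q_log_space_def log_weight_def Q_mass_def Q_weight_def)
qed

theorem theorem2p5:
  fixes p p' s :: real and g :: "complex \<Rightarrow> complex"
  assumes "1 < p" and "p \<le> 2" and "0 < s" and "s < 1"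
    and "1 / p + 1 / p' = 1"
    and "g holomorphic_on unit_disc"
  shows "(T_op g ` besov p \<subseteq> Q_space s \<longrightarrow> g \<in> Q_log_space s (1 / p')) \<and>
    (\<forall>\<alpha>::real. \<alpha> > 1 / 2 \<and> g \<in> Q_log_space s \<alpha> \<longrightarrow> T_op g ` besov p \<subseteq> Q_space s)"
proof (intro conjI allI impI image_subsetI)
  assume "T_op g ` besov p \<subseteq> Q_space s"
  then show "g \<in> Q_log_space s (1 / p')"
    using assms by (intro Q_log_of_maps)
next
  fix \<alpha> :: real and f
  assume "\<alpha> > 1 / 2 \<and> g \<in> Q_log_space s \<alpha>" and "f \<in> besov p"
  then show "T_op g f \<in> Q_space s"
    using assms by (auto intro: T_op_maps_besov_Q)
qed

end
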